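(* Let $T'\in\mathcal{L}(\mathcal{H})$ be an arbitrary operator, let $\varepsilon>0$ be arbitrary, and let $\mathcal{J}(\mathcal{H})$ be a proper ideal of $\mathcal{L}(\mathcal{H})$ strictly larger than the ideal $\mathbb{F}$ of finite-rank operators. Then there exist a scalar $\beta\in\mathbb{C}$, an invertible operator $S\in\mathcal{L}(\mathcal{H})$, and infinite dimensional (closed) mutually orthogonal subspaces $\mathcal{M}_1,\mathcal{M}_2,\mathcal{M}_3$ of $\mathcal{H}$ such that $\mathcal{M}_1\oplus\mathcal{M}_2\oplus\mathcal{M}_3=\mathcal{H}$ and such that the matrix of $S^{-1}(T'-\beta 1_{\mathcal{H}})S$ relative to this decomposition has the form $$\begin{pmatrix} T_{1,1} & T_{1,2} & T_{1,3}\\ R_{2,1} & T_{2,2} & T_{2,3}\\ R_{3,1} & R_{3,2} & T_{3,3}\end{pmatrix},$$ where: (a) $T_{1,1}\in\mathcal{J}(\mathcal{M}_1)$, $T_{3,3}\in\mathcal{J}(\mathcal{M}_3)$, $\|T_{1,1}\|<\varepsilon$, and $\|T_{3,3}\|<\varepsilon$; (b) $R_{2,1}$, $R_{3,1}$, and $R_{3,2}$ are operators of rank at most one; (c) $T_{1,1}$ and $T_{3,3}$ are diagonalizable normal operators.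
   Context: $\mathcal{H}$ is a separable, infinite dimensional, complex Hilbert space; $\mathcal{L}(\mathcal{H})$ is the algebra of all bounded linear operators on $\mathcal{H}$; $1_{\mathcal{H}}$ is the identity operator; $\mathbb{F}$ is the ideal of finite-rank operators. "Ideal" means two-sided ideal (not necessarily norm closed). For any separable infinite dimensional Hilbert space $\mathcal{K}$, $\mathcal{J}(\mathcal{K})$ is the ideal of $\mathcal{L}(\mathcal{K})$ obtained from $\mathcal{J}(\mathcal{H})$ by identifying $\mathcal{K}$ with $\mathcal{H}$ via a Hilbert space isomorphism. An operator on a Hilbert space is a diagonalizable normal operator if there is an orthonormal basis of the space consisting of its eigenvectors. *)

theory Defs
  imports "HOL-Analysis.Analysis" "HOL-Algebra.Ideal"
begin

section \<open>Complex Hilbert spaces\<close>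

text \<open>The inner product is linear in the first argument. Definiteness follows from
  \<open>norm_eq_sqrt_cinner\<close>, completeness is part of \<^class>\<open>banach\<close>.\<close>

class complex_hilbert_space = banach +
  fixes scaleC :: "complex \<Rightarrow> 'a \<Rightarrow> 'a" (infixr "*\<^sub>C" 75)
    and cinner :: "'a \<Rightarrow> 'a \<Rightarrow> complex"
  assumes scaleC_add_right: "a *\<^sub>C (x + y) = a *\<^sub>C x + a *\<^sub>C y"
    and scaleC_add_left: "(a + b) *\<^sub>C x = a *\<^sub>C x + b *\<^sub>C x"
    and scaleC_scaleC: "a *\<^sub>C (b *\<^sub>C x) = (a * b) *\<^sub>C x"
    and scaleC_one: "1 *\<^sub>C x = x"
    and scaleR_scaleC: "r *\<^sub>R x = complex_of_real r *\<^sub>C x"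
    and cinner_commute: "cinner x y = cnj (cinner y x)"
    and cinner_add_left: "cinner (x + y) z = cinner x z + cinner y z"
    and cinner_scaleC_left: "cinner (a *\<^sub>C x) y = a * cinner x y"
    and norm_eq_sqrt_cinner: "norm x = sqrt (Re (cinner x x))"

global_interpretation complex_vector:
  vector_space "scaleC :: complex \<Rightarrow> 'a \<Rightarrow> 'a::complex_hilbert_space"
  defines csubspace = complex_vector.subspace
    and cspan = complex_vector.span
  by unfold_locales (auto simp: scaleC_add_right scaleC_add_left scaleC_scaleC scaleC_one)

abbreviation clinear ::
  "('a::complex_hilbert_space \<Rightarrow> 'b::complex_hilbert_space) \<Rightarrow> bool"
  where "clinear \<equiv> Vector_Spaces.linear scaleC scaleC"

definition infinite_cdim :: "'a::complex_hilbert_space set \<Rightarrow> bool"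
  where "infinite_cdim M \<longleftrightarrow> \<not> (\<exists>B. finite B \<and> M \<subseteq> cspan B)"

definition orthonormal :: "'a::complex_hilbert_space set \<Rightarrow> bool"
  where "orthonormal E \<longleftrightarrow> (\<forall>e\<in>E. \<forall>f\<in>E. cinner e f = (if e = f then 1 else 0))"

definition orthonormal_basis_of ::
  "'a::complex_hilbert_space set \<Rightarrow> 'a set \<Rightarrow> bool"
  where "orthonormal_basis_of E M \<longleftrightarrow> orthonormal E \<and> closure (cspan E) = M"

definition mutually_orthogonal ::
  "'a::complex_hilbert_space set \<Rightarrow> 'a set \<Rightarrow> bool"
  where "mutually_orthogonal M N \<longleftrightarrow> (\<forall>x\<in>M. \<forall>y\<in>N. cinner x y = 0)"

definition closed_csubspace :: "'a::complex_hilbert_space set \<Rightarrow> bool"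
  where "closed_csubspace M \<longleftrightarrow> csubspace M \<and> closed M"

definition orth_proj :: "'a::complex_hilbert_space set \<Rightarrow> 'a \<Rightarrow> 'a"
  where "orth_proj M x = (THE p. p \<in> M \<and> (\<forall>z\<in>M. cinner (x - p) z = 0))"


section \<open>Bounded operators and ideals\<close>

definition bounded_clinear ::
  "('a::complex_hilbert_space \<Rightarrow> 'b::complex_hilbert_space) \<Rightarrow> bool"
  where "bounded_clinear A \<longleftrightarrow> clinear A \<and> (\<exists>K. \<forall>x. norm (A x) \<le> norm x * K)"

definition bounded_operators ::
  "('a::complex_hilbert_space \<Rightarrow> 'a) ring" ("\<L>")
  where "\<L> = \<lparr>carrier = {A. bounded_clinear A}, mult = (\<circ>), one = id,
           zero = (\<lambda>x. 0), add = (\<lambda>A B x. A x + B x)\<rparr>"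

definition rank_le ::
  "nat \<Rightarrow> 'a::complex_hilbert_space set \<Rightarrow> ('a \<Rightarrow> 'a) \<Rightarrow> bool"
  where "rank_le n M A \<longleftrightarrow> (\<exists>B. finite B \<and> card B \<le> n \<and> A ` M \<subseteq> cspan B)"

definition finite_rank_operators :: "('a::complex_hilbert_space \<Rightarrow> 'a) set" ("\<F>")
  where "\<F> = {A \<in> carrier \<L>. \<exists>n. rank_le n UNIV A}"


section \<open>Operators on and between closed subspaces\<close>

text \<open>An operator with domain a subspace \<open>N\<close> is represented by a function on the whole type
  that is \<^const>\<open>undefined\<close> outside \<open>N\<close>, as in \<^const>\<open>restrict\<close>.\<close>

definition matrix_entry ::
  "'a::complex_hilbert_space set \<Rightarrow> 'a set \<Rightarrow> ('a \<Rightarrow> 'a) \<Rightarrow> 'a \<Rightarrow> 'a"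
  where "matrix_entry M N A = (\<lambda>x\<in>N. orth_proj M (A x))"

text \<open>Same convention as \<^const>\<open>onorm\<close>, with the supremum over the subspace only.\<close>

definition onorm_on :: "'a::complex_hilbert_space set \<Rightarrow> ('a \<Rightarrow> 'a) \<Rightarrow> real"
  where "onorm_on M A = (SUP x\<in>M. norm (A x) / norm x)"

definition diagonalizable_normal_on ::
  "'a::complex_hilbert_space set \<Rightarrow> ('a \<Rightarrow> 'a) \<Rightarrow> bool"
  where "diagonalizable_normal_on M A \<longleftrightarrow>
    (\<exists>E. orthonormal_basis_of E M \<and> (\<forall>e\<in>E. \<exists>c. A e = c *\<^sub>C e))"

definition hilbert_iso_onto ::
  "('a::complex_hilbert_space \<Rightarrow> 'a) \<Rightarrow> 'a set \<Rightarrow> bool"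
  where "hilbert_iso_onto U K \<longleftrightarrow>
    clinear U \<and> (\<forall>x y. cinner (U x) (U y) = cinner x y) \<and> range U = K"

definition transport_op :: "('a \<Rightarrow> 'a) \<Rightarrow> 'a set \<Rightarrow> ('a \<Rightarrow> 'a) \<Rightarrow> 'a \<Rightarrow> 'a"
  where "transport_op U K B = (\<lambda>y\<in>K. U (B (inv_into UNIV U y)))"

text \<open>The ideal of operators on \<open>K\<close> corresponding to \<open>J\<close>. By \<open>ideal_on_eq\<close> below, it is
  already obtained from any single isomorphism \<open>U\<close>.\<close>

definition ideal_on ::
  "('a::complex_hilbert_space \<Rightarrow> 'a) set \<Rightarrow> 'a set \<Rightarrow> ('a \<Rightarrow> 'a) set"
  where "ideal_on J K = {transport_op U K B | U B. hilbert_iso_onto U K \<and> B \<in> J}"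


section \<open>Basic facts\<close>

lemma bounded_clinearI:
  assumes "\<And>x y. A (x + y) = A x + A y" "\<And>c x. A (c *\<^sub>C x) = c *\<^sub>C A x"
    and "\<And>x. norm (A x) \<le> norm x * K"
  shows "bounded_clinear A"
  unfolding bounded_clinear_def Vector_Spaces.linear_iff
  by (intro conjI allI exI[of _ K] complex_vector.vector_space_axioms assms)

lemma bounded_clinear_add: "bounded_clinear A \<Longrightarrow> A (x + y) = A x + A y"
  unfolding bounded_clinear_def by (meson Vector_Spaces.linear_iff)

lemma bounded_clinear_scaleC: "bounded_clinear A \<Longrightarrow> A (c *\<^sub>C x) = c *\<^sub>C A x"
  unfolding bounded_clinear_def by (meson Vector_Spaces.linear_iff)

lemma bounded_clinear_bound:
  assumes "bounded_clinear A"
  obtains K where "K \<ge> 0" "\<And>x. norm (A x) \<le> norm x * K"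
proof -
  obtain K where K: "\<And>x. norm (A x) \<le> norm x * K"
    using assms unfolding bounded_clinear_def by blast
  have "norm (A x) \<le> norm x * max K 0" for x
    using K[of x] mult_left_mono[of K "max K 0" "norm x"] by simp
  then show thesis using that[of "max K 0"] by simp
qed

lemma bounded_clinear_plus:
  assumes A: "bounded_clinear A" and B: "bounded_clinear B"
  shows "bounded_clinear (\<lambda>x. A x + B x)"
proof -
  obtain K L where "\<And>x. norm (A x) \<le> norm x * K" "\<And>x. norm (B x) \<le> norm x * L"
    using A B by (metis bounded_clinear_bound)
  then have "norm (A x + B x) \<le> norm x * (K + L)" for x
    by (metis (no_types) norm_triangle_mono distrib_left)
  then show ?thesis
    using A B by (intro bounded_clinearI)
      (simp_all add: bounded_clinear_add bounded_clinear_scaleC scaleC_add_right)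
qed

lemma bounded_clinear_comp:
  assumes A: "bounded_clinear A" and B: "bounded_clinear B"
  shows "bounded_clinear (A \<circ> B)"
proof -
  obtain K L where K: "K \<ge> 0" "\<And>x. norm (A x) \<le> norm x * K"
    and L: "\<And>x. norm (B x) \<le> norm x * L"
    using A B by (metis bounded_clinear_bound)
  have "norm (A (B x)) \<le> norm x * (L * K)" for x
    using K(2)[of "B x"] mult_right_mono[OF L[of x] K(1)] by (simp add: mult.assoc)
  then show ?thesis
    using A B by (intro bounded_clinearI)
      (simp_all add: bounded_clinear_add bounded_clinear_scaleC)
qed

lemma bounded_clinear_uminus:
  assumes A: "bounded_clinear A"
  shows "bounded_clinear (\<lambda>x. - A x)"
proof -
  obtain K where "\<And>x. norm (A x) \<le> norm x * K"
    using A by (metis bounded_clinear_bound)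
  then show ?thesis
    using A by (intro bounded_clinearI[where K = K])
      (simp_all add: bounded_clinear_add bounded_clinear_scaleC)
qed

lemma bounded_clinear_id: "bounded_clinear id"
  by (rule bounded_clinearI[where K = 1]) simp_all

lemma bounded_clinear_zero: "bounded_clinear (\<lambda>x. 0)"
  by (rule bounded_clinearI[where K = 0]) simp_all

lemma ring_bounded_operators: "ring (\<L> :: ('a::complex_hilbert_space \<Rightarrow> 'a) ring)"
proof (rule ringI)
  show "abelian_group (\<L> :: ('a \<Rightarrow> 'a) ring)"
  proof (rule abelian_groupI)
    fix A :: "'a \<Rightarrow> 'a" assume "A \<in> carrier \<L>"
    then show "\<exists>B\<in>carrier \<L>. B \<oplus>\<^bsub>\<L>\<^esub> A = \<zero>\<^bsub>\<L>\<^esub>"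
      using bounded_clinear_uminus[of A]
      by (intro bexI[of _ "\<lambda>x. - A x"]) (auto simp: bounded_operators_def)
  qed (auto simp: bounded_operators_def bounded_clinear_plus bounded_clinear_zero ac_simps)
  show "monoid (\<L> :: ('a \<Rightarrow> 'a) ring)"
    by (rule monoidI)
      (auto simp: bounded_operators_def bounded_clinear_comp bounded_clinear_id comp_assoc)
qed (auto simp: bounded_operators_def bounded_clinear_add fun_eq_iff)

lemma hilbert_iso_onto_norm: "hilbert_iso_onto U K \<Longrightarrow> norm (U x) = norm x"
  by (simp add: hilbert_iso_onto_def norm_eq_sqrt_cinner)

lemma hilbert_iso_onto_bounded: "hilbert_iso_onto U K \<Longrightarrow> bounded_clinear U"
  unfolding bounded_clinear_def using hilbert_iso_onto_norm[of U K]
  by (auto simp: hilbert_iso_onto_def intro!: exI[of _ 1])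

lemma hilbert_iso_onto_inj:
  assumes U: "hilbert_iso_onto U K"
  shows "inj U"
proof (rule injI)
  fix x y assume eq: "U x = U y"
  have "U (x - y) + U y = U x"
    using bounded_clinear_add[OF hilbert_iso_onto_bounded[OF U], of "x - y" y] by simp
  then have "norm (x - y) = 0"
    using eq hilbert_iso_onto_norm[OF U, of "x - y"] by simp
  then show "x = y" by simp
qed

lemma bounded_clinear_iso_change:
  assumes U: "hilbert_iso_onto U K" and V: "hilbert_iso_onto V K"
  shows "bounded_clinear (\<lambda>x. inv_into UNIV U (V x))"
    and "U (inv_into UNIV U (V x)) = V x"
proof -
  have r: "U (inv_into UNIV U (V x)) = V x" for x
    using U V by (intro f_inv_into_f) (auto simp: hilbert_iso_onto_def)
  then show "U (inv_into UNIV U (V x)) = V x" .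
  note bU = hilbert_iso_onto_bounded[OF U] and bV = hilbert_iso_onto_bounded[OF V]
  show "bounded_clinear (\<lambda>x. inv_into UNIV U (V x))"
  proof (rule bounded_clinearI[where K = 1])
    fix x y c
    show "inv_into UNIV U (V (x + y)) = inv_into UNIV U (V x) + inv_into UNIV U (V y)"
      by (rule injD[OF hilbert_iso_onto_inj[OF U]])
        (simp add: r bounded_clinear_add[OF bU] bounded_clinear_add[OF bV, symmetric])
    show "inv_into UNIV U (V (c *\<^sub>C x)) = c *\<^sub>C inv_into UNIV U (V x)"
      by (rule injD[OF hilbert_iso_onto_inj[OF U]])
        (simp add: r bounded_clinear_scaleC[OF bU] bounded_clinear_scaleC[OF bV, symmetric])
    show "norm (inv_into UNIV U (V x)) \<le> norm x * 1"
      using hilbert_iso_onto_norm[OF U, of "inv_into UNIV U (V x)"]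
        hilbert_iso_onto_norm[OF V, of x] by (simp add: r)
  qed
qed

lemma ideal_on_eq:
  assumes J: "ideal J \<L>" and U: "hilbert_iso_onto U K"
  shows "ideal_on J K = transport_op U K ` J"
proof
  show "transport_op U K ` J \<subseteq> ideal_on J K"
    using U by (auto simp: ideal_on_def)
  show "ideal_on J K \<subseteq> transport_op U K ` J"
  proof
    fix A assume "A \<in> ideal_on J K"
    then obtain V B where V: "hilbert_iso_onto V K" and B: "B \<in> J"
      and A: "A = transport_op V K B"
      by (auto simp: ideal_on_def)
    define W where "W = (\<lambda>x. inv_into UNIV U (V x))"
    define W' where "W' = (\<lambda>x. inv_into UNIV V (U x))"
    have W: "W \<in> carrier \<L>" "W' \<in> carrier \<L>"
      using bounded_clinear_iso_change(1)[OF U V] bounded_clinear_iso_change(1)[OF V U]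
      by (auto simp: W_def W'_def bounded_operators_def)
    have "W \<otimes>\<^bsub>\<L>\<^esub> (B \<otimes>\<^bsub>\<L>\<^esub> W') \<in> J"
      using W B J by (simp add: ideal.I_l_closed ideal.I_r_closed)
    then have C: "(\<lambda>x. W (B (W' x))) \<in> J"
      by (simp add: bounded_operators_def comp_def)
    have "U (inv_into UNIV U y) = y" if "y \<in> K" for y
      using U that by (intro f_inv_into_f) (auto simp: hilbert_iso_onto_def)
    then have "A = transport_op U K (\<lambda>x. W (B (W' x)))"
      unfolding A transport_op_def W_def W'_def
      by (intro restrict_ext) (simp add: bounded_clinear_iso_change(2)[OF U V])
    then show "A \<in> transport_op U K ` J" using C by blast
  qed
qed

end

theory Submission
  imports Defs "HOL-Complex_Analysis.Cauchy_Integral_Formula"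
begin

text \<open>Let \<open>\<beta>\<close> have maximal modulus among the points that are not Riesz points of \<open>T'\<close>, and
  \<open>A = T' - \<beta>\<close>. Then \<open>A - \<nu>\<close> is invertible for some arbitrarily small \<open>\<nu>\<close>. If the kernels of \<open>A\<close> and
  of its adjoint are both infinite dimensional, they provide \<open>\<M>\<^sub>1\<close> and \<open>\<M>\<^sub>3\<close>. Otherwise \<open>A\<close> or its
  adjoint has dense but not closed range on an invariant subspace, and by a Baire category argument
  there is a vector \<open>u\<close> whose resolvent orbit \<open>(A\<^sup>* - \<nu>\<^sub>n)\<^sup>-\<^sup>1 u\<close>, normalized, is weakly null with
  \<open>\<nu>\<^sub>n\<close> tending to \<open>0\<close> as fast as desired. Resolvent vectors are eigenvectors up to a multiple of \<open>u\<close>.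
  A rank one perturbation turns a subsequence of them into eigenvectors, and a second orbit yields the
  analogous sequence for \<open>A\<close>, orthogonal to the first one. Weakly null normalized sequences
  have subsequences close to orthonormal ones, so a similarity makes both sequences orthonormal, and
  four transvections \<open>1 + v \<otimes> z\<close> move the vectors of the rank one terms into the required subspaces.
  The eigenvalues are chosen so small that the diagonal operators lie in \<open>\<J>\<close>: if \<open>Q \<in> \<J>\<close> has infinite
  rank and maps an orthonormal sequence \<open>v\<^sub>n\<close> to nonzero orthogonal vectors, all diagonal
  operators with \<open>n\<close>-th entry bounded by \<open>\<parallel>Q v\<^sub>n\<parallel>\<close> lie in \<open>\<J>\<close>.\<close>

section \<open>Inner products and bounded operators\<close>

text \<open>The entries below the diagonal are controlled by vectors. Suppose that \<open>A\<close>
  sends each \<open>p n\<close> into the span of \<open>p n\<close>, \<open>e\<close> and \<psi>,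
  that the adjoint sends each \<open>q k\<close> into the span of \<open>q k\<close>,
  \<open>m\<close> and \<open>u\<close>, and that all \<open>p n\<close> are orthogonal to all
  \<open>q k\<close>. If u lies in the closed span of p, \<psi> in that of q, and e and m are
  orthogonal to both spans, then these spans and their common complement give diagonal corners,
  while the lower entries have ranges spanned by e, \<psi> and the third component of
  \<open>A m\<close>. The obstacle is the mutual orthogonality: resolvent orbits of an operator and
  of its adjoint, chosen independently, are unrelated. So one orbit is first made exact by
  subtracting \<psi> \<otimes> u, and the other one is sought in the closed span of eigenvectors of
  the perturbed operator for different eigenvalues, where orthogonality is automatic. The price is
  the term \<psi> \<otimes> u, which ends up in the corner below the other two entries. The extremal
  choice of \<beta> serves two opposite needs: invertible points must accumulate at 0, and yet
  \<open>A\<close> must not be invertible up to a finite dimensional piece.\<close>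

lemma cinner_add_right: "cinner x (y + z) = cinner x y + cinner x z"
  by (metis cinner_add_left cinner_commute complex_cnj_add)

lemma cinner_scaleC_right: "cinner x (a *\<^sub>C y) = cnj a * cinner x y"
  by (metis cinner_scaleC_left cinner_commute complex_cnj_mult)

lemma cinner_zero_left [simp]: "cinner 0 x = 0"
  by (metis add_cancel_right_left cinner_add_left)

lemma cinner_zero_right [simp]: "cinner x 0 = 0"
  by (metis add_cancel_right_left cinner_add_right)

lemma scaleC_minus1: "(-1) *\<^sub>C x = - x"
  by (metis complex_vector.scale_minus_left complex_vector.scale_one)

lemma cinner_minus_left: "cinner (- x) y = - cinner x y"
  by (metis add.right_inverse add_eq_0_iff cinner_add_left cinner_zero_left)

lemma cinner_minus_right: "cinner x (- y) = - cinner x y"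
  by (metis add.right_inverse add_eq_0_iff cinner_add_right cinner_zero_right)

lemma cinner_diff_left: "cinner (x - y) z = cinner x z - cinner y z"
  by (metis ab_group_add_class.ab_diff_conv_add_uminus cinner_add_left cinner_minus_left)

lemma cinner_diff_right: "cinner x (y - z) = cinner x y - cinner x z"
  by (metis ab_group_add_class.ab_diff_conv_add_uminus cinner_add_right cinner_minus_right)

lemmas cinner_simps = cinner_add_left cinner_add_right cinner_scaleC_left cinner_scaleC_right
  cinner_minus_left cinner_minus_right cinner_diff_left cinner_diff_right

lemma cinner_sum_left: "cinner (\<Sum>i\<in>I. f i) y = (\<Sum>i\<in>I. cinner (f i) y)"
  by (induction I rule: infinite_finite_induct) (auto simp: cinner_add_left)

lemma cinner_sum_right: "cinner y (\<Sum>i\<in>I. f i) = (\<Sum>i\<in>I. cinner y (f i))"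
  by (induction I rule: infinite_finite_induct) (auto simp: cinner_add_right)

lemma Re_cinner_self: "Re (cinner x x) = (norm x)\<^sup>2"
proof -
  have "0 \<le> norm x" by simp
  then have "0 \<le> Re (cinner x x)" unfolding norm_eq_sqrt_cinner by simp
  then show ?thesis unfolding norm_eq_sqrt_cinner by simp
qed

lemma cinner_self: "cinner x x = complex_of_real ((norm x)\<^sup>2)"
proof -
  have "Im (cinner x x) = 0" using arg_cong[OF cinner_commute[of x x], of Im] by simp
  then show ?thesis by (simp add: complex_eq_iff Re_cinner_self)
qed

lemma cinner_self_eq_0 [simp]: "cinner x x = 0 \<longleftrightarrow> x = 0"
  by (simp add: cinner_self)

lemma cinner_eq_0_commute: "cinner x y = 0 \<longleftrightarrow> cinner y x = 0"
  by (metis cinner_commute complex_cnj_zero)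

lemma cinner_ext_right: "(\<And>z. cinner z x = cinner z y) \<Longrightarrow> x = y"
  by (metis cinner_diff_right cinner_self_eq_0 right_minus_eq)

lemma norm_scaleC: "norm (a *\<^sub>C x) = cmod a * norm x"
proof -
  have "cinner (a *\<^sub>C x) (a *\<^sub>C x) = (a * cnj a) * cinner x x"
    by (simp only: cinner_scaleC_left cinner_scaleC_right mult_ac)
  also have "\<dots> = complex_of_real ((cmod a)\<^sup>2 * (norm x)\<^sup>2)"
    by (simp only: complex_norm_square cinner_self of_real_mult)
  finally have "Re (cinner (a *\<^sub>C x) (a *\<^sub>C x)) = (cmod a)\<^sup>2 * (norm x)\<^sup>2" by simp
  then have "(norm (a *\<^sub>C x))\<^sup>2 = (cmod a * norm x)\<^sup>2"
    by (simp add: Re_cinner_self power_mult_distrib)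
  then show ?thesis by (simp add: power2_eq_iff_nonneg)
qed

definition unitv :: "'a::complex_hilbert_space \<Rightarrow> 'a"
  where "unitv x = complex_of_real (1 / norm x) *\<^sub>C x"

lemma norm_unitv: "x \<noteq> 0 \<Longrightarrow> norm (unitv x) = 1"
  by (simp add: unitv_def norm_scaleC norm_divide)

lemma norm_add_sq: "(norm (x + y))\<^sup>2 = (norm x)\<^sup>2 + (norm y)\<^sup>2 + 2 * Re (cinner x y)"
proof -
  have "Re (cinner y x) = Re (cinner x y)" using arg_cong[OF cinner_commute[of y x], of Re] by simp
  then show ?thesis by (simp add: Re_cinner_self[symmetric] cinner_simps)
qed

lemma norm_diff_sq: "(norm (x - y))\<^sup>2 = (norm x)\<^sup>2 + (norm y)\<^sup>2 - 2 * Re (cinner x y)"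
  using norm_add_sq[of x "- y"] by (simp add: cinner_simps)

lemma parallelogram:
  fixes x y :: "'a::complex_hilbert_space"
  shows "(norm (x + y))\<^sup>2 + (norm (x - y))\<^sup>2 = 2 * (norm x)\<^sup>2 + 2 * (norm y)\<^sup>2"
  using norm_add_sq[of x y] norm_diff_sq[of x y] by linarith

lemma norm_add_sq_orth: "cinner x y = 0 \<Longrightarrow> (norm (x + y))\<^sup>2 = (norm x)\<^sup>2 + (norm y)\<^sup>2"
  by (simp add: norm_add_sq)

lemma Cauchy_Schwarz: "cmod (cinner x y) \<le> norm x * norm y"
proof (cases "y = 0")
  case False
  define c where "c = cinner x y / cinner y y"
  have "cinner (x - c *\<^sub>C y) (c *\<^sub>C y) = 0"
    using False by (simp add: cinner_simps c_def)
  from norm_add_sq_orth[OF this] have "(norm x)\<^sup>2 \<ge> (norm (c *\<^sub>C y))\<^sup>2" by simp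
  then have "norm (c *\<^sub>C y) \<le> norm x" by (simp add: power2_le_iff_abs_le)
  moreover have "norm (c *\<^sub>C y) * norm y = cmod (cinner x y)"
    using False by (simp add: norm_scaleC c_def norm_divide cinner_self power2_eq_square norm_mult)
  ultimately show ?thesis by (metis mult_right_mono norm_ge_zero)
qed simp

lemma bounded_linear_cinner_left: "bounded_linear (\<lambda>x. cinner x y)"
  by (rule bounded_linear_intro[where K = "norm y"])
    (auto simp: cinner_simps scaleR_scaleC scaleR_conv_of_real Cauchy_Schwarz)

lemma bounded_bilinear_cinner: "bounded_bilinear cinner"
  by (rule bounded_bilinear.intro)
    (auto simp: cinner_simps scaleR_scaleC scaleR_conv_of_real intro!: exI[of _ 1] Cauchy_Schwarz)

lemma bounded_bilinear_scaleC: "bounded_bilinear scaleC"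
  by (rule bounded_bilinear.intro)
    (auto simp: scaleC_add_left scaleC_add_right scaleR_scaleC scaleC_scaleC norm_scaleC
      scaleR_conv_of_real mult_ac intro!: exI[of _ 1])

lemmas tendsto_cinner [tendsto_intros] = bounded_bilinear.tendsto[OF bounded_bilinear_cinner]
lemmas tendsto_scaleC [tendsto_intros] = bounded_bilinear.tendsto[OF bounded_bilinear_scaleC]
lemmas continuous_on_cinner [continuous_intros] =
  bounded_bilinear.continuous_on[OF bounded_bilinear_cinner]

lemma bounded_clinear_bounded_linear:
  assumes "bounded_clinear A" shows "bounded_linear A"
proof -
  obtain K where K: "\<And>x. norm (A x) \<le> norm x * K" using bounded_clinear_bound[OF assms] by blast
  show ?thesis
    by (rule bounded_linear_intro[where K = K])
      (auto simp: scaleR_scaleC bounded_clinear_add[OF assms] bounded_clinear_scaleC[OF assms] K)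
qed

lemma bounded_clinear_zero_right: "bounded_clinear A \<Longrightarrow> A 0 = 0"
  by (simp add: bounded_clinear_bounded_linear linear_simps(3))

lemma bounded_clinear_diff: "bounded_clinear A \<Longrightarrow> A (x - y) = A x - A y"
  by (simp add: bounded_clinear_bounded_linear linear_simps(2))

lemma bounded_clinear_neg: "bounded_clinear A \<Longrightarrow> A (- x) = - A x"
  by (simp add: bounded_clinear_bounded_linear linear_simps(4))

lemma bounded_clinear_sum: "bounded_clinear A \<Longrightarrow> A (\<Sum>i\<in>I. f i) = (\<Sum>i\<in>I. A (f i))"
  using linear_sum[OF bounded_linear.linear[OF bounded_clinear_bounded_linear]] .

lemma tendsto_bounded_clinear: "bounded_clinear A \<Longrightarrow> (f \<longlongrightarrow> l) F \<Longrightarrow> ((\<lambda>x. A (f x)) \<longlongrightarrow> A l) F"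
  using bounded_linear.tendsto[OF bounded_clinear_bounded_linear] .

lemma continuous_on_bounded_clinear: "bounded_clinear A \<Longrightarrow> continuous_on S A"
  using linear_continuous_on[OF bounded_clinear_bounded_linear] .

lemma bounded_clinear_minus:
  "bounded_clinear A \<Longrightarrow> bounded_clinear B \<Longrightarrow> bounded_clinear (\<lambda>x. A x - B x)"
  using bounded_clinear_plus[OF _ bounded_clinear_uminus, of A B] by simp

lemma bounded_clinear_cmult:
  assumes A: "bounded_clinear A" shows "bounded_clinear (\<lambda>x. c *\<^sub>C A x)"
proof -
  obtain K where K: "\<And>x. norm (A x) \<le> norm x * K" using bounded_clinear_bound[OF A] by blast
  have "norm (c *\<^sub>C A x) \<le> norm x * (cmod c * K)" for x
    using mult_left_mono[OF K[of x], of "cmod c"] by (simp add: norm_scaleC mult_ac)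
  then show ?thesis
    by (intro bounded_clinearI[where K = "cmod c * K"])
      (simp_all add: bounded_clinear_add[OF A] bounded_clinear_scaleC[OF A] scaleC_add_right
        scaleC_scaleC mult.commute)
qed

lemma bounded_clinear_ident: "bounded_clinear (\<lambda>x. x)"
  using bounded_clinear_id by (simp add: id_def)

lemma bounded_clinear_scale: "bounded_clinear (\<lambda>x. c *\<^sub>C x)"
  using bounded_clinear_cmult[OF bounded_clinear_ident] .

lemma bounded_clinear_compose:
  "bounded_clinear A \<Longrightarrow> bounded_clinear B \<Longrightarrow> bounded_clinear (\<lambda>x. A (B x))"
  using bounded_clinear_comp[of A B] by (simp add: comp_def)

lemma bounded_clinear_rank1: "bounded_clinear (\<lambda>x. cinner x q *\<^sub>C p)"
proof (rule bounded_clinearI[where K = "norm q * norm p"])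
  show "norm (cinner x q *\<^sub>C p) \<le> norm x * (norm q * norm p)" for x
    using mult_right_mono[OF Cauchy_Schwarz[of x q], of "norm p"] by (simp add: norm_scaleC mult_ac)
qed (simp_all add: cinner_simps scaleC_add_left scaleC_scaleC)

lemmas bounded_clinear_intros = bounded_clinear_plus bounded_clinear_minus bounded_clinear_cmult
  bounded_clinear_ident bounded_clinear_scale bounded_clinear_rank1 bounded_clinear_uminus
  bounded_clinear_zero

lemmas clin_simps = bounded_clinear_add bounded_clinear_scaleC bounded_clinear_diff
  bounded_clinear_neg bounded_clinear_zero_right

section \<open>Closed subspaces, projections and adjoints\<close>

lemma csubspace_iff:
  "csubspace M \<longleftrightarrow> 0 \<in> M \<and> (\<forall>x\<in>M. \<forall>y\<in>M. x + y \<in> M) \<and> (\<forall>c. \<forall>x\<in>M. c *\<^sub>C x \<in> M)"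
  by (auto simp: complex_vector.subspace_def)

lemma closed_csubspaceD:
  assumes "closed_csubspace M"
  shows "csubspace M" "closed M" "0 \<in> M" "x \<in> M \<Longrightarrow> y \<in> M \<Longrightarrow> x + y \<in> M"
    "x \<in> M \<Longrightarrow> y \<in> M \<Longrightarrow> x - y \<in> M" "x \<in> M \<Longrightarrow> c *\<^sub>C x \<in> M" "x \<in> M \<Longrightarrow> - x \<in> M"
  using assms unfolding closed_csubspace_def
  by (auto simp: complex_vector.subspace_0 complex_vector.subspace_add complex_vector.subspace_diff
      complex_vector.subspace_scale complex_vector.subspace_neg)

text \<open>Allowing any set \<open>F\<close> makes \<open>perp F\<close> with finite
  \<open>F\<close> the general closed subspace of finite codimension, so codimension needs no notion
  of its own.\<close>

definition perp :: "'a::complex_hilbert_space set \<Rightarrow> 'a set"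
  where "perp F = {x. \<forall>f\<in>F. cinner x f = 0}"

lemma perp_memI: "(\<And>f. f \<in> F \<Longrightarrow> cinner x f = 0) \<Longrightarrow> x \<in> perp F"
  by (simp add: perp_def)

lemma perpD: "x \<in> perp F \<Longrightarrow> f \<in> F \<Longrightarrow> cinner x f = 0" "x \<in> perp F \<Longrightarrow> f \<in> F \<Longrightarrow> cinner f x = 0"
  by (auto simp: perp_def cinner_eq_0_commute)

lemma closed_csubspace_perp: "closed_csubspace (perp F)"
proof -
  have "perp F = (\<Inter>f\<in>F. {x. cinner x f = 0})" by (auto simp: perp_def)
  moreover have "closed {x. cinner x f = 0}" for f :: 'a
    by (rule closed_Collect_eq) (auto intro!: continuous_intros)
  ultimately have "closed (perp F)" by (metis closed_INT)
  then show ?thesis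
    by (auto simp: closed_csubspace_def csubspace_iff perp_def cinner_simps)
qed

lemma closed_csubspace_UNIV: "closed_csubspace UNIV"
  by (simp add: closed_csubspace_def csubspace_iff)

lemma closed_csubspace_Int:
  "closed_csubspace M \<Longrightarrow> closed_csubspace N \<Longrightarrow> closed_csubspace (M \<inter> N)"
  by (auto simp: closed_csubspace_def csubspace_iff)

lemma closed_csubspace_kernel:
  assumes "bounded_clinear A" shows "closed_csubspace {x. A x = 0}"
proof -
  have "closed {x. A x = 0}"
    by (rule closed_Collect_eq) (auto intro!: continuous_intros continuous_on_bounded_clinear assms)
  then show ?thesis
    by (auto simp: closed_csubspace_def csubspace_iff clin_simps[OF assms])
qed

lemma closed_csubspace_closure:
  assumes "csubspace M" shows "closed_csubspace (closure M)"
proof -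
  have "x + y \<in> closure M" if xy: "x \<in> closure M" "y \<in> closure M" for x y
  proof -
    obtain f where "\<forall>n. f n \<in> M" "f \<longlonglongrightarrow> x"
      using xy(1) unfolding closure_sequential by blast
    moreover obtain g where "\<forall>n. g n \<in> M" "g \<longlonglongrightarrow> y"
      using xy(2) unfolding closure_sequential by blast
    ultimately show ?thesis unfolding closure_sequential
      by (intro exI[of _ "\<lambda>n. f n + g n"]) (auto intro: tendsto_add complex_vector.subspace_add[OF assms])
  qed
  moreover have "c *\<^sub>C x \<in> closure M" if x: "x \<in> closure M" for x c
  proof -
    obtain f where "\<forall>n. f n \<in> M" "f \<longlonglongrightarrow> x" using x unfolding closure_sequential by blast
    then show ?thesis unfolding closure_sequential
      by (intro exI[of _ "\<lambda>n. c *\<^sub>C f n"])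
        (auto intro: tendsto_scaleC complex_vector.subspace_scale[OF assms])
  qed
  moreover have "0 \<in> closure M"
    using complex_vector.subspace_0[OF assms] closure_subset by blast
  ultimately show ?thesis by (simp add: closed_csubspace_def csubspace_iff)
qed

definition cls :: "'a::complex_hilbert_space set \<Rightarrow> 'a set"
  where "cls F = closure (cspan F)"

lemma closed_csubspace_cls: "closed_csubspace (cls F)"
  unfolding cls_def by (rule closed_csubspace_closure) (rule complex_vector.subspace_span)

lemma cls_superset: "F \<subseteq> cls F"
  unfolding cls_def using complex_vector.span_superset closure_subset by blast

lemma cls_minimal:
  assumes "F \<subseteq> M" "closed_csubspace M" shows "cls F \<subseteq> M"
  unfolding cls_def using assms
  by (intro closure_minimal complex_vector.span_minimal) (auto simp: closed_csubspace_def)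

lemma closest_point_exists:
  assumes M: "closed_csubspace M"
  shows "\<exists>p\<in>M. \<forall>z\<in>M. norm (x - p) \<le> norm (x - z)"
proof -
  define d where "d = Inf ((\<lambda>z. norm (x - z)) ` M)"
  have ne: "M \<noteq> {}" using closed_csubspaceD(3)[OF M] by auto
  have bdd: "bdd_below ((\<lambda>z. norm (x - z)) ` M)" by (auto intro!: bdd_belowI[of _ 0])
  have d_le: "d \<le> norm (x - z)" if "z \<in> M" for z
    unfolding d_def using that bdd by (auto intro: cInf_lower)
  have d0: "0 \<le> d" unfolding d_def using ne by (auto intro!: cInf_greatest)
  have "\<exists>z\<in>M. norm (x - z) < d + 1 / Suc n" for n
  proof -
    have "d < d + 1 / Suc n" by simp
    then show ?thesis
      using cInf_lessD[of "(\<lambda>z. norm (x - z)) ` M" "d + 1 / Suc n"] ne d_def by auto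
  qed
  then obtain p where p: "\<And>n. p n \<in> M" "\<And>n. norm (x - p n) < d + 1 / Suc n" by metis
  have lim: "(\<lambda>n. norm (x - p n)) \<longlonglongrightarrow> d"
  proof (rule real_tendsto_sandwich[OF _ _ tendsto_const])
    show "(\<lambda>n. d + 1 / Suc n) \<longlonglongrightarrow> d"
      using tendsto_add[OF tendsto_const LIMSEQ_inverse_real_of_nat, of d]
      by (simp add: inverse_eq_divide)
    show "\<forall>\<^sub>F n in sequentially. d \<le> norm (x - p n)" by (simp add: d_le p(1))
    show "\<forall>\<^sub>F n in sequentially. norm (x - p n) \<le> d + 1 / Suc n"
      by (intro always_eventually allI less_imp_le p(2))
  qed
  \<comment> \<open>The midpoint of two points of \<open>M\<close> lies in \<open>M\<close>, hence
    at distance at least \<open>d\<close> from \<open>x\<close>; the parallelogram law then makes a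
    minimizing sequence Cauchy.\<close>
  have key: "(norm (p m - p n))\<^sup>2 \<le> 2 * (norm (x - p m))\<^sup>2 + 2 * (norm (x - p n))\<^sup>2 - 4 * d\<^sup>2" for m n
  proof -
    have "(1/2) *\<^sub>C (p m + p n) \<in> M" using p by (intro closed_csubspaceD[OF M]) auto
    from d_le[OF this] have "2 * d \<le> 2 * norm (x - (1/2) *\<^sub>C (p m + p n))" by simp
    also have "\<dots> = norm (2 *\<^sub>C (x - (1/2) *\<^sub>C (p m + p n)))" by (simp add: norm_scaleC)
    also have "2 *\<^sub>C (x - (1/2) *\<^sub>C (p m + p n)) = (x - p m) + (x - p n)"
      by (simp add: complex_vector.scale_right_diff_distrib
          complex_vector.scale_left_distrib[of 1 1, simplified])
    finally have "(2 * d)\<^sup>2 \<le> (norm ((x - p m) + (x - p n)))\<^sup>2"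
      using d0 by (intro power_mono) auto
    moreover have "norm ((x - p m) - (x - p n)) = norm (p m - p n)"
      by (simp add: norm_minus_commute)
    ultimately show ?thesis using parallelogram[of "x - p m" "x - p n"]
      by (simp add: power_mult_distrib)
  qed
  have "Cauchy p"
  proof (rule CauchyI)
    fix e :: real assume e: "e > 0"
    have "(\<lambda>n. (norm (x - p n))\<^sup>2) \<longlonglongrightarrow> d\<^sup>2" by (intro tendsto_intros lim)
    moreover have "d\<^sup>2 < d\<^sup>2 + e\<^sup>2 / 4" using e by simp
    ultimately have "eventually (\<lambda>n. (norm (x - p n))\<^sup>2 < d\<^sup>2 + e\<^sup>2 / 4) sequentially"
      using order_tendstoD(2) by blast
    then obtain N where N: "\<And>n. n \<ge> N \<Longrightarrow> (norm (x - p n))\<^sup>2 < d\<^sup>2 + e\<^sup>2 / 4"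
      by (auto simp: eventually_sequentially)
    have "norm (p m - p n) < e" if "m \<ge> N" "n \<ge> N" for m n
    proof -
      have "(norm (p m - p n))\<^sup>2 < e\<^sup>2" using key[of m n] N[OF that(1)] N[OF that(2)] by simp
      then show ?thesis using e by (simp add: power2_less_imp_less)
    qed
    then show "\<exists>N. \<forall>m\<ge>N. \<forall>n\<ge>N. norm (p m - p n) < e" by blast
  qed
  then obtain q where q: "p \<longlonglongrightarrow> q" using Cauchy_convergent_iff convergent_def by blast
  have "q \<in> M" using closed_csubspaceD(2)[OF M] p(1) q closed_sequentially by blast
  moreover have "norm (x - q) = d"
    using LIMSEQ_unique[OF lim tendsto_norm[OF tendsto_diff[OF tendsto_const q]]] by simp
  ultimately show ?thesis using d_le by blast
qed

lemma projection_exists: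
  assumes M: "closed_csubspace M"
  shows "\<exists>p\<in>M. \<forall>z\<in>M. cinner (x - p) z = 0"
proof -
  obtain p where p: "p \<in> M" "\<And>z. z \<in> M \<Longrightarrow> norm (x - p) \<le> norm (x - z)"
    using closest_point_exists[OF M] by blast
  have "cinner (x - p) z = 0" if z: "z \<in> M" for z
  proof (cases "z = 0")
    case False
    define c where "c = cinner (x - p) z / cinner z z"
    have "cinner (x - p - c *\<^sub>C z) (c *\<^sub>C z) = 0"
      using False by (simp add: cinner_simps c_def)
    from norm_add_sq_orth[OF this]
    have "(norm (x - p))\<^sup>2 = (norm (x - (p + c *\<^sub>C z)))\<^sup>2 + (norm (c *\<^sub>C z))\<^sup>2"
      by (simp add: diff_diff_eq)
    moreover have "norm (x - p) \<le> norm (x - (p + c *\<^sub>C z))"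
      using p z by (simp add: closed_csubspaceD[OF M])
    then have "(norm (x - p))\<^sup>2 \<le> (norm (x - (p + c *\<^sub>C z)))\<^sup>2" by (intro power_mono) auto
    ultimately have "c *\<^sub>C z = 0" by simp
    then show ?thesis using False by (simp add: c_def)
  qed simp
  then show ?thesis using p(1) by blast
qed

lemma orth_proj_eqI:
  assumes M: "closed_csubspace M" and "p \<in> M" "\<And>z. z \<in> M \<Longrightarrow> cinner (x - p) z = 0"
  shows "orth_proj M x = p"
  unfolding orth_proj_def
proof (rule the_equality)
  fix q assume q: "q \<in> M \<and> (\<forall>z\<in>M. cinner (x - q) z = 0)"
  have "q - p \<in> M" using q assms by (simp add: closed_csubspaceD[OF M])
  then have "cinner (x - p) (q - p) = 0" "cinner (x - q) (q - p) = 0" using q assms by auto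
  then have "cinner (q - p) (q - p) = 0"
    by (metis (no_types) cinner_diff_left cinner_self_eq_0 cinner_zero_left diff_eq_eq diff_self)
  then show "q = p" by simp
qed (use assms in auto)

lemma
  assumes M: "closed_csubspace M"
  shows orth_proj_in: "orth_proj M x \<in> M"
    and orth_proj_orth: "z \<in> M \<Longrightarrow> cinner (x - orth_proj M x) z = 0"
proof -
  obtain p where "p \<in> M" "\<And>z. z \<in> M \<Longrightarrow> cinner (x - p) z = 0" using projection_exists[OF M] by blast
  moreover from this have "orth_proj M x = p" using orth_proj_eqI[OF M] by blast
  ultimately show "orth_proj M x \<in> M" "z \<in> M \<Longrightarrow> cinner (x - orth_proj M x) z = 0" by auto
qed

lemma orth_proj_orth_left: "closed_csubspace M \<Longrightarrow> z \<in> M \<Longrightarrow> cinner z (x - orth_proj M x) = 0"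
  using orth_proj_orth cinner_eq_0_commute by blast

lemma orth_proj_id: "closed_csubspace M \<Longrightarrow> x \<in> M \<Longrightarrow> orth_proj M x = x"
  by (rule orth_proj_eqI) auto

lemma cinner_orth_proj: "closed_csubspace M \<Longrightarrow> z \<in> M \<Longrightarrow> cinner (orth_proj M x) z = cinner x z"
  using orth_proj_orth[of M z x] by (simp add: cinner_diff_left)

lemma cinner_orth_proj': "closed_csubspace M \<Longrightarrow> z \<in> M \<Longrightarrow> cinner z (orth_proj M x) = cinner z x"
  using cinner_orth_proj[of M z x] by (metis cinner_commute)

lemma orth_proj_perp: "closed_csubspace M \<Longrightarrow> x - orth_proj M x \<in> perp M"
  by (simp add: perp_def orth_proj_orth)

lemma norm_orth_proj_le:
  assumes M: "closed_csubspace M" shows "norm (orth_proj M x) \<le> norm x"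
proof -
  have "cinner (x - orth_proj M x) (orth_proj M x) = 0" using M orth_proj_orth orth_proj_in by blast
  from norm_add_sq_orth[OF this] have "(norm (orth_proj M x))\<^sup>2 \<le> (norm x)\<^sup>2" by simp
  then show ?thesis by (simp add: power2_le_iff_abs_le)
qed

lemma bounded_clinear_orth_proj:
  assumes M: "closed_csubspace M" shows "bounded_clinear (orth_proj M)"
proof (rule bounded_clinearI[where K = 1])
  show "orth_proj M (x + y) = orth_proj M x + orth_proj M y" for x y
    by (rule orth_proj_eqI[OF M])
      (auto simp: closed_csubspaceD[OF M] orth_proj_in[OF M] cinner_simps cinner_orth_proj[OF M])
  show "orth_proj M (c *\<^sub>C x) = c *\<^sub>C orth_proj M x" for x c
    by (rule orth_proj_eqI[OF M])
      (auto simp: closed_csubspaceD[OF M] orth_proj_in[OF M] cinner_simps cinner_orth_proj[OF M])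
qed (simp add: norm_orth_proj_le[OF M])

lemma perp_perp_cls: "perp (perp F) = cls F"
proof
  show "cls F \<subseteq> perp (perp F)"
    by (rule cls_minimal[OF _ closed_csubspace_perp]) (auto simp: perp_def cinner_eq_0_commute)
  show "perp (perp F) \<subseteq> cls F"
  proof
    fix x assume x: "x \<in> perp (perp F)"
    note M = closed_csubspace_cls[of F]
    let ?r = "x - orth_proj (cls F) x"
    have "?r \<in> perp F" using orth_proj_orth[OF M] cls_superset[of F] by (auto simp: perp_def)
    then have "cinner x ?r = 0" using x by (simp add: perp_def)
    moreover have "cinner (orth_proj (cls F) x) ?r = 0"
      using orth_proj_orth_left[OF M orth_proj_in[OF M]] .
    ultimately have "cinner ?r ?r = 0" by (simp add: cinner_diff_left)
    then have "x = orth_proj (cls F) x" by simp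
    then show "x \<in> cls F" using orth_proj_in[OF M] by metis
  qed
qed

lemma perp_cls: "perp (cls F) = perp F"
proof
  show "perp (cls F) \<subseteq> perp F" using cls_superset by (auto simp: perp_def)
  show "perp F \<subseteq> perp (cls F)"
    unfolding perp_perp_cls[symmetric] by (auto simp: perp_def cinner_eq_0_commute)
qed

lemma dense_in_closed_subspaceI:
  assumes W: "closed_csubspace W" and S: "csubspace S" "S \<subseteq> W"
    and *: "\<And>y. y \<in> W \<Longrightarrow> (\<And>x. x \<in> S \<Longrightarrow> cinner x y = 0) \<Longrightarrow> y = 0"
  shows "closure S = W"
proof
  have SW: "closure S \<subseteq> W" using S W closure_minimal unfolding closed_csubspace_def by blast
  show "closure S \<subseteq> W" by fact
  note M = closed_csubspace_closure[OF S(1)]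
  show "W \<subseteq> closure S"
  proof
    fix x assume x: "x \<in> W"
    have "x - orth_proj (closure S) x = 0"
      using x SW orth_proj_in[OF M, of x] closure_subset[of S]
      by (intro *) (auto intro!: closed_csubspaceD[OF W] orth_proj_orth_left[OF M])
    then show "x \<in> closure S" using orth_proj_in[OF M, of x] by simp
  qed
qed

lemma riesz_representation:
  fixes f :: "'a::complex_hilbert_space \<Rightarrow> complex"
  assumes add: "\<And>x y. f (x + y) = f x + f y" and sc: "\<And>c x. f (c *\<^sub>C x) = c * f x"
    and bd: "\<And>x. cmod (f x) \<le> norm x * K"
  shows "\<exists>z. \<forall>x. f x = cinner x z"
proof (cases "\<forall>x. f x = 0")
  case True then show ?thesis by (intro exI[of _ 0]) simp
next
  case False
  then obtain x0 where x0: "f x0 \<noteq> 0" by blast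
  have "bounded_linear f"
    by (rule bounded_linear_intro[where K = K])
      (auto simp: add sc scaleR_scaleC scaleR_conv_of_real bd)
  note bl = this linear_simps(2,3)[OF this]
  have M: "closed_csubspace {x. f x = 0}" (is "closed_csubspace ?M")
  proof -
    have "closed ?M"
      by (rule closed_Collect_eq) (auto intro!: linear_continuous_on bl)
    then show ?thesis by (auto simp: closed_csubspace_def csubspace_iff add sc bl)
  qed
  define r where "r = x0 - orth_proj ?M x0"
  have fr: "f r = f x0" using orth_proj_in[OF M, of x0] by (simp add: r_def bl)
  then have r0: "r \<noteq> 0" using x0 bl(3) by auto
  have "f x = cinner x ((cnj (f r / cinner r r)) *\<^sub>C r)" for x
  proof -
    have "x - (f x / f r) *\<^sub>C r \<in> ?M" using fr x0 by (simp add: bl sc)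
    from orth_proj_orth_left[OF M this, of x0] have "cinner (x - (f x / f r) *\<^sub>C r) r = 0"
      by (simp add: r_def)
    then show ?thesis using fr x0 r0 by (simp add: cinner_simps field_simps)
  qed
  then show ?thesis by blast
qed

text \<open>The choice operator makes \<open>adj\<close> total; it is the adjoint when
  \<open>bounded_clinear A\<close> holds, where the Riesz representation supplies a witness.\<close>

definition adj :: "('a::complex_hilbert_space \<Rightarrow> 'a) \<Rightarrow> 'a \<Rightarrow> 'a"
  where "adj A y = (SOME z. \<forall>x. cinner (A x) y = cinner x z)"

lemma cinner_adj:
  assumes A: "bounded_clinear A" shows "cinner (A x) y = cinner x (adj A y)"
proof -
  obtain K where K: "\<And>x. norm (A x) \<le> norm x * K" using bounded_clinear_bound[OF A] by blast
  have "cmod (cinner (A x) y) \<le> norm x * (K * norm y)" for x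
    using mult_right_mono[OF K[of x], of "norm y"] Cauchy_Schwarz[of "A x" y]
    by (simp add: mult_ac)
  then have "\<exists>z. \<forall>x. cinner (A x) y = cinner x z"
    by (intro riesz_representation) (auto simp: clin_simps[OF A] cinner_simps)
  from someI_ex[OF this] show ?thesis unfolding adj_def by blast
qed

lemma cinner_adj': "bounded_clinear A \<Longrightarrow> cinner y (A x) = cinner (adj A y) x"
  by (metis cinner_adj cinner_commute)

lemma adj_eqI:
  assumes "bounded_clinear A" "\<And>x. cinner (A x) y = cinner x z" shows "adj A y = z"
proof -
  have "cinner x (adj A y - z) = 0" for x
    using assms cinner_adj[of A x y] by (simp add: cinner_diff_right)
  then show ?thesis by (metis cinner_self_eq_0 right_minus_eq)
qed

lemma bounded_clinear_adj:
  assumes A: "bounded_clinear A" shows "bounded_clinear (adj A)"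
proof -
  obtain K where K: "K \<ge> 0" "\<And>x. norm (A x) \<le> norm x * K" using bounded_clinear_bound[OF A] by blast
  show ?thesis
  proof (rule bounded_clinearI[where K = K])
    show "adj A (x + y) = adj A x + adj A y" for x y
      by (rule adj_eqI[OF A]) (simp add: cinner_simps cinner_adj[OF A])
    show "adj A (c *\<^sub>C x) = c *\<^sub>C adj A x" for c x
      by (rule adj_eqI[OF A]) (simp add: cinner_simps cinner_adj[OF A])
    show "norm (adj A y) \<le> norm y * K" for y
    proof (cases "adj A y = 0")
      case True then show ?thesis using K(1) by simp
    next
      case False
      have "norm (adj A y) * norm (adj A y) = cmod (cinner (adj A y) (adj A y))"
        by (simp add: cinner_self power2_eq_square norm_mult)
      also have "\<dots> = cmod (cinner (A (adj A y)) y)" by (simp add: cinner_adj[OF A])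
      also have "\<dots> \<le> norm (A (adj A y)) * norm y" by (rule Cauchy_Schwarz)
      also have "\<dots> \<le> (norm (adj A y) * K) * norm y" by (intro mult_right_mono K) simp
      finally show ?thesis using False by (simp add: mult_ac)
    qed
  qed
qed

lemma adj_adj: "bounded_clinear A \<Longrightarrow> adj (adj A) = A"
  by (rule ext, rule adj_eqI[OF bounded_clinear_adj]) (simp_all add: cinner_adj')

lemma adj_eqI_fun:
  assumes "bounded_clinear A" "\<And>x y. cinner (A x) y = cinner x (B y)" shows "adj A = B"
  using assms by (intro ext adj_eqI) auto

section \<open>Operators bounded below up to finite dimension\<close>

text \<open>For a closed subspace \<open>W\<close> this says that \<open>B\<close> restricted to \<open>W\<close> has closed range and
  finite dimensional kernel.\<close>

definition CP :: "('a::complex_hilbert_space \<Rightarrow> 'a) \<Rightarrow> 'a set \<Rightarrow> bool"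
  where "CP B W \<longleftrightarrow> (\<forall>v l. (\<forall>n::nat. v n \<in> W) \<and> bounded (range v) \<and> (\<lambda>n. B (v n)) \<longlonglongrightarrow> l \<longrightarrow>
     (\<exists>r p. strict_mono (r :: nat \<Rightarrow> nat) \<and> (v \<circ> r) \<longlonglongrightarrow> p))"

lemma CP_subset: "CP B W \<Longrightarrow> W' \<subseteq> W \<Longrightarrow> CP B W'"
  unfolding CP_def by blast

lemma Cauchy_bounded_below:
  assumes "c > 0" "\<And>m n. c * norm (v m - v n) \<le> norm (w m - w n)" "Cauchy w"
  shows "Cauchy (v :: nat \<Rightarrow> 'a::real_normed_vector)"
proof (rule CauchyI)
  fix e :: real assume "e > 0"
  then have "c * e > 0" using assms(1) by simp
  then obtain N where N: "\<And>m n. m \<ge> N \<Longrightarrow> n \<ge> N \<Longrightarrow> norm (w m - w n) < c * e"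
    using CauchyD[OF assms(3)] by blast
  have "norm (v m - v n) < e" if "m \<ge> N" "n \<ge> N" for m n
  proof -
    have "c * norm (v m - v n) < c * e" using assms(2)[of m n] N[OF that] by linarith
    then show ?thesis using assms(1) by simp
  qed
  then show "\<exists>N. \<forall>m\<ge>N. \<forall>n\<ge>N. norm (v m - v n) < e" by blast
qed

lemma CP_bounded_below:
  assumes B: "bounded_clinear B" and W: "closed_csubspace W"
    and c: "c > 0" "\<And>x. x \<in> W \<Longrightarrow> c * norm x \<le> norm (B x)"
  shows "CP B W"
  unfolding CP_def
proof (intro allI impI)
  fix v :: "nat \<Rightarrow> 'a" and l
  assume v: "(\<forall>n. v n \<in> W) \<and> bounded (range v) \<and> (\<lambda>n. B (v n)) \<longlonglongrightarrow> l"
  have "Cauchy v"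
  proof (rule Cauchy_bounded_below[OF c(1), of v "\<lambda>n. B (v n)"])
    show "c * norm (v m - v n) \<le> norm (B (v m) - B (v n))" for m n
      using c(2)[of "v m - v n"] v by (simp add: bounded_clinear_diff[OF B] closed_csubspaceD[OF W])
  qed (use v LIMSEQ_imp_Cauchy in blast)
  then obtain p where "v \<longlonglongrightarrow> p" using Cauchy_convergent_iff convergent_def by blast
  then show "\<exists>r p. strict_mono (r :: nat \<Rightarrow> nat) \<and> (v \<circ> r) \<longlonglongrightarrow> p"
    by (intro exI[of _ id] exI[of _ p]) (auto simp: strict_mono_def)
qed

text \<open>One missing dimension contributes a bounded sequence of complex coefficients, which has
  a convergent subsequence; what remains lies in the smaller subspace.\<close>

lemma CP_perp_singleton:
  assumes B: "bounded_clinear B" and W: "closed_csubspace W" and cp: "CP B (W \<inter> perp {f})"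
  shows "CP B W"
proof (cases "W \<subseteq> perp {f}")
  case True then show ?thesis using cp by (simp add: Int_absorb2)
next
  case False
  \<comment> \<open>\<open>f\<close> need not lie in \<open>W\<close>; its projection represents the
    same functional on \<open>W\<close> and may be subtracted without leaving
    \<open>W\<close>.\<close>
  define g where "g = orth_proj W f"
  have g: "g \<in> W" "\<And>x. x \<in> W \<Longrightarrow> cinner x g = cinner x f"
    using orth_proj_in[OF W] cinner_orth_proj'[OF W] by (auto simp: g_def)
  have g0: "g \<noteq> 0" using False g(2) by (auto simp: perp_def)
  show ?thesis unfolding CP_def
  proof (intro allI impI, elim conjE)
    fix v :: "nat \<Rightarrow> 'a" and l
    assume v: "\<forall>n. v n \<in> W" "bounded (range v)" "(\<lambda>n. B (v n)) \<longlonglongrightarrow> l"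
    define a where "a n = cinner (v n) g / cinner g g" for n
    obtain C where C: "\<And>n. norm (v n) \<le> C" using v(2) by (auto simp: bounded_iff)
    have "cmod (a n) \<le> C * norm g / cmod (cinner g g)" for n
      unfolding a_def norm_divide
      by (intro divide_right_mono order_trans[OF Cauchy_Schwarz] mult_right_mono C) auto
    then have "bounded (range a)" by (auto simp: bounded_iff)
    then obtain r al where r: "strict_mono (r :: nat \<Rightarrow> nat)" "(a \<circ> r) \<longlonglongrightarrow> al"
      using bounded_imp_convergent_subsequence by blast
    define u where "u n = v (r n) - a (r n) *\<^sub>C g" for n
    have uW: "u n \<in> W \<inter> perp {f}" for n
    proof -
      have "cinner (u n) g = 0" using g0 by (simp add: u_def a_def cinner_simps)
      moreover have "u n \<in> W" using v(1) g(1) by (simp add: u_def closed_csubspaceD[OF W])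
      ultimately show ?thesis using g(2) by (auto simp: perp_def)
    qed
    have "(\<lambda>n. B (v (r n)) - a (r n) *\<^sub>C B g) \<longlonglongrightarrow> l - al *\<^sub>C B g"
      using LIMSEQ_subseq_LIMSEQ[OF v(3) r(1)] r(2) by (intro tendsto_intros) (auto simp: o_def)
    then have "(\<lambda>n. B (u n)) \<longlonglongrightarrow> l - al *\<^sub>C B g" by (simp add: u_def clin_simps[OF B])
    moreover have "bounded (range u)"
    proof -
      have "norm (u n) \<le> C + C * norm g / cmod (cinner g g) * norm g" for n
        unfolding u_def using C \<open>\<And>n. cmod (a n) \<le> _\<close>
        by (intro order_trans[OF norm_triangle_ineq4] add_mono, blast)
          (simp only: norm_scaleC, intro mult_right_mono, auto)
      then show ?thesis by (auto simp: bounded_iff)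
    qed
    ultimately obtain s p where s: "strict_mono (s :: nat \<Rightarrow> nat)" "(u \<circ> s) \<longlonglongrightarrow> p"
      using cp uW unfolding CP_def by blast
    have "(\<lambda>n. u (s n) + a (r (s n)) *\<^sub>C g) \<longlonglongrightarrow> p + al *\<^sub>C g"
      using s(2) LIMSEQ_subseq_LIMSEQ[OF r(2) s(1)] by (intro tendsto_intros) (auto simp: o_def)
    then have "(v \<circ> (r \<circ> s)) \<longlonglongrightarrow> p + al *\<^sub>C g" by (simp add: u_def o_def)
    then show "\<exists>r p. strict_mono (r :: nat \<Rightarrow> nat) \<and> (v \<circ> r) \<longlonglongrightarrow> p"
      using strict_mono_o[OF r(1) s(1)] by blast
  qed
qed

lemma CP_perp:
  assumes B: "bounded_clinear B" and "finite F" "closed_csubspace W" "CP B (W \<inter> perp F)"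
  shows "CP B W"
  using assms(2-)
proof (induction F arbitrary: W rule: finite_induct)
  case empty then show ?case by (simp add: perp_def)
next
  case (insert f F)
  have "W \<inter> perp (insert f F) = (W \<inter> perp {f}) \<inter> perp F" by (auto simp: perp_def)
  then have "CP B (W \<inter> perp {f})"
    using insert closed_csubspace_Int[OF _ closed_csubspace_perp] by metis
  then show ?case using CP_perp_singleton[OF B] insert by blast
qed

lemma not_CP_approx_kernel:
  assumes B: "bounded_clinear B" and W: "closed_csubspace W" and "\<not> CP B W" "finite F" "d > 0"
  shows "\<exists>z\<in>W \<inter> perp F. norm z = 1 \<and> norm (B z) < d"
proof (rule ccontr)
  assume no: "\<not> ?thesis"
  note WF = closed_csubspace_Int[OF W closed_csubspace_perp[of F]]
  have "d * norm x \<le> norm (B x)" if x: "x \<in> W \<inter> perp F" for x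
  proof (cases "x = 0")
    case False
    have "complex_of_real (1 / norm x) *\<^sub>C x \<in> W \<inter> perp F" using closed_csubspaceD(6)[OF WF x] .
    moreover have "norm (complex_of_real (1 / norm x) *\<^sub>C x) = 1" using False by (rule norm_unitv[unfolded unitv_def])
    ultimately have "d \<le> norm (B (complex_of_real (1 / norm x) *\<^sub>C x))" using no by force
    then show ?thesis using False by (simp add: clin_simps[OF B] norm_scaleC norm_divide field_simps)
  qed (simp add: clin_simps[OF B])
  from CP_bounded_below[OF B WF assms(5) this] CP_perp[OF B assms(4) W] assms(3) show False by blast
qed

text \<open>This is the resolvent set of \<open>B\<close>.\<close>

definition regular :: "('a::complex_hilbert_space \<Rightarrow> 'a) \<Rightarrow> complex \<Rightarrow> bool"
  where "regular B \<nu> \<longleftrightarrow> (\<exists>R. bounded_clinear R \<and> (\<forall>x. B (R x) - \<nu> *\<^sub>C R x = x) \<and>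
    (\<forall>x. R (B x - \<nu> *\<^sub>C x) = x))"

lemma surj_of_bounded_below_dense:
  assumes B: "bounded_clinear B" and W: "closed_csubspace W" and X: "closed_csubspace X"
    and c: "c > 0" "\<And>x. x \<in> X \<Longrightarrow> c * norm x \<le> norm (B x)"
    and y: "y \<in> closure (B ` X)"
  shows "\<exists>x\<in>X. B x = y"
proof -
  obtain w where w: "\<And>n. w n \<in> B ` X" "w \<longlonglongrightarrow> y" using y unfolding closure_sequential by blast
  then have "\<forall>n. \<exists>x. x \<in> X \<and> w n = B x" by blast
  then obtain v where v: "\<And>n. v n \<in> X" "\<And>n. w n = B (v n)" by metis
  have "Cauchy v"
  proof (rule Cauchy_bounded_below[OF c(1), of v w])
    show "c * norm (v m - v n) \<le> norm (w m - w n)" for m n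
      using c(2)[of "v m - v n"] v by (simp add: bounded_clinear_diff[OF B] closed_csubspaceD[OF X])
  qed (use w LIMSEQ_imp_Cauchy in blast)
  then obtain p where p: "v \<longlonglongrightarrow> p" using Cauchy_convergent_iff convergent_def by blast
  have "p \<in> X" using closed_csubspaceD(2)[OF X] v(1) p closed_sequentially by blast
  moreover have "w = (\<lambda>n. B (v n))" using v(2) by blast
  then have "w \<longlonglongrightarrow> B p" using tendsto_bounded_clinear[OF B p] by simp
  then have "B p = y" using w(2) LIMSEQ_unique by blast
  ultimately show ?thesis by blast
qed

text \<open>Otherwise there are unit vectors orthogonal to the kernel whose images tend to 0, and
  \<open>CP\<close> yields a limit that is a unit vector in the kernel and orthogonal to it.\<close>

lemma CP_bounded_below_off_kernel:
  assumes B: "bounded_clinear B" and W: "closed_csubspace W" and cp: "CP B W"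
  shows "\<exists>c>0. \<forall>v\<in>W \<inter> perp {x\<in>W. B x = 0}. c * norm v \<le> norm (B v)"
proof (rule ccontr)
  let ?X = "W \<inter> perp {x\<in>W. B x = 0}"
  note X = closed_csubspace_Int[OF W closed_csubspace_perp[of "{x\<in>W. B x = 0}"]]
  assume no: "\<not> ?thesis"
  have "\<exists>v\<in>?X. norm v = 1 \<and> norm (B v) < 1 / Suc n" for n
  proof -
    have "1 / real (Suc n) > 0" by simp
    then obtain x where x: "x \<in> ?X" "norm (B x) < 1 / Suc n * norm x" using no by (meson not_le)
    have x0: "x \<noteq> 0" using x(2) by (auto simp: clin_simps[OF B])
    have "complex_of_real (1 / norm x) *\<^sub>C x \<in> ?X" using closed_csubspaceD(6)[OF X x(1)] .
    moreover have "norm (complex_of_real (1 / norm x) *\<^sub>C x) = 1" using x0 by (rule norm_unitv[unfolded unitv_def])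
    moreover have "norm (B (complex_of_real (1 / norm x) *\<^sub>C x)) < 1 / Suc n"
      using x0 x(2) by (simp add: clin_simps[OF B] norm_scaleC norm_divide field_simps)
    ultimately show ?thesis by blast
  qed
  then obtain v where v: "\<And>n. v n \<in> ?X" "\<And>n. norm (v n) = 1" "\<And>n. norm (B (v n)) < 1 / Suc n"
    by metis
  have "(\<lambda>n. B (v n)) \<longlonglongrightarrow> 0"
  proof (rule tendsto_norm_zero_cancel, rule real_tendsto_sandwich[OF _ _ tendsto_const])
    show "(\<lambda>n. 1 / Suc n) \<longlonglongrightarrow> 0" using LIMSEQ_inverse_real_of_nat by (simp add: inverse_eq_divide)
    show "\<forall>\<^sub>F n in sequentially. norm (B (v n)) \<le> 1 / Suc n"
      by (intro always_eventually allI less_imp_le v(3))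
  qed simp
  moreover have "bounded (range v)" using v(2) by (auto simp: bounded_iff intro!: exI[of _ 1])
  ultimately obtain r p where r: "strict_mono (r :: nat \<Rightarrow> nat)" "(v \<circ> r) \<longlonglongrightarrow> p"
    using cp v(1) unfolding CP_def by blast
  have pX: "p \<in> ?X"
    using closed_sequentially[OF closed_csubspaceD(2)[OF X] _ r(2)] v(1) by (simp add: o_def)
  have "(\<lambda>n. B ((v \<circ> r) n)) \<longlonglongrightarrow> B p" using tendsto_bounded_clinear[OF B r(2)] .
  moreover have "(\<lambda>n. B ((v \<circ> r) n)) \<longlonglongrightarrow> 0"
    using LIMSEQ_subseq_LIMSEQ[OF \<open>(\<lambda>n. B (v n)) \<longlonglongrightarrow> 0\<close> r(1)] by (simp add: o_def)
  ultimately have "B p = 0" using LIMSEQ_unique by blast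
  then have "p \<in> {x\<in>W. B x = 0}" using pX by blast
  then have "cinner p p = 0" using pX perpD(1) by blast
  then have "p = 0" by simp
  have "(\<lambda>n. norm ((v \<circ> r) n)) \<longlonglongrightarrow> norm p" by (intro tendsto_intros r)
  moreover have "(\<lambda>n. norm ((v \<circ> r) n)) = (\<lambda>n. 1)" using v(2) by (simp add: o_def)
  ultimately have "norm p = 1" using LIMSEQ_unique[OF _ tendsto_const] by metis
  then show False using \<open>p = 0\<close> by simp
qed

text \<open>If the kernel were nonzero, surjectivity would give a chain \<open>\<dots> \<mapsto> v\<^sub>2 \<mapsto> v\<^sub>1 \<mapsto> v\<^sub>0 \<mapsto> 0\<close> of
  geometric growth, and \<open>\<Sum>\<nu>\<^sup>n v\<^sub>n\<close> would be an eigenvector for every small \<open>\<nu>\<close>.\<close>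

lemma bounded_below_and_onto:
  assumes B: "bounded_clinear B" and W: "closed_csubspace W" and BW: "\<And>x. x \<in> W \<Longrightarrow> B x \<in> W"
    and dense: "W \<subseteq> closure (B ` W)" and cp: "CP B W"
    and inj: "\<And>\<epsilon>::real. \<epsilon> > 0 \<Longrightarrow> \<exists>\<nu>. cmod \<nu> < \<epsilon> \<and> (\<forall>x\<in>W. B x = \<nu> *\<^sub>C x \<longrightarrow> x = 0)"
  shows "\<exists>c>0. (\<forall>x\<in>W. c * norm x \<le> norm (B x)) \<and> B ` W = W"
proof -
  define K where "K = {x\<in>W. B x = 0}"
  have K: "closed_csubspace K"
    using closed_csubspace_Int[OF W closed_csubspace_kernel[OF B]] by (simp add: K_def Int_def)
  let ?X = "W \<inter> perp K"
  note X = closed_csubspace_Int[OF W closed_csubspace_perp[of K]]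
  obtain c where c: "c > 0" "\<And>x. x \<in> ?X \<Longrightarrow> c * norm x \<le> norm (B x)"
    using CP_bounded_below_off_kernel[OF B W cp] by (auto simp: K_def)
  have "B ` W \<subseteq> B ` ?X"
  proof
    fix y assume "y \<in> B ` W"
    then obtain x where x: "x \<in> W" "y = B x" by blast
    have "orth_proj K x \<in> K" by (rule orth_proj_in[OF K])
    then have "B (x - orth_proj K x) = y" "x - orth_proj K x \<in> ?X"
      using x orth_proj_perp[OF K, of x]
      by (auto simp: clin_simps[OF B] K_def intro!: closed_csubspaceD[OF W])
    then show "y \<in> B ` ?X" by blast
  qed
  then have "closure (B ` W) \<subseteq> closure (B ` ?X)" by (rule closure_mono)
  then have onto: "\<exists>x\<in>?X. B x = y" if "y \<in> W" for y
    using surj_of_bounded_below_dense[OF B W X c] dense that by blast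
  have "K = {0}"
  proof (rule ccontr)
    assume "K \<noteq> {0}"
    then obtain v0 where v0: "v0 \<in> K" "v0 \<noteq> 0" using closed_csubspaceD(3)[OF K] by blast
    define g where "g y = (SOME x. x \<in> ?X \<and> B x = y)" for y
    have g: "g y \<in> W" "B (g y) = y" "norm (g y) \<le> norm y / c" if "y \<in> W" for y
    proof -
      have "g y \<in> ?X \<and> B (g y) = y" unfolding g_def by (rule someI_ex) (use onto that in blast)
      then show "g y \<in> W" "B (g y) = y" "norm (g y) \<le> norm y / c"
        using c(2)[of "g y"] c(1) by (auto simp: field_simps)
    qed
    define v where "v n = (g ^^ n) v0" for n
    have vW: "v n \<in> W" for n
      unfolding v_def using v0(1) by (induction n) (auto simp: g K_def)
    have vS: "B (v (Suc n)) = v n" for n using g(2)[OF vW] by (simp add: v_def)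
    have v00: "v 0 = v0" "B v0 = 0" using v0 by (auto simp: v_def K_def)
    have vn: "norm (v n) \<le> norm v0 / c ^ n" for n
    proof (induction n)
      case (Suc n)
      have "norm (v (Suc n)) \<le> norm (v n) / c" using g(3)[OF vW[of n]] by (simp add: v_def)
      also have "\<dots> \<le> norm v0 / c ^ n / c" using Suc c(1) by (intro divide_right_mono) auto
      finally show ?case by (simp add: mult.commute)
    qed (simp add: v00)
    \<comment> \<open>With \<open>cmod \<nu> < c / 3\<close> the ratio \<open>q\<close> is below
      1/3, so the terms of the series after the first add up to less than half of
      \<open>norm v0\<close> and cannot cancel the first term \<open>v0\<close>.\<close>
    have "c / 3 > 0" using c(1) by simp
    then obtain \<nu> where nu: "cmod \<nu> < c / 3" "\<And>x. x \<in> W \<Longrightarrow> B x = \<nu> *\<^sub>C x \<Longrightarrow> x = 0"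
      using inj by blast
    define q where "q = cmod \<nu> / c"
    have q: "0 \<le> q" "q < 1/3" using nu(1) c(1) by (auto simp: q_def field_simps)
    define f where "f n = (\<nu> ^ n) *\<^sub>C v n" for n
    have fn: "norm (f n) \<le> norm v0 * q ^ n" for n
      using mult_left_mono[OF vn[of n], of "cmod \<nu> ^ n"]
      by (simp add: f_def norm_scaleC norm_power q_def power_divide mult_ac)
    have sg: "summable (\<lambda>n. norm v0 * q ^ n)" using q by (intro summable_mult summable_geometric) auto
    have sf: "summable f" by (rule summable_comparison_test[OF _ sg]) (use fn in auto)
    let ?x = "\<Sum>n. f n"
    have W0: "sum f {..<n} \<in> W" for n
      using closed_csubspaceD(1)[OF W] vW
      by (intro complex_vector.subspace_sum) (auto simp: f_def complex_vector.subspace_scale)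
    have xW: "?x \<in> W"
      using closed_sequentially[OF closed_csubspaceD(2)[OF W] W0 summable_LIMSEQ[OF sf]] .
    have "B ?x = (\<Sum>n. B (f n))"
      by (rule bounded_linear.suminf[OF bounded_clinear_bounded_linear[OF B] sf])
    also have "\<dots> = (\<Sum>n. B (f (Suc n))) + B (f 0)"
      using suminf_split_head[OF bounded_linear.summable[OF bounded_clinear_bounded_linear[OF B] sf]]
      by simp
    also have "\<dots> = (\<Sum>n. \<nu> *\<^sub>C f n)"
      by (simp add: f_def v00 clin_simps[OF B] vS scaleC_scaleC)
    also have "\<dots> = \<nu> *\<^sub>C ?x"
      using bounded_linear.suminf[OF bounded_clinear_bounded_linear[OF bounded_clinear_scale] sf] by metis
    finally have x0: "?x = 0" using nu(2) xW by blast
    have "norm (\<Sum>n. f (Suc n)) \<le> (\<Sum>n. norm v0 * q * q ^ n)"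
    proof (rule order_trans[OF summable_norm suminf_le])
      have s2: "summable (\<lambda>n. norm v0 * q * q ^ n)"
        using q by (intro summable_mult summable_geometric) auto
      show "norm (f (Suc n)) \<le> norm v0 * q * q ^ n" for n using fn[of "Suc n"] by (simp add: mult_ac)
      then show "summable (\<lambda>n. norm (f (Suc n)))"
        by (intro summable_comparison_test[OF _ s2]) auto
      then show "summable (\<lambda>n. norm (f (Suc n)))" .
      show "summable (\<lambda>n. norm v0 * q * q ^ n)" by fact
    qed
    also have "\<dots> = norm v0 * q * (1 / (1 - q))"
      using q by (subst suminf_mult) (auto simp: suminf_geometric summable_geometric)
    also have "\<dots> < norm v0"
    proof -
      have "q * (1 / (1 - q)) < 1" using q by (simp add: field_simps)
      then show ?thesis
        using v0(2) mult_strict_left_mono[of "q * (1 / (1 - q))" 1 "norm v0"] by (simp add: mult.assoc)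
    qed
    finally have "norm (\<Sum>n. f (Suc n)) < norm v0" .
    moreover have "(\<Sum>n. f (Suc n)) = - v0"
      using suminf_split_head[OF sf] x0 by (simp add: f_def v00)
    ultimately show False by simp
  qed
  then have "?X = W" by (auto simp: perp_def)
  then have "B ` W = W" using onto BW by force
  then show ?thesis using c \<open>?X = W\<close> by blast
qed

text \<open>Surjectivity is a fixed point problem: if \<open>g\<close> inverts \<open>B\<close> on
  \<open>W\<close>, then \<open>B x = w + \<nu> *\<^sub>C x\<close> amounts to
  \<open>x = g (w + \<nu> *\<^sub>C x)\<close>, and the right side contracts with ratio
  \<open>cmod \<nu> / c\<close>.\<close>

lemma perturb_bounded_below_onto:
  assumes B: "bounded_clinear B" and W: "closed_csubspace W" and BW: "\<And>x. x \<in> W \<Longrightarrow> B x \<in> W"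
    and c: "c > 0" "\<And>x. x \<in> W \<Longrightarrow> c * norm x \<le> norm (B x)" and onto: "W \<subseteq> B ` W"
    and nu: "cmod \<nu> < c"
  shows "\<And>x. x \<in> W \<Longrightarrow> (c - cmod \<nu>) * norm x \<le> norm (B x - \<nu> *\<^sub>C x)"
    and "W \<subseteq> (\<lambda>x. B x - \<nu> *\<^sub>C x) ` W"
proof -
  show "(c - cmod \<nu>) * norm x \<le> norm (B x - \<nu> *\<^sub>C x)" if "x \<in> W" for x
    using c(2)[OF that] norm_triangle_ineq2[of "B x" "\<nu> *\<^sub>C x"] by (simp add: norm_scaleC algebra_simps)
  show "W \<subseteq> (\<lambda>x. B x - \<nu> *\<^sub>C x) ` W"
  proof
    fix w assume w: "w \<in> W"
    have "\<forall>y\<in>W. \<exists>x. x \<in> W \<and> B x = y" using onto by blast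
    then obtain g where g: "\<And>y. y \<in> W \<Longrightarrow> g y \<in> W" "\<And>y. y \<in> W \<Longrightarrow> B (g y) = y" by metis
    have gd: "norm (g y - g z) \<le> norm (y - z) / c" if "y \<in> W" "z \<in> W" for y z
      using c(2)[of "g y - g z"] c(1) g that
      by (simp add: closed_csubspaceD[OF W] clin_simps[OF B] field_simps)
    have wx: "w + \<nu> *\<^sub>C x \<in> W" if "x \<in> W" for x using w that by (simp add: closed_csubspaceD[OF W])
    have "\<exists>!x. x \<in> W \<and> g (w + \<nu> *\<^sub>C x) = x"
    proof (rule Banach_fix[of W "cmod \<nu> / c"])
      show "complete W" using closed_csubspaceD(2)[OF W] by (simp add: complete_eq_closed)
      show "W \<noteq> {}" using w by blast
      show "0 \<le> cmod \<nu> / c" "cmod \<nu> / c < 1" using c(1) nu by auto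
      show "(\<lambda>x. g (w + \<nu> *\<^sub>C x)) ` W \<subseteq> W" using g wx by blast
      show "dist (g (w + \<nu> *\<^sub>C x)) (g (w + \<nu> *\<^sub>C y)) \<le> cmod \<nu> / c * dist x y"
        if "x \<in> W" "y \<in> W" for x y
        using gd[OF wx[OF that(1)] wx[OF that(2)]]
        by (simp add: dist_norm norm_scaleC complex_vector.scale_right_diff_distrib[symmetric])
    qed
    then obtain x where x: "x \<in> W" "g (w + \<nu> *\<^sub>C x) = x" by blast
    then have "B x = w + \<nu> *\<^sub>C x" using g(2)[OF wx[OF x(1)]] by simp
    then show "w \<in> (\<lambda>x. B x - \<nu> *\<^sub>C x) ` W" using x(1) by (intro image_eqI[of _ _ x]) auto
  qed
qed

section \<open>Orthonormal sequences\<close>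

definition onseq :: "(nat \<Rightarrow> 'a::complex_hilbert_space) \<Rightarrow> bool"
  where "onseq p \<longleftrightarrow> (\<forall>m n. cinner (p m) (p n) = (if m = n then 1 else 0))"

lemma onseqD: "onseq p \<Longrightarrow> cinner (p m) (p n) = (if m = n then 1 else 0)"
  by (simp add: onseq_def)

lemma onseq_norm: "onseq p \<Longrightarrow> norm (p n) = 1"
  using onseqD[of p n n] by (simp add: cinner_self power2_eq_1_iff)
    (metis abs_norm_cancel abs_one of_real_eq_1_iff power2_eq_1_iff abs_minus_cancel of_real_power)

lemma norm_sum_onseq:
  assumes "onseq p" "finite I"
  shows "(norm (\<Sum>n\<in>I. a n *\<^sub>C p n))\<^sup>2 = (\<Sum>n\<in>I. (cmod (a n))\<^sup>2)"
  using assms(2)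
proof (induction I rule: finite_induct)
  case (insert i I)
  have "cinner (a i *\<^sub>C p i) (\<Sum>n\<in>I. a n *\<^sub>C p n) = 0"
    unfolding cinner_sum_right
    by (intro sum.neutral) (use insert onseqD[OF assms(1)] in \<open>auto simp: cinner_simps\<close>)
  from norm_add_sq_orth[OF this] insert show ?case
    by (simp add: norm_scaleC onseq_norm[OF assms(1)])
qed simp

lemma bessel:
  assumes "onseq p" "finite I"
  shows "(\<Sum>n\<in>I. (cmod (cinner x (p n)))\<^sup>2) \<le> (norm x)\<^sup>2"
proof -
  let ?y = "\<Sum>n\<in>I. cinner x (p n) *\<^sub>C p n"
  have "cinner ?y (p k) = cinner x (p k)" if "k \<in> I" for k
    using that assms(2) by (simp add: cinner_sum_left cinner_simps onseqD[OF assms(1)] if_distrib cong: if_cong)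
  then have "cinner (x - ?y) ?y = 0"
    by (simp add: cinner_sum_right cinner_simps)
  from norm_add_sq_orth[OF this] show ?thesis by (simp add: norm_sum_onseq[OF assms])
qed

lemma summable_onseq:
  assumes p: "onseq p" and s: "summable (\<lambda>n. (cmod (a n))\<^sup>2)"
  shows "summable (\<lambda>n. a n *\<^sub>C p n)"
  unfolding summable_Cauchy
proof (intro allI impI)
  fix e :: real assume e: "e > 0"
  then have "e\<^sup>2 > 0" by simp
  then obtain N where N: "\<And>m n. m \<ge> N \<Longrightarrow> norm (\<Sum>k=m..<n. (cmod (a k))\<^sup>2) < e\<^sup>2"
    using s unfolding summable_Cauchy by blast
  have "norm (\<Sum>k=m..<n. a k *\<^sub>C p k) < e" if "m \<ge> N" for m n
  proof -
    have "(norm (\<Sum>k=m..<n. a k *\<^sub>C p k))\<^sup>2 < e\<^sup>2"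
      using N[OF that, of n] by (simp add: norm_sum_onseq[OF p] sum_nonneg)
    then show ?thesis using e by (simp add: power2_less_imp_less)
  qed
  then show "\<exists>N. \<forall>m\<ge>N. \<forall>n. norm (\<Sum>k=m..<n. a k *\<^sub>C p k) < e" by blast
qed

lemma summable_bessel:
  assumes "onseq p" shows "summable (\<lambda>n. (cmod (cinner x (p n)))\<^sup>2)"
  by (rule bounded_imp_summable[where B = "(norm x)\<^sup>2"])
    (auto intro: bessel[OF assms])

text \<open>With two sequences this covers both uses: \<open>p = q\<close> gives a diagonal
  operator, and \<open>c = (\<lambda>n. 1)\<close> gives the partial isometry that carries one
  orthonormal sequence to another.\<close>

definition diagop :: "(nat \<Rightarrow> complex) \<Rightarrow> (nat \<Rightarrow> 'a) \<Rightarrow> (nat \<Rightarrow> 'a) \<Rightarrow> 'a \<Rightarrow> 'a::complex_hilbert_space"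
  where "diagop c p q x = (\<Sum>n. (c n * cinner x (p n)) *\<^sub>C q n)"

context
  fixes c :: "nat \<Rightarrow> complex" and p q :: "nat \<Rightarrow> 'a::complex_hilbert_space" and C :: real
  assumes p: "onseq p" and q: "onseq q" and C: "\<And>n. cmod (c n) \<le> C"
begin

lemma diagop_coeff_le: "(cmod (c n * cinner x (p n)))\<^sup>2 \<le> C\<^sup>2 * (cmod (cinner x (p n)))\<^sup>2"
  unfolding norm_mult power_mult_distrib
  by (intro mult_right_mono power_mono C) auto

lemma summable_diagop: "summable (\<lambda>n. (c n * cinner x (p n)) *\<^sub>C q n)"
proof (rule summable_onseq[OF q])
  show "summable (\<lambda>n. (cmod (c n * cinner x (p n)))\<^sup>2)"
    by (rule summable_comparison_test[OF _ summable_mult[OF summable_bessel[OF p], of "C\<^sup>2" x]])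
      (use diagop_coeff_le in auto)
qed

lemma norm_diagop: "norm (diagop c p q x) \<le> C * norm x"
proof -
  have C0: "0 \<le> C" using C[of 0] norm_ge_zero order_trans by blast
  have "norm (\<Sum>n<N. (c n * cinner x (p n)) *\<^sub>C q n) \<le> C * norm x" for N
  proof -
    have "(norm (\<Sum>n<N. (c n * cinner x (p n)) *\<^sub>C q n))\<^sup>2 \<le> (\<Sum>n<N. C\<^sup>2 * (cmod (cinner x (p n)))\<^sup>2)"
      by (subst norm_sum_onseq[OF q]) (auto intro!: sum_mono diagop_coeff_le)
    also have "\<dots> \<le> (C * norm x)\<^sup>2"
      unfolding sum_distrib_left[symmetric] power_mult_distrib by (intro mult_left_mono bessel[OF p]) auto
    finally show ?thesis using C0 by (simp add: power2_le_iff_abs_le)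
  qed
  moreover have "(\<lambda>N. norm (\<Sum>n<N. (c n * cinner x (p n)) *\<^sub>C q n)) \<longlonglongrightarrow> norm (diagop c p q x)"
    unfolding diagop_def by (intro tendsto_norm summable_LIMSEQ summable_diagop)
  ultimately show ?thesis by (intro LIMSEQ_le_const2) auto
qed

lemma bounded_clinear_diagop: "bounded_clinear (diagop c p q)"
proof (rule bounded_clinearI[where K = C])
  show "diagop c p q (x + y) = diagop c p q x + diagop c p q y" for x y
    unfolding diagop_def suminf_add[OF summable_diagop summable_diagop]
    by (simp add: cinner_simps algebra_simps scaleC_add_left)
  show "diagop c p q (a *\<^sub>C x) = a *\<^sub>C diagop c p q x" for a x
    unfolding diagop_def
    using bounded_linear.suminf[OF bounded_clinear_bounded_linear[OF bounded_clinear_scale] summable_diagop, of a x]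
    by (simp add: cinner_simps scaleC_scaleC mult_ac)
qed (simp add: norm_diagop mult.commute)

lemma cinner_diagop: "cinner (diagop c p q x) (q k) = c k * cinner x (p k)"
proof -
  have "cinner (diagop c p q x) (q k) = (\<Sum>n. cinner ((c n * cinner x (p n)) *\<^sub>C q n) (q k))"
    unfolding diagop_def by (rule bounded_linear.suminf[OF bounded_linear_cinner_left summable_diagop])
  also have "\<dots> = (\<Sum>n. if n = k then c n * cinner x (p n) else 0)"
    by (rule suminf_cong) (simp add: cinner_simps onseqD[OF q])
  finally show ?thesis using sums_unique[OF sums_single[of k "\<lambda>n. c n * cinner x (p n)"]] by simp
qed

lemma diagop_basis: "diagop c p q (p k) = c k *\<^sub>C q k"
proof -
  have "diagop c p q (p k) = (\<Sum>n. if n = k then c n *\<^sub>C q n else 0)"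
    unfolding diagop_def by (rule suminf_cong) (simp add: onseqD[OF p])
  then show ?thesis using sums_unique[OF sums_single[of k "\<lambda>n. c n *\<^sub>C q n"]] by simp
qed

lemma diagop_in_cls: "diagop c p q x \<in> cls (range q)"
proof -
  note M = closed_csubspace_cls[of "range q"]
  have "(\<Sum>n<N. (c n * cinner x (p n)) *\<^sub>C q n) \<in> cls (range q)" for N
    using closed_csubspaceD(1)[OF M] cls_superset[of "range q"]
    by (intro complex_vector.subspace_sum) (auto intro!: complex_vector.subspace_scale)
  then show ?thesis unfolding diagop_def
    using closed_sequentially[OF closed_csubspaceD(2)[OF M] _ summable_LIMSEQ[OF summable_diagop]] by blast
qed

end

lemma cls_eqI:
  assumes "x \<in> cls F" "y \<in> cls F" "\<And>f. f \<in> F \<Longrightarrow> cinner x f = cinner y f"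
  shows "x = y"
proof -
  have "x - y \<in> perp F" using assms(3) by (simp add: perp_def cinner_simps)
  then have "x - y \<in> perp (cls F)" by (simp add: perp_cls)
  moreover have "x - y \<in> cls F" using assms closed_csubspaceD(5)[OF closed_csubspace_cls] by blast
  ultimately have "cinner (x - y) (x - y) = 0" by (rule perpD)
  then show ?thesis by simp
qed

lemma onseq_expansion:
  assumes "onseq p" "x \<in> cls (range p)"
  shows "x = (\<Sum>n. cinner x (p n) *\<^sub>C p n)" "summable (\<lambda>n. cinner x (p n) *\<^sub>C p n)"
proof -
  have "x = diagop (\<lambda>n. 1) p p x"
    using cinner_diagop[OF assms(1,1), of "\<lambda>n. 1" 1]
    by (intro cls_eqI[OF assms(2) diagop_in_cls[OF assms(1,1), of _ 1]]) auto
  then show "x = (\<Sum>n. cinner x (p n) *\<^sub>C p n)" by (simp add: diagop_def)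
  show "summable (\<lambda>n. cinner x (p n) *\<^sub>C p n)"
    using summable_diagop[OF assms(1,1), of "\<lambda>n. 1" 1] by simp
qed

section \<open>Finite dimensional subspaces\<close>

text \<open>Each vector of \<open>F\<close> costs at most one further spanning vector, namely some
  \<open>z\<close> of the subspace that is not orthogonal to it.\<close>

lemma finite_dim_of_perp:
  assumes "finite F" "csubspace Z" "Z \<inter> perp F \<subseteq> {0}"
  shows "\<exists>B. finite B \<and> B \<subseteq> Z \<and> Z \<subseteq> cspan B"
  using assms
proof (induction F arbitrary: Z rule: finite_induct)
  case empty then show ?case by (intro exI[of _ "{}"]) (auto simp: perp_def)
next
  case (insert f F)
  let ?Z = "Z \<inter> perp {f}"
  have "csubspace ?Z"
    by (rule complex_vector.subspace_inter[OF insert.prems(1) closed_csubspaceD(1)[OF closed_csubspace_perp]])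
  moreover have "?Z \<inter> perp F \<subseteq> {0}" using insert.prems by (auto simp: perp_def)
  ultimately have "\<exists>B. finite B \<and> B \<subseteq> ?Z \<and> ?Z \<subseteq> cspan B" by (rule insert.IH)
  then obtain B where B: "finite B" "B \<subseteq> ?Z" "?Z \<subseteq> cspan B" by (elim exE conjE)
  show ?case
  proof (cases "Z \<subseteq> perp {f}")
    case True then show ?thesis using B by blast
  next
    case False
    then obtain z where z: "z \<in> Z" "cinner z f \<noteq> 0" by (auto simp: perp_def)
    have "x \<in> cspan (insert z B)" if x: "x \<in> Z" for x
    proof -
      have "x - (cinner x f / cinner z f) *\<^sub>C z \<in> ?Z"
        using x z insert.prems(1)
        by (auto simp: perp_def cinner_simps complex_vector.subspace_diff complex_vector.subspace_scale)
      then show ?thesis using B(3) complex_vector.span_breakdown_eq by blast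
    qed
    then show ?thesis using B z by (intro exI[of _ "insert z B"]) auto
  qed
qed

lemma infinite_cdim_perp:
  assumes "csubspace Z" "infinite_cdim Z" "finite F"
  shows "\<exists>z\<in>Z \<inter> perp F. norm z = 1"
proof -
  have "\<not> Z \<inter> perp F \<subseteq> {0}"
  proof
    assume "Z \<inter> perp F \<subseteq> {0}"
    from finite_dim_of_perp[OF assms(3,1) this] show False
      using assms(2) by (auto simp: infinite_cdim_def)
  qed
  then obtain z where z: "z \<in> Z \<inter> perp F" "z \<noteq> 0" by blast
  have "complex_of_real (1 / norm z) *\<^sub>C z \<in> Z \<inter> perp F"
    using z assms(1) closed_csubspaceD(6)[OF closed_csubspace_perp] complex_vector.subspace_scale by blast
  moreover have "norm (complex_of_real (1 / norm z) *\<^sub>C z) = 1" using z(2) by (rule norm_unitv[unfolded unitv_def])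
  ultimately show ?thesis by blast
qed

lemma infinite_independent_not_in_finite_span:
  assumes "complex_vector.independent S" "infinite S" "finite B" shows "\<not> S \<subseteq> cspan B"
  using complex_vector.independent_span_bound assms by blast

text \<open>Dimensions are bounded by \<open>card B\<close>. One repetition suffices for the
  ascending chains in view, the kernels of powers, since these stay constant from then on. The
  descending chain in view, a kernel intersected with ranges of powers, may pause and shrink again,
  so eventual constancy is asked for.\<close>

lemma finite_dim_chain:
  fixes Z :: "nat \<Rightarrow> 'a::complex_hilbert_space set"
  assumes fin: "finite B" and Z: "\<And>n. Z n \<subseteq> cspan B" "\<And>n. csubspace (Z n)"
  shows "(\<And>n. Z n \<subseteq> Z (Suc n)) \<Longrightarrow> \<exists>k. Z (Suc k) = Z k"
    and "(\<And>n. Z (Suc n) \<subseteq> Z n) \<Longrightarrow> \<exists>k. \<forall>n\<ge>k. Z n = Z k"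
proof -
  have dim_le: "complex_vector.dim (Z n) \<le> card B" for n
    using complex_vector.dim_le_card[OF Z(1) fin] .
  have "\<exists>C. C \<subseteq> Z n \<and> complex_vector.independent C \<and> Z n \<subseteq> cspan C \<and> card C = complex_vector.dim (Z n)" for n
    using complex_vector.basis_exists[of "Z n"] by metis
  then obtain Bs where Bs: "\<And>n. Bs n \<subseteq> Z n" "\<And>n. complex_vector.independent (Bs n)"
    "\<And>n. Z n \<subseteq> cspan (Bs n)" "\<And>n. card (Bs n) = complex_vector.dim (Z n)"
    by metis
  have finBs: "finite (Bs n)" for n
    using complex_vector.independent_span_bound[OF fin Bs(2)] Bs(1) Z(1) by blast
  have eq: "Z m = Z n" if sub: "Z m \<subseteq> Z n" and d: "complex_vector.dim (Z n) \<le> complex_vector.dim (Z m)" for m n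
  proof
    show "Z n \<subseteq> Z m"
    proof
      fix x assume x: "x \<in> Z n"
      show "x \<in> Z m"
      proof (rule ccontr)
        assume nx: "x \<notin> Z m"
        have sp: "cspan (Bs m) \<subseteq> Z m" using Bs(1) Z(2) by (simp add: complex_vector.span_minimal)
        then have "x \<notin> cspan (Bs m)" using nx by blast
        then have "complex_vector.independent (insert x (Bs m))"
          using Bs(2) by (simp add: complex_vector.independent_insert)
        moreover have "insert x (Bs m) \<subseteq> cspan (Bs n)" using x sub Bs(1,3) by blast
        ultimately have "card (insert x (Bs m)) \<le> card (Bs n)"
          using complex_vector.independent_span_bound[OF finBs] by blast
        moreover have "x \<notin> Bs m" using nx Bs(1) by blast
        ultimately show False using finBs d Bs(4) by simp
      qed
    qed
  qed fact
  {
    assume inc: "\<And>n. Z n \<subseteq> Z (Suc n)"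
    show "\<exists>k. Z (Suc k) = Z k"
    proof (rule ccontr)
      assume no: "\<nexists>k. Z (Suc k) = Z k"
      have "complex_vector.dim (Z n) < complex_vector.dim (Z (Suc n))" for n
        using eq[OF inc[of n]] no by (metis not_less)
      then have "n \<le> complex_vector.dim (Z n)" for n
      proof (induction n)
        case (Suc n) then show ?case by (metis Suc_leI le_less_trans)
      qed simp
      from this[of "Suc (card B)"] dim_le[of "Suc (card B)"] show False by simp
    qed
  }
  {
    assume dec: "\<And>n. Z (Suc n) \<subseteq> Z n"
    have dec': "Z n \<subseteq> Z k" if "n \<ge> k" for n k using lift_Suc_antimono_le[of Z] dec that by blast
    obtain k where k: "\<And>n. complex_vector.dim (Z k) \<le> complex_vector.dim (Z n)"
      using ex_has_least_nat[of "\<lambda>_. True" undefined "\<lambda>n. complex_vector.dim (Z n)"] by auto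
    show "\<exists>k. \<forall>n\<ge>k. Z n = Z k" using eq[OF dec' k] by blast
  }
qed

lemma csubspace_image:
  assumes A: "bounded_clinear A" and Y: "csubspace Y" shows "csubspace (A ` Y)"
  unfolding csubspace_iff
proof (intro conjI ballI allI)
  show "0 \<in> A ` Y"
    using Y bounded_clinear_zero_right[OF A] by (metis complex_vector.subspace_0 image_eqI)
  show "x + y \<in> A ` Y" if "x \<in> A ` Y" "y \<in> A ` Y" for x y
    using that Y by (auto simp: bounded_clinear_add[OF A, symmetric] complex_vector.subspace_add)
  show "c *\<^sub>C x \<in> A ` Y" if "x \<in> A ` Y" for x c
    using that Y by (auto simp: bounded_clinear_scaleC[OF A, symmetric] complex_vector.subspace_scale)
qed

lemma finite_dim_preimage:
  assumes A: "bounded_clinear A" and X: "csubspace X" and "finite B" "{x\<in>X. A x = 0} \<subseteq> cspan B"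
    and "finite B'" "A ` X \<subseteq> cspan B'"
  shows "\<exists>D. finite D \<and> X \<subseteq> cspan D"
proof -
  obtain Bs where Bs: "Bs \<subseteq> A ` X" "complex_vector.independent Bs" "A ` X \<subseteq> cspan Bs"
    using complex_vector.basis_exists by metis
  have "finite Bs" using complex_vector.independent_span_bound[OF assms(5) Bs(2)] Bs(1) assms(6) by blast
  obtain D where D: "D \<subseteq> X" "finite D" "Bs = A ` D" using finite_subset_image[OF \<open>finite Bs\<close> Bs(1)] by blast
  have "x \<in> cspan (D \<union> B)" if x: "x \<in> X" for x
  proof -
    have "cspan Bs \<subseteq> A ` cspan D"
    proof (rule complex_vector.span_minimal)
      show "Bs \<subseteq> A ` cspan D" using D(3) complex_vector.span_superset by blast
      show "csubspace (A ` cspan D)" using csubspace_image[OF A complex_vector.subspace_span] .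
    qed
    then have "A x \<in> A ` cspan D" using Bs(3) x by blast
    then obtain d where d: "d \<in> cspan D" "A x = A d" by blast
    have "d \<in> X" using d(1) D(1) X complex_vector.span_minimal by blast
    then have "x - d \<in> {x\<in>X. A x = 0}" using x d X by (simp add: complex_vector.subspace_diff clin_simps[OF A])
    then have "x - d \<in> cspan (D \<union> B)" using assms(4) complex_vector.span_mono[of B "D \<union> B"] by blast
    moreover have "d \<in> cspan (D \<union> B)" using d(1) complex_vector.span_mono[of D "D \<union> B"] by blast
    ultimately show ?thesis by (metis complex_vector.span_add diff_add_cancel)
  qed
  then show ?thesis using D(2) assms(3) by (intro exI[of _ "D \<union> B"]) auto
qed

section \<open>Regular points and Riesz points\<close>

text \<open>Membership of 0 in the closure of the resolvent set. One use is through
  \<open>bounded_below_and_onto\<close>, where it supplies small \<open>\<nu>\<close> that are not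
  eigenvalues.\<close>

definition near_regular :: "('a::complex_hilbert_space \<Rightarrow> 'a) \<Rightarrow> bool"
  where "near_regular A \<longleftrightarrow> (\<forall>\<epsilon>>0. \<exists>\<nu>. cmod \<nu> < \<epsilon> \<and> regular A \<nu>)"

text \<open>\<open>A\<close> is invertible on an invariant subspace of finite codimension.\<close>

definition riesz_point :: "('a::complex_hilbert_space \<Rightarrow> 'a) \<Rightarrow> bool"
  where "riesz_point A \<longleftrightarrow> (\<exists>F. finite F \<and> (\<forall>x\<in>perp F. A x \<in> perp F) \<and>
    (\<exists>c>0. \<forall>x\<in>perp F. c * norm x \<le> norm (A x)) \<and> perp F \<subseteq> A ` perp F)"

lemma regularI:
  assumes B: "bounded_clinear B" and c: "c > 0" "\<And>x. c * norm x \<le> norm (B x - \<nu> *\<^sub>C x)"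
    and onto: "\<And>y. \<exists>x. B x - \<nu> *\<^sub>C x = y"
  shows "regular B \<nu>"
proof -
  define D where "D x = B x - \<nu> *\<^sub>C x" for x
  have D: "bounded_clinear D"
    unfolding D_def by (intro bounded_clinear_intros B)
  have inj: "x = y" if "D x = D y" for x y
  proof -
    have "c * norm (x - y) \<le> 0" using c(2)[of "x - y"] that by (simp add: D_def[symmetric] clin_simps[OF D])
    then show ?thesis using c(1) by (simp add: mult_le_0_iff)
  qed
  define R where "R y = (SOME x. D x = y)" for y
  have R: "D (R y) = y" for y
    unfolding R_def by (rule someI_ex) (use onto in \<open>auto simp: D_def\<close>)
  have RD: "R (D x) = x" for x by (rule inj) (rule R)
  have "bounded_clinear R"
  proof (rule bounded_clinearI[where K = "1 / c"])
    show "R (x + y) = R x + R y" for x y by (rule inj) (simp add: clin_simps[OF D] R)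
    show "R (a *\<^sub>C x) = a *\<^sub>C R x" for a x by (rule inj) (simp add: clin_simps[OF D] R)
    show "norm (R x) \<le> norm x * (1 / c)" for x
      using c(2)[of "R x"] c(1) R[of x] by (simp add: D_def field_simps)
  qed
  then show ?thesis unfolding regular_def using R RD unfolding D_def by blast
qed

lemma regular_inj: "regular B \<nu> \<Longrightarrow> B x = \<nu> *\<^sub>C x \<Longrightarrow> bounded_clinear B \<Longrightarrow> x = 0"
  unfolding regular_def by (metis bounded_clinear_zero_right diff_self)

lemma near_regular_inj:
  assumes "near_regular B" "bounded_clinear B" "\<epsilon> > 0"
  shows "\<exists>\<nu>. cmod \<nu> < \<epsilon> \<and> (\<forall>x\<in>W. B x = \<nu> *\<^sub>C x \<longrightarrow> x = 0)"
  using assms regular_inj unfolding near_regular_def by blast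

lemma regular_adj:
  assumes B: "bounded_clinear B" and "regular B \<nu>" shows "regular (adj B) (cnj \<nu>)"
proof -
  obtain R where R: "bounded_clinear R" "\<And>x. B (R x) - \<nu> *\<^sub>C R x = x" "\<And>x. R (B x - \<nu> *\<^sub>C x) = x"
    using assms(2) unfolding regular_def by blast
  note aB = bounded_clinear_adj[OF B] and aR = bounded_clinear_adj[OF R(1)]
  have "cinner z (adj B (adj R x) - cnj \<nu> *\<^sub>C adj R x) = cinner z x" for x z
  proof -
    have "cinner z (adj B (adj R x) - cnj \<nu> *\<^sub>C adj R x) = cinner (R (B z - \<nu> *\<^sub>C z)) x"
      by (simp add: cinner_simps cinner_adj[OF B, symmetric] cinner_adj[OF R(1)])
    then show ?thesis by (simp add: R)
  qed
  then have 1: "adj B (adj R x) - cnj \<nu> *\<^sub>C adj R x = x" for x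
    by (rule cinner_ext_right)
  have "cinner z (adj R (adj B x - cnj \<nu> *\<^sub>C x)) = cinner z x" for x z
  proof -
    have "cinner z (adj R (adj B x - cnj \<nu> *\<^sub>C x)) = cinner (B (R z) - \<nu> *\<^sub>C R z) x"
      by (simp add: cinner_simps cinner_adj[OF B] cinner_adj[OF R(1), symmetric])
    then show ?thesis by (simp add: R)
  qed
  then have 2: "adj R (adj B x - cnj \<nu> *\<^sub>C x) = x" for x
    by (rule cinner_ext_right)
  show ?thesis unfolding regular_def using aR 1 2 by blast
qed

lemma near_regular_adj:
  assumes "bounded_clinear B" "near_regular B" shows "near_regular (adj B)"
  unfolding near_regular_def
proof (intro allI impI)
  fix \<epsilon> :: real assume "\<epsilon> > 0"
  then obtain \<nu> where "cmod \<nu> < \<epsilon>" "regular B \<nu>" using assms(2) unfolding near_regular_def by blast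
  then show "\<exists>\<nu>. cmod \<nu> < \<epsilon> \<and> regular (adj B) \<nu>"
    using regular_adj[OF assms(1)] by (intro exI[of _ "cnj \<nu>"]) auto
qed

text \<open>Independence of eigenvectors for distinct eigenvalues, in the quotient by
  \<open>G\<close>: applying \<open>A - ev v\<close> removes the term of \<open>v\<close> and keeps
  the sum in \<open>G\<close>.\<close>

lemma eigenvectors_mod_invariant:
  assumes A: "bounded_clinear A" and G: "csubspace G" "\<And>x. x \<in> G \<Longrightarrow> A x \<in> G"
    and "finite t" "\<And>w. w \<in> t \<Longrightarrow> A w = ev w *\<^sub>C w" "inj_on ev t" "(\<Sum>w\<in>t. c w *\<^sub>C w) \<in> G"
  shows "\<forall>w\<in>t. c w *\<^sub>C w \<in> G"
  using assms(4-)
proof (induction t arbitrary: c rule: finite_induct)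
  case (insert v t)
  let ?x = "\<Sum>w\<in>insert v t. c w *\<^sub>C w"
  have "A ?x - ev v *\<^sub>C ?x = (\<Sum>w\<in>insert v t. (c w * (ev w - ev v)) *\<^sub>C w)"
    unfolding bounded_clinear_sum[OF A] complex_vector.scale_sum_right sum_subtractf[symmetric]
    using insert.prems(1)
    by (intro sum.cong) (auto simp: clin_simps[OF A] scaleC_scaleC algebra_simps
        complex_vector.scale_left_diff_distrib)
  also have "\<dots> = (\<Sum>w\<in>t. (c w * (ev w - ev v)) *\<^sub>C w)" using insert.hyps by simp
  finally have eq: "A ?x - ev v *\<^sub>C ?x = (\<Sum>w\<in>t. (c w * (ev w - ev v)) *\<^sub>C w)" .
  have "A ?x - ev v *\<^sub>C ?x \<in> G"
    by (intro complex_vector.subspace_diff[OF G(1)] complex_vector.subspace_scale[OF G(1)] G(2) insert.prems(3))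
  then have "(\<Sum>w\<in>t. (c w * (ev w - ev v)) *\<^sub>C w) \<in> G" unfolding eq .
  then have *: "\<forall>w\<in>t. (c w * (ev w - ev v)) *\<^sub>C w \<in> G"
    using insert.IH[of "\<lambda>w. c w * (ev w - ev v)"] insert.prems(1,2) by (auto simp: inj_on_def)
  have t: "c w *\<^sub>C w \<in> G" if "w \<in> t" for w
  proof -
    have "ev w - ev v \<noteq> 0" using insert.prems(2) insert.hyps that by (auto simp: inj_on_def)
    then have eq: "1 / (ev w - ev v) * (c w * (ev w - ev v)) = c w" by simp
    have "(c w * (ev w - ev v)) *\<^sub>C w \<in> G" using * that by blast
    from complex_vector.subspace_scale[OF G(1) this, of "1 / (ev w - ev v)"]
    have "((1 / (ev w - ev v)) * (c w * (ev w - ev v))) *\<^sub>C w \<in> G" by (simp only: scaleC_scaleC)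
    then show ?thesis unfolding eq .
  qed
  then have "(\<Sum>w\<in>t. c w *\<^sub>C w) \<in> G" by (rule complex_vector.subspace_sum[OF G(1)])
  moreover have "c v *\<^sub>C v = ?x - (\<Sum>w\<in>t. c w *\<^sub>C w)" using insert.hyps by simp
  ultimately have "c v *\<^sub>C v \<in> G" using complex_vector.subspace_diff[OF G(1) insert.prems(3)] by metis
  then show ?case using t by blast
qed simp

text \<open>The eigenvectors are independent modulo \<open>G\<close>, so their span meets
  \<open>perp F\<close> only in 0 and is finite dimensional. The intended cases are
  \<open>G = perp F\<close> for an operator and \<open>G = {0}\<close> for its adjoint.\<close>

lemma finitely_many_eigenvalues:
  assumes A: "bounded_clinear A" and G: "csubspace G" "\<And>x. x \<in> G \<Longrightarrow> A x \<in> G" and F: "finite F"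
    and S: "\<And>\<nu>. \<nu> \<in> S \<Longrightarrow> v \<nu> \<noteq> 0 \<and> A (v \<nu>) = \<nu> *\<^sub>C v \<nu> \<and> (v \<nu> \<in> G \<longrightarrow> v \<nu> = 0)"
    and triv: "cspan (v ` S) \<inter> perp F \<subseteq> G"
  shows "finite S"
proof (rule ccontr)
  assume inf: "infinite S"
  have inj: "inj_on v S"
  proof (rule inj_onI)
    fix a b assume "a \<in> S" "b \<in> S" "v a = v b"
    then have "a *\<^sub>C v a = b *\<^sub>C v a" "v a \<noteq> 0" using S by metis+
    then show "a = b" by simp
  qed
  define ev where "ev = the_inv_into S v"
  have ev: "ev (v a) = a" if "a \<in> S" for a unfolding ev_def using the_inv_into_f_f[OF inj that] .
  have inj_ev: "inj_on ev t" if "t \<subseteq> v ` S" for t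
    using that ev by (intro inj_onI) (metis imageE subsetD)
  have ev_eq: "A w = ev w *\<^sub>C w" if "w \<in> v ` S" for w using S that ev by fastforce
  have zero: "c w = 0" if "finite t" "t \<subseteq> v ` S" "(\<Sum>w\<in>t. c w *\<^sub>C w) \<in> G" "w \<in> t" for t c w
  proof (rule ccontr)
    assume "c w \<noteq> 0"
    have "c w *\<^sub>C w \<in> G"
      using eigenvectors_mod_invariant[OF A G that(1) _ inj_ev[OF that(2)] that(3)] ev_eq that(2,4) by blast
    then have "(1 / c w) *\<^sub>C c w *\<^sub>C w \<in> G" using G(1) complex_vector.subspace_scale by blast
    then have "w \<in> G" using \<open>c w \<noteq> 0\<close> by (simp add: scaleC_scaleC)
    then show False using S that(2,4) by blast
  qed
  have "complex_vector.independent (v ` S)"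
    unfolding complex_vector.dependent_explicit
    using zero complex_vector.subspace_0[OF G(1)] by (metis (no_types, lifting))
  moreover have "infinite (v ` S)" using inf inj finite_imageD by blast
  moreover have "cspan (v ` S) \<inter> perp F \<subseteq> {0}"
  proof
    fix x assume x: "x \<in> cspan (v ` S) \<inter> perp F"
    then obtain t c where t: "finite t" "t \<subseteq> v ` S" "x = (\<Sum>w\<in>t. c w *\<^sub>C w)"
      unfolding complex_vector.span_explicit by blast
    then have "\<forall>w\<in>t. c w = 0" using zero triv x by blast
    then show "x \<in> {0}" using t(3) by simp
  qed
  from finite_dim_of_perp[OF F complex_vector.subspace_span this]
  obtain B where "finite B" "cspan (v ` S) \<subseteq> cspan B" by blast
  then have "v ` S \<subseteq> cspan B" using complex_vector.span_superset by blast
  ultimately show False using infinite_independent_not_in_finite_span \<open>finite B\<close> by blast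
qed

lemma bounded_below_of_inj_CP:
  assumes B: "bounded_clinear B" and cp: "CP B UNIV" and inj: "\<And>x. B x = 0 \<Longrightarrow> x = 0"
  shows "\<exists>c>0. \<forall>x. c * norm x \<le> norm (B x)"
proof -
  have "{x\<in>UNIV. B x = 0} \<subseteq> {0}" using inj by blast
  then have "perp {x\<in>UNIV. B x = 0} = UNIV" by (auto simp: perp_def)
  then show ?thesis using CP_bounded_below_off_kernel[OF B closed_csubspace_UNIV cp] by auto
qed

text \<open>For small \<open>\<nu>\<close> the operator \<open>A - \<nu>\<close> is bounded below
  and onto on \<open>perp F\<close>. Hence eigenvectors of \<open>A\<close> stay outside
  \<open>perp F\<close> and those of the adjoint are orthogonal to it, which leaves finitely many
  exceptional \<open>\<nu>\<close>. At any other small point \<open>A - \<nu>\<close> is injective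
  with closed and dense range.\<close>

lemma riesz_near_regular:
  assumes A: "bounded_clinear A" and "riesz_point A"
  shows "near_regular A"
  unfolding near_regular_def
proof (intro allI impI)
  fix \<epsilon> :: real assume e: "\<epsilon> > 0"
  obtain F c where F: "finite F" "\<And>x. x \<in> perp F \<Longrightarrow> A x \<in> perp F" and c: "c > 0"
    "\<And>x. x \<in> perp F \<Longrightarrow> c * norm x \<le> norm (A x)" and onto: "perp F \<subseteq> A ` perp F"
    using assms(2) unfolding riesz_point_def by blast
  note W = closed_csubspace_perp[of F]
  define r where "r = min \<epsilon> c"
  have r: "r > 0" using e c(1) by (simp add: r_def)
  have low: "(c - cmod \<nu>) * norm x \<le> norm (A x - \<nu> *\<^sub>C x)" "perp F \<subseteq> (\<lambda>x. A x - \<nu> *\<^sub>C x) ` perp F"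
    if "\<nu> \<in> ball 0 r" "x \<in> perp F" for \<nu> x
    using perturb_bounded_below_onto[OF A W F(2) c onto, of \<nu>] that by (auto simp: r_def)
  have onto': "perp F \<subseteq> (\<lambda>x. A x - \<nu> *\<^sub>C x) ` perp F" if "\<nu> \<in> ball 0 r" for \<nu>
    using low(2)[OF that closed_csubspaceD(3)[OF W]] .
  define S1 where "S1 = {\<nu>\<in>ball 0 r. \<exists>x. x \<noteq> 0 \<and> A x = \<nu> *\<^sub>C x}"
  define S2 where "S2 = {\<nu>\<in>ball 0 r. \<exists>y. y \<noteq> 0 \<and> adj A y = cnj \<nu> *\<^sub>C y}"
  have inj_perp: "x = 0" if "\<nu> \<in> ball 0 r" "A x = \<nu> *\<^sub>C x" "x \<in> perp F" for x \<nu>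
  proof -
    have "(c - cmod \<nu>) * norm x \<le> 0" using low(1)[OF that(1,3)] that(2) by simp
    moreover have "c - cmod \<nu> > 0" using that(1) by (simp add: r_def)
    ultimately show ?thesis by (simp add: mult_le_0_iff)
  qed
  have "finite S1"
  proof -
    have "\<forall>\<nu>\<in>S1. \<exists>x. x \<noteq> 0 \<and> A x = \<nu> *\<^sub>C x" by (simp add: S1_def)
    then obtain v where v: "\<And>\<nu>. \<nu> \<in> S1 \<Longrightarrow> v \<nu> \<noteq> 0 \<and> A (v \<nu>) = \<nu> *\<^sub>C v \<nu>" by metis
    show ?thesis
    proof (rule finitely_many_eigenvalues[OF A closed_csubspaceD(1)[OF W] F(2) F(1)])
      show "v \<nu> \<noteq> 0 \<and> A (v \<nu>) = \<nu> *\<^sub>C v \<nu> \<and> (v \<nu> \<in> perp F \<longrightarrow> v \<nu> = 0)" if "\<nu> \<in> S1" for \<nu>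
        using v[OF that] inj_perp that by (auto simp: S1_def)
    qed auto
  qed
  moreover have "finite S2"
  proof -
    have "\<forall>\<nu>\<in>S2. \<exists>x. x \<noteq> 0 \<and> adj A x = cnj \<nu> *\<^sub>C x" by (simp add: S2_def)
    then obtain v where v: "\<And>\<nu>. \<nu> \<in> S2 \<Longrightarrow> v \<nu> \<noteq> 0 \<and> adj A (v \<nu>) = cnj \<nu> *\<^sub>C v \<nu>" by metis
    \<comment> \<open>The range of \<open>A - \<nu>\<close> contains \<open>perp F\<close>, and a
      kernel vector of the adjoint is orthogonal to that range.\<close>
    have orth: "v ` S2 \<subseteq> perp (perp F)"
    proof (intro image_subsetI perp_memI)
      fix \<nu> w assume n: "\<nu> \<in> S2" and w: "w \<in> perp F"
      then obtain x where x: "w = A x - \<nu> *\<^sub>C x" using onto'[of \<nu>] by (auto simp: S2_def)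
      have "cinner w (v \<nu>) = 0" using v[OF n] by (simp add: x cinner_simps cinner_adj[OF A])
      then show "cinner (v \<nu>) w = 0" using cinner_eq_0_commute by blast
    qed
    have "finite (cnj ` S2)"
    proof (rule finitely_many_eigenvalues[OF bounded_clinear_adj[OF A] complex_vector.subspace_single_0 _ F(1),
          where v = "\<lambda>\<nu>. v (cnj \<nu>)"])
      show "adj A x \<in> {0}" if "x \<in> {0}" for x
        using that bounded_clinear_zero_right[OF bounded_clinear_adj[OF A]] by simp
      have "cspan (v ` S2) \<subseteq> perp (perp F)"
        by (rule complex_vector.span_minimal[OF orth closed_csubspaceD(1)[OF closed_csubspace_perp]])
      then have "cspan (v ` S2) \<inter> perp F \<subseteq> {0}" using perpD(1) cinner_self_eq_0 by blast
      then show "cspan ((\<lambda>\<nu>. v (cnj \<nu>)) ` cnj ` S2) \<inter> perp F \<subseteq> {0}" by (simp add: image_image)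
    qed (use v in auto)
    then show ?thesis by (rule finite_imageD) (simp add: inj_on_def)
  qed
  ultimately have "finite (S1 \<union> S2)" by blast
  moreover have "infinite (ball (0::complex) r)"
    using r finite_imp_not_open[of "ball (0::complex) r"] by auto
  ultimately have "\<not> ball 0 r \<subseteq> S1 \<union> S2" using finite_subset by metis
  then obtain \<nu> where nu: "\<nu> \<in> ball 0 r" "\<nu> \<notin> S1" "\<nu> \<notin> S2" by blast
  define D where "D x = A x - \<nu> *\<^sub>C x" for x
  have D: "bounded_clinear D" unfolding D_def by (intro bounded_clinear_intros A)
  have "c - cmod \<nu> > 0" using nu(1) by (simp add: r_def)
  then have "CP D (UNIV \<inter> perp F)"
    using CP_bounded_below[OF D W _ low(1)[OF nu(1), folded D_def]] by simp
  then have "CP D UNIV" by (rule CP_perp[OF D F(1) closed_csubspace_UNIV])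
  moreover have "x = 0" if "D x = 0" for x using nu that by (auto simp: D_def S1_def)
  ultimately obtain c' where c': "c' > 0" "\<And>x. c' * norm x \<le> norm (D x)"
    using bounded_below_of_inj_CP[OF D] by blast
  have "closure (range D) = UNIV"
  proof (rule dense_in_closed_subspaceI[OF closed_csubspace_UNIV])
    show "csubspace (range D)" by (rule csubspace_image[OF D complex_vector.subspace_UNIV])
    fix y assume "\<And>x. x \<in> range D \<Longrightarrow> cinner x y = 0"
    then have "cinner (D x) y = 0" for x by blast
    then have "cinner x (adj A y - cnj \<nu> *\<^sub>C y) = 0" for x
      by (simp add: D_def cinner_simps cinner_adj[OF A])
    then have "adj A y - cnj \<nu> *\<^sub>C y = 0" using cinner_self_eq_0 by blast
    then show "y = 0" using nu by (auto simp: S2_def)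
  qed auto
  then have "\<exists>x. D x = y" for y
    using surj_of_bounded_below_dense[OF D closed_csubspace_UNIV closed_csubspace_UNIV c', of y] by simp
  then have "regular A \<nu>" using regularI[OF A c'(1)] c'(2) unfolding D_def by blast
  then show "\<exists>\<nu>. cmod \<nu> < \<epsilon> \<and> regular A \<nu>" using nu(1) by (auto simp: r_def)
qed

text \<open>The equation is rewritten as \<open>x = (1 / l) *\<^sub>C (T x - w)\<close>, a
  contraction of \<open>W\<close> with ratio \<open>K / cmod l\<close>; the invariance of
  \<open>W\<close> keeps the solution in \<open>W\<close>.\<close>

lemma onto_of_large:
  assumes T: "bounded_clinear T" and W: "closed_csubspace W" and TW: "\<And>x. x \<in> W \<Longrightarrow> T x \<in> W"
    and K: "K \<ge> 0" "\<And>x. norm (T x) \<le> norm x * K" and l: "K < cmod l"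
  shows "W \<subseteq> (\<lambda>x. T x - l *\<^sub>C x) ` W"
proof
  fix w assume w: "w \<in> W"
  have l0: "l \<noteq> 0" using K(1) l by auto
  have "\<exists>!x. x \<in> W \<and> (1 / l) *\<^sub>C (T x - w) = x"
  proof (rule Banach_fix[of W "K / cmod l"])
    show "complete W" using closed_csubspaceD(2)[OF W] by (simp add: complete_eq_closed)
    show "W \<noteq> {}" using w by blast
    show "0 \<le> K / cmod l" "K / cmod l < 1" using K(1) l by (auto simp: divide_less_eq_1)
    show "(\<lambda>x. (1 / l) *\<^sub>C (T x - w)) ` W \<subseteq> W" using TW w by (auto intro!: closed_csubspaceD[OF W])
    show "dist ((1 / l) *\<^sub>C (T x - w)) ((1 / l) *\<^sub>C (T y - w)) \<le> K / cmod l * dist x y"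
      if "x \<in> W" "y \<in> W" for x y
    proof -
      have "(1 / l) *\<^sub>C (T x - w) - (1 / l) *\<^sub>C (T y - w) = (1 / l) *\<^sub>C T (x - y)"
        by (simp add: complex_vector.scale_right_diff_distrib clin_simps[OF T])
      then show ?thesis using K(2)[of "x - y"] l K(1)
        by (simp add: dist_norm norm_scaleC norm_divide divide_right_mono mult.commute)
    qed
  qed
  then obtain x where x: "x \<in> W" "(1 / l) *\<^sub>C (T x - w) = x" by blast
  then have "l *\<^sub>C (1 / l) *\<^sub>C (T x - w) = l *\<^sub>C x" by simp
  then have "T x - w = l *\<^sub>C x" using l0 by (simp add: scaleC_scaleC)
  then have "w = T x - l *\<^sub>C x" by (simp add: algebra_simps)
  then show "w \<in> (\<lambda>x. T x - l *\<^sub>C x) ` W" using x(1) by blast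
qed

lemma bounded_below_of_large:
  assumes "\<And>x. norm (T x) \<le> norm x * K"
  shows "(cmod l - K) * norm x \<le> norm (T x - l *\<^sub>C x)"
  using assms[of x] norm_triangle_ineq3[of "T x" "l *\<^sub>C x"] by (simp add: norm_scaleC algebra_simps)

text \<open>Otherwise the resolvent on \<open>W\<close> would be entire and vanish at infinity.\<close>

lemma spectrum_nonempty_on:
  assumes T: "bounded_clinear T" and W: "closed_csubspace W" and TW: "\<And>x. x \<in> W \<Longrightarrow> T x \<in> W"
    and low: "\<And>l. \<exists>c>0. \<forall>x\<in>W. c * norm x \<le> norm (T x - l *\<^sub>C x)"
  shows "W = {0}"
proof -
  define D where "D l x = T x - l *\<^sub>C x" for l x
  have D: "bounded_clinear (D l)" for l unfolding D_def by (intro bounded_clinear_intros T)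
  have DW: "D l x \<in> W" if "x \<in> W" for l x using that TW by (simp add: D_def closed_csubspaceD[OF W])
  obtain c where c: "\<And>l. c l > 0" "\<And>l x. x \<in> W \<Longrightarrow> c l * norm x \<le> norm (D l x)"
    using low unfolding D_def by metis
  obtain K where K: "K \<ge> 0" "\<And>x. norm (T x) \<le> norm x * K" using bounded_clinear_bound[OF T] by blast
  \<comment> \<open>The hypothesis bounds \<open>D l\<close> below but does not make it onto. The
    set \<open>P\<close> of points where it is onto is open, closed and contains
    \<open>K + 1\<close>, so it is the whole plane.\<close>
  define P where "P = {l. W \<subseteq> D l ` W}"
  have shift: "D (l + m) x = D l x - m *\<^sub>C x" for l m x by (simp add: D_def scaleC_add_left)
  have ball_P: "m \<in> P" if "l \<in> P" "dist m l < a" "0 < a" "\<And>x. x \<in> W \<Longrightarrow> a * norm x \<le> norm (D l x)" for l m a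
  proof -
    have "cmod (m - l) < a" using that(2) by (simp add: dist_norm)
    from perturb_bounded_below_onto(2)[OF D W DW that(3,4) _ this] that(1)
    show ?thesis using shift[of l "m - l"] by (simp add: P_def)
  qed
  have "open P"
    unfolding open_dist
  proof
    fix l assume "l \<in> P"
    then show "\<exists>e>0. \<forall>m. dist m l < e \<longrightarrow> m \<in> P" using ball_P[OF \<open>l \<in> P\<close> _ c(1,2)] c(1) by blast
  qed
  moreover have "open (- P)"
    unfolding open_dist
  proof
    fix l assume l: "l \<in> - P"
    have "m \<in> - P" if m: "dist m l < c l / 2" for m
    proof
      assume mP: "m \<in> P"
      have "c l / 2 * norm x \<le> norm (D m x)" if "x \<in> W" for x
      proof -
        have "D l x = D m x - (l - m) *\<^sub>C x" using shift[of m "l - m" x] by simp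
        then have "norm (D l x) \<le> norm (D m x) + cmod (l - m) * norm x"
          by (metis norm_scaleC norm_triangle_ineq4)
        moreover have "cmod (l - m) * norm x \<le> c l / 2 * norm x"
          using m by (intro mult_right_mono) (auto simp: dist_norm norm_minus_commute)
        ultimately show ?thesis using c(2)[OF that, of l] by simp
      qed
      from ball_P[OF mP _ _ this] m c(1)[of l] have "l \<in> P" by (simp add: dist_commute)
      then show False using l by blast
    qed
    then show "\<exists>e>0. \<forall>m. dist m l < e \<longrightarrow> m \<in> - P" using c(1)[of l] half_gt_zero by blast
  qed
  moreover have "of_real (K + 1) \<in> P"
    unfolding P_def D_def using onto_of_large[OF T W TW K, of "of_real (K + 1)"] K(1) by simp
  ultimately have P: "P = UNIV" using connectedD[OF connected_UNIV, of P "- P"] by auto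
  define R where "R l w = (SOME x. x \<in> W \<and> D l x = w)" for l w
  have R: "R l w \<in> W" "D l (R l w) = w" if "w \<in> W" for l w
  proof -
    have "l \<in> P" using P by simp
    then have "\<exists>x. x \<in> W \<and> D l x = w" using that by (auto simp: P_def)
    from someI_ex[OF this] show "R l w \<in> W" "D l (R l w) = w" unfolding R_def by auto
  qed
  have Rn: "c l * norm (R l w) \<le> norm w" if "w \<in> W" for l w using c(2)[OF R(1)[OF that], of l l] R(2)[OF that] by simp
  have inj: "x = y" if "x \<in> W" "y \<in> W" "D l x = D l y" for x y l
  proof -
    have "c l * norm (x - y) \<le> 0" using c(2)[of "x - y" l] that by (simp add: clin_simps[OF D] closed_csubspaceD[OF W])
    then show ?thesis using c(1)[of l] by (simp add: mult_le_0_iff)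
  qed
  have res: "R m w - R l w = (m - l) *\<^sub>C R m (R l w)" if "w \<in> W" for m l w
  proof (rule inj[of _ _ m])
    have "D m (R l w) = w - (m - l) *\<^sub>C R l w" using shift[of l "m - l" "R l w"] R(2)[OF that] by simp
    then show "D m (R m w - R l w) = D m ((m - l) *\<^sub>C R m (R l w))"
      using R that by (simp add: clin_simps[OF D])
  qed (use R that in \<open>auto intro!: closed_csubspaceD[OF W]\<close>)
  have Rcont: "((\<lambda>m. R m w) \<longlongrightarrow> R l w) (at l)" if w: "w \<in> W" for l w
  proof -
    have "((\<lambda>m. R m w - R l w) \<longlongrightarrow> 0) (at l)"
    proof (rule Lim_null_comparison)
      show "((\<lambda>m. cmod (m - l) * (2 / c l * norm (R l w))) \<longlongrightarrow> 0) (at l)"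
        by (intro tendsto_mult_left_zero tendsto_norm_zero LIM_zero tendsto_ident_at)
      show "\<forall>\<^sub>F m in at l. norm (R m w - R l w) \<le> cmod (m - l) * (2 / c l * norm (R l w))"
        unfolding eventually_at
      proof (intro exI[of _ "c l / 2"] conjI ballI impI)
        fix m assume m: "m \<noteq> l \<and> dist m l < c l / 2"
        let ?y = "R l w" let ?x = "R m ?y"
        have yW: "?y \<in> W" "?x \<in> W" using R w by auto
        have "D l ?x = D m ?x - (l - m) *\<^sub>C ?x" using shift[of m "l - m" ?x] by simp
        then have "norm (D l ?x) \<le> norm (D m ?x) + cmod (l - m) * norm ?x"
          by (metis norm_scaleC norm_triangle_ineq4)
        moreover have "cmod (l - m) * norm ?x \<le> c l / 2 * norm ?x"
          using m by (intro mult_right_mono) (auto simp: dist_norm norm_minus_commute)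
        ultimately have "c l / 2 * norm ?x \<le> norm ?y" using c(2)[OF yW(2), of l] R(2)[OF yW(1)] by simp
        then have "norm ?x \<le> 2 / c l * norm ?y" using c(1)[of l] by (simp add: field_simps)
        then show "norm (R m w - R l w) \<le> cmod (m - l) * (2 / c l * norm (R l w))"
          unfolding res[OF w] norm_scaleC by (rule mult_left_mono) simp
      qed (use c(1)[of l] in auto)
    qed
    then show ?thesis by (simp add: LIM_zero_iff)
  qed
  have "x = 0" if x: "x \<in> W" for x
  proof -
    \<comment> \<open>Pairing with \<open>R 0 x\<close> makes the value at 0 the squared norm of
      \<open>R 0 x\<close>, so that the vanishing of \<open>\<phi>\<close> at one point already
      gives \<open>x = 0\<close>.\<close>
    define \<phi> where "\<phi> l = cinner (R l x) (R 0 x)" for l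
    have "(\<phi> has_field_derivative cinner (R l (R l x)) (R 0 x)) (at l)" for l
      unfolding has_field_derivative_iff
    proof (rule Lim_transform_eventually)
      show "((\<lambda>m. cinner (R m (R l x)) (R 0 x)) \<longlongrightarrow> cinner (R l (R l x)) (R 0 x)) (at l)"
        by (intro tendsto_intros Rcont R x)
      show "\<forall>\<^sub>F m in at l. cinner (R m (R l x)) (R 0 x) = (\<phi> m - \<phi> l) / (m - l)"
        unfolding eventually_at \<phi>_def
        by (intro exI[of _ 1]) (auto simp: cinner_diff_left[symmetric] res[OF x] cinner_scaleC_left)
    qed
    then have "\<phi> holomorphic_on UNIV"
      by (auto simp: holomorphic_on_def field_differentiable_def intro: has_field_derivative_at_within)
    moreover have "(\<phi> \<longlongrightarrow> 0) at_infinity"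
    proof (rule Lim_null_comparison)
      show "\<forall>\<^sub>F l in at_infinity. norm (\<phi> l) \<le> norm x * norm (R 0 x) * inverse (cmod l - K)"
        unfolding eventually_at_infinity
      proof (intro exI[of _ "K + 1"] allI impI)
        fix l assume l: "K + 1 \<le> cmod l"
        have "(cmod l - K) * norm (R l x) \<le> norm x"
          using bounded_below_of_large[OF K(2), of l "R l x"] R(2)[OF x, of l] by (simp add: D_def)
        then have "norm (R l x) \<le> norm x * inverse (cmod l - K)" using l by (simp add: field_simps)
        then have "norm (R l x) * norm (R 0 x) \<le> norm x * inverse (cmod l - K) * norm (R 0 x)"
          by (rule mult_right_mono) simp
        then show "norm (\<phi> l) \<le> norm x * norm (R 0 x) * inverse (cmod l - K)"
          unfolding \<phi>_def using Cauchy_Schwarz[of "R l x" "R 0 x"] by (simp add: mult_ac)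
      qed
      have "filterlim (\<lambda>l::complex. - K + cmod l) at_top at_infinity"
        by (rule filterlim_tendsto_add_at_top[OF tendsto_const filterlim_norm_at_top])
      then have "((\<lambda>l. inverse (cmod l - K)) \<longlongrightarrow> 0) at_infinity"
        by (intro tendsto_inverse_0_at_top) simp
      then show "((\<lambda>l. norm x * norm (R 0 x) * inverse (cmod l - K)) \<longlongrightarrow> 0) at_infinity"
        by (rule tendsto_mult_right_zero)
    qed
    ultimately have "\<phi> 0 = 0" by (rule Liouville_weak_0)
    then have "R 0 x = 0" by (simp add: \<phi>_def)
    then show "x = 0" using R(2)[OF x, of 0] bounded_clinear_zero_right[OF D] by metis
  qed
  then show ?thesis using closed_csubspaceD(3)[OF W] by blast
qed

lemma riesz_point_perturb:
  assumes A: "bounded_clinear A" and "riesz_point A"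
  shows "\<exists>c>0. \<forall>\<nu>. cmod \<nu> < c \<longrightarrow> riesz_point (\<lambda>x. A x - \<nu> *\<^sub>C x)"
proof -
  obtain F c where F: "finite F" "\<And>x. x \<in> perp F \<Longrightarrow> A x \<in> perp F" and c: "c > 0"
    "\<And>x. x \<in> perp F \<Longrightarrow> c * norm x \<le> norm (A x)" and onto: "perp F \<subseteq> A ` perp F"
    using assms(2) unfolding riesz_point_def by blast
  note W = closed_csubspace_perp[of F]
  have "riesz_point (\<lambda>x. A x - \<nu> *\<^sub>C x)" if "cmod \<nu> < c" for \<nu>
    unfolding riesz_point_def
    using perturb_bounded_below_onto[OF A W F(2) c onto that] that F
    by (intro exI[of _ F] conjI) (auto intro!: closed_csubspaceD[OF W] exI[of _ "c - cmod \<nu>"])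
  then show ?thesis using c(1) by blast
qed

text \<open>If all points were Riesz points, finitely many of the finite codimensional subspaces
  would serve a whole disc by compactness. On their intersection \<open>perp G\<close>,
  \<open>T - m\<close> is bounded below for every \<open>m\<close>, outside the disc because
  \<open>m\<close> is large. Then \<open>perp G\<close> is zero by
  \<open>spectrum_nonempty_on\<close>, which is impossible in infinite dimension.\<close>

lemma exists_non_riesz:
  assumes T: "bounded_clinear T" and inf: "infinite_cdim (UNIV :: 'a::complex_hilbert_space set)"
  shows "\<exists>l. \<not> riesz_point (\<lambda>x::'a. T x - l *\<^sub>C x)"
proof (rule ccontr)
  assume "\<nexists>l. \<not> riesz_point (\<lambda>x. T x - l *\<^sub>C x)"
  then have "\<forall>l. \<exists>F c. finite F \<and> (\<forall>x\<in>perp F. T x - l *\<^sub>C x \<in> perp F) \<and> c > 0 \<and>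
     (\<forall>x\<in>perp F. c * norm x \<le> norm (T x - l *\<^sub>C x))"
    unfolding riesz_point_def by meson
  then obtain F c where Fc: "\<And>l. finite (F l)" "\<And>l x. x \<in> perp (F l) \<Longrightarrow> T x - l *\<^sub>C x \<in> perp (F l)"
    "\<And>l. c l > 0" "\<And>l x. x \<in> perp (F l) \<Longrightarrow> c l * norm x \<le> norm (T x - l *\<^sub>C x)"
    by metis
  obtain K where K: "K \<ge> 0" "\<And>x. norm (T x) \<le> norm x * K" using bounded_clinear_bound[OF T] by blast
  have TF: "T x \<in> perp (F l)" if "x \<in> perp (F l)" for x l
    using closed_csubspaceD(4)[OF closed_csubspace_perp Fc(2)[OF that]
        closed_csubspaceD(6)[OF closed_csubspace_perp that, of l]] by simp
  have "compact (cball (0::complex) (K + 1))" by simp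
  then obtain L where L: "finite L" "cball 0 (K + 1) \<subseteq> (\<Union>l\<in>L. ball l (c l))"
  proof (rule compactE_image[of _ UNIV "\<lambda>l. ball l (c l)"])
    show "cball 0 (K + 1) \<subseteq> (\<Union>l\<in>UNIV. ball l (c l))" using Fc(3) centre_in_ball by blast
  qed auto
  define G where "G = (\<Union>l\<in>L. F l)"
  have GF: "perp G \<subseteq> perp (F l)" if "l \<in> L" for l using that by (auto simp: perp_def G_def)
  have "perp G = {0}"
  proof (rule spectrum_nonempty_on[OF T closed_csubspace_perp])
    show "T x \<in> perp G" if "x \<in> perp G" for x
    proof (rule perp_memI)
      fix f assume "f \<in> G"
      then obtain l where "l \<in> L" "f \<in> F l" by (auto simp: G_def)
      then show "cinner (T x) f = 0" using TF GF that perpD(1) by blast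
    qed
    show "\<exists>d>0. \<forall>x\<in>perp G. d * norm x \<le> norm (T x - m *\<^sub>C x)" for m
    proof (cases "cmod m \<le> K + 1")
      case True
      then have "m \<in> cball 0 (K + 1)" by simp
      then obtain l where l: "l \<in> L" "m \<in> ball l (c l)" using L(2) by blast
      have "(c l - cmod (m - l)) * norm x \<le> norm (T x - m *\<^sub>C x)" if "x \<in> perp G" for x
      proof -
        have "T x - l *\<^sub>C x = (T x - m *\<^sub>C x) + (m - l) *\<^sub>C x"
          by (simp add: complex_vector.scale_left_diff_distrib)
        then have "norm (T x - l *\<^sub>C x) \<le> norm (T x - m *\<^sub>C x) + cmod (m - l) * norm x"
          by (metis norm_scaleC norm_triangle_ineq)
        moreover have "c l * norm x \<le> norm (T x - l *\<^sub>C x)" using Fc(4) GF l(1) that by blast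
        ultimately show ?thesis by (simp add: algebra_simps)
      qed
      moreover have "c l - cmod (m - l) > 0" using l(2) by (simp add: dist_norm norm_minus_commute)
      ultimately show ?thesis by blast
    next
      case False
      then show ?thesis using bounded_below_of_large[OF K(2), of m] by (intro exI[of _ "cmod m - K"]) auto
    qed
  qed
  moreover have "finite G" using L(1) Fc(1) by (simp add: G_def)
  then obtain z where "z \<in> UNIV \<inter> perp G" "norm z = 1"
    using infinite_cdim_perp[OF _ inf] complex_vector.subspace_UNIV by blast
  ultimately show False by auto
qed

text \<open>The points that are not Riesz points form a nonempty compact set. Just beyond one of
  maximal modulus all points are Riesz points, and those are limits of regular points.\<close>

lemma exists_essential_boundary_point:
  assumes T: "bounded_clinear T" and inf: "infinite_cdim (UNIV :: 'a::complex_hilbert_space set)"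
  shows "\<exists>\<beta>. near_regular (\<lambda>x::'a. T x - \<beta> *\<^sub>C x) \<and> \<not> riesz_point (\<lambda>x. T x - \<beta> *\<^sub>C x)"
proof -
  define D where "D l x = T x - l *\<^sub>C x" for l x
  have D: "bounded_clinear (D l)" for l unfolding D_def by (intro bounded_clinear_intros T)
  have shift: "D l x - m *\<^sub>C x = D (l + m) x" for l m x by (simp add: D_def scaleC_add_left)
  define S where "S = {l. \<not> riesz_point (D l)}"
  have "S \<noteq> {}" using exists_non_riesz[OF T inf] by (auto simp: S_def D_def[abs_def])
  obtain K where K: "K \<ge> 0" "\<And>x. norm (T x) \<le> norm x * K" using bounded_clinear_bound[OF T] by blast
  have "open (- S)"
    unfolding open_dist
  proof
    fix l assume "l \<in> - S"
    then obtain c where c: "c > 0" "\<And>\<nu>. cmod \<nu> < c \<Longrightarrow> riesz_point (D (l + \<nu>))"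
      using riesz_point_perturb[OF D, of l] by (auto simp: S_def shift)
    have "m \<in> - S" if "dist m l < c" for m using c(2)[of "m - l"] that by (simp add: S_def dist_norm)
    then show "\<exists>e>0. \<forall>m. dist m l < e \<longrightarrow> m \<in> - S" using c(1) by blast
  qed
  moreover have "cmod l \<le> K" if "l \<in> S" for l
  proof (rule ccontr)
    assume l: "\<not> cmod l \<le> K"
    have "riesz_point (D l)"
      unfolding riesz_point_def D_def
      using onto_of_large[OF T closed_csubspace_UNIV _ K, of l] bounded_below_of_large[OF K(2), of l] l
      by (intro exI[of _ "{}"] conjI exI[of _ "cmod l - K"]) (auto simp: perp_def)
    then show False using that by (simp add: S_def)
  qed
  then have "bounded S" by (auto simp: bounded_iff)
  ultimately have "compact S" by (simp add: compact_eq_bounded_closed closed_def)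
  then obtain \<beta> where b: "\<beta> \<in> S" "\<And>l. l \<in> S \<Longrightarrow> cmod l \<le> cmod \<beta>"
    using continuous_attains_sup[OF _ \<open>S \<noteq> {}\<close>, of cmod] continuous_on_norm_id by blast
  have "near_regular (D \<beta>)"
    unfolding near_regular_def
  proof (intro allI impI)
    fix \<epsilon> :: real assume e: "\<epsilon> > 0"
    \<comment> \<open>\<open>d\<close> points radially outwards from \<open>\<beta>\<close>, in an
      arbitrary direction if \<open>\<beta>\<close> is 0. Half of \<open>\<epsilon>\<close> is spent
      here, the other half on the regular point near \<open>\<beta> + d\<close>.\<close>
    define d where "d = complex_of_real (\<epsilon> / 2) * (if \<beta> = 0 then 1 else sgn \<beta>)"
    have "\<beta> + d = (if \<beta> = 0 then complex_of_real (\<epsilon> / 2) else of_real (cmod \<beta> + \<epsilon> / 2) * sgn \<beta>)"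
      by (simp add: d_def sgn_eq field_simps)
    moreover have "cmod (of_real (cmod \<beta> + \<epsilon> / 2)) = cmod \<beta> + \<epsilon> / 2"
      using e by (simp only: norm_of_real) simp
    ultimately have "cmod (\<beta> + d) = cmod \<beta> + \<epsilon> / 2"
      by (cases "\<beta> = 0") (simp_all only: norm_mult norm_sgn if_True if_False norm_zero refl mult_1_right add_0)
    then have "\<beta> + d \<notin> S" using b(2) e by fastforce
    then have "near_regular (D (\<beta> + d))" using riesz_near_regular[OF D] by (simp add: S_def)
    then obtain \<nu> where nu: "cmod \<nu> < \<epsilon> / 2" "regular (D (\<beta> + d)) \<nu>"
      using e unfolding near_regular_def by (metis half_gt_zero)
    have "cmod d = \<epsilon> / 2" using e by (simp add: d_def norm_mult norm_sgn)
    then have "cmod (d + \<nu>) < \<epsilon>" using nu(1) norm_triangle_ineq[of d \<nu>] by simp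
    moreover have "regular (D \<beta>) (d + \<nu>)" using nu(2) by (simp add: regular_def shift add.assoc)
    ultimately show "\<exists>\<nu>. cmod \<nu> < \<epsilon> \<and> regular (D \<beta>) \<nu>" by blast
  qed
  then show ?thesis using b(1) by (auto simp: S_def D_def[abs_def])
qed

section \<open>Invariant subspaces with dense range\<close>

lemma bounded_clinear_funpow:
  fixes A :: "'a::complex_hilbert_space \<Rightarrow> 'a"
  shows "bounded_clinear A \<Longrightarrow> bounded_clinear (A ^^ k)"
  by (induction k) (simp_all add: bounded_clinear_id bounded_clinear_comp)

lemma cls_closed_csubspace: "closed_csubspace M \<Longrightarrow> cls M = M"
  using cls_minimal[of M M] cls_superset by blast

text \<open>Let \<open>V\<close> be the stable kernel; then \<open>A y \<in> V\<close> forces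
  \<open>y \<in> V\<close>. A vector \<open>y\<close> of \<open>perp V\<close> that is orthogonal to
  the image of \<open>perp V\<close> under the adjoint has \<open>A y\<close> in
  \<open>perp (perp V)\<close>, which is \<open>V\<close>, so \<open>y\<close> lies in
  \<open>V\<close> as well and vanishes.\<close>

lemma
  fixes A :: "'a::complex_hilbert_space \<Rightarrow> 'a"
  assumes A: "bounded_clinear A" and stab: "{x. (A ^^ Suc k) x = 0} = {x. (A ^^ k) x = 0}"
  shows adj_perp_kernel_invariant:
      "x \<in> perp {x. (A ^^ k) x = 0} \<Longrightarrow> adj A x \<in> perp {x. (A ^^ k) x = 0}"
    and adj_perp_kernel_dense:
      "perp {x. (A ^^ k) x = 0} \<subseteq> closure (adj A ` perp {x. (A ^^ k) x = 0})"
proof -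
  define V where "V = {x. (A ^^ k) x = 0}"
  have V: "closed_csubspace V"
    unfolding V_def by (rule closed_csubspace_kernel[OF bounded_clinear_funpow[OF A]])
  have AV: "A v \<in> V" if "v \<in> V" for v
  proof -
    have "(A ^^ Suc k) v = A 0" using that by (simp add: V_def)
    then have "(A ^^ Suc k) v = 0" using bounded_clinear_zero_right[OF A] by simp
    then show ?thesis unfolding funpow_Suc_right by (simp add: V_def)
  qed
  have VA: "v \<in> V" if "A v \<in> V" for v
  proof -
    have "(A ^^ Suc k) v = 0" using that unfolding funpow_Suc_right by (simp add: V_def)
    then show ?thesis using stab by (auto simp: V_def)
  qed
  have inv: "adj A x \<in> perp V" if "x \<in> perp V" for x
  proof (rule perp_memI)
    fix v assume "v \<in> V"
    then have "cinner x (A v) = 0" using AV that perpD(1) by blast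
    then show "cinner (adj A x) v = 0" by (simp add: cinner_adj'[OF A])
  qed
  note W = closed_csubspace_perp[of V]
  have "closure (adj A ` perp V) = perp V"
  proof (rule dense_in_closed_subspaceI[OF W])
    show "csubspace (adj A ` perp V)"
      by (rule csubspace_image[OF bounded_clinear_adj[OF A] closed_csubspaceD(1)[OF W]])
    show "adj A ` perp V \<subseteq> perp V" using inv by blast
    fix y assume y: "y \<in> perp V" "\<And>x. x \<in> adj A ` perp V \<Longrightarrow> cinner x y = 0"
    have "A y \<in> perp (perp V)"
    proof (rule perp_memI)
      fix x assume "x \<in> perp V"
      then have "cinner (adj A x) y = 0" using y(2) by blast
      then have "cinner x (A y) = 0" by (simp add: cinner_adj'[OF A])
      then show "cinner (A y) x = 0" using cinner_eq_0_commute by blast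
    qed
    then have "A y \<in> V" using perp_perp_cls cls_closed_csubspace[OF V] by metis
    then have "y \<in> V" by (rule VA)
    then have "cinner y y = 0" using perpD(1)[OF y(1)] by blast
    then show "y = 0" by simp
  qed
  then show "x \<in> perp {x. (A ^^ k) x = 0} \<Longrightarrow> adj A x \<in> perp {x. (A ^^ k) x = 0}"
    and "perp {x. (A ^^ k) x = 0} \<subseteq> closure (adj A ` perp {x. (A ^^ k) x = 0})"
    using inv unfolding V_def by auto
qed

lemma perp_finite_dim_subspace:
  assumes "B \<subseteq> V" "V \<subseteq> cspan B" shows "perp V = perp B"
proof
  show "perp V \<subseteq> perp B" using assms(1) by (auto simp: perp_def)
  have "V \<subseteq> cls B" using assms(2) closure_subset by (auto simp: cls_def)
  then have "perp (cls B) \<subseteq> perp V" by (auto simp: perp_def)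
  then show "perp B \<subseteq> perp V" by (simp add: perp_cls)
qed

lemma finite_dim_subset_basis:
  assumes "V \<subseteq> cspan D" "finite D"
  shows "\<exists>B. finite B \<and> B \<subseteq> V \<and> V \<subseteq> cspan B"
proof -
  obtain B where B: "B \<subseteq> V" "complex_vector.independent B" "V \<subseteq> cspan B"
    using complex_vector.basis_exists[of V] by metis
  then have "finite B" using complex_vector.independent_span_bound[OF assms(2) B(2)] assms(1) by blast
  then show ?thesis using B by blast
qed

lemma kernel_powers_subspace:
  fixes A :: "'a::complex_hilbert_space \<Rightarrow> 'a"
  shows "bounded_clinear A \<Longrightarrow> csubspace {x. (A ^^ k) x = 0}"
  by (rule closed_csubspaceD(1)[OF closed_csubspace_kernel[OF bounded_clinear_funpow]])

lemma kernel_powers_mono: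
  fixes A :: "'a::complex_hilbert_space \<Rightarrow> 'a"
  assumes "bounded_clinear A" shows "{x. (A ^^ k) x = 0} \<subseteq> {x. (A ^^ Suc k) x = 0}"
  using bounded_clinear_zero_right[OF assms] by auto

text \<open>The subspace \<open>perp F\<close> is invariant under the adjoint only. An invariant one
  for \<open>A\<close> is the complement of the stable kernel of the powers of the adjoint; on it
  \<open>A\<close> has dense range and is \<open>CP\<close>, and \<open>near_regular\<close>
  upgrades this to invertibility.\<close>

lemma riesz_point_of_adj:
  assumes A: "bounded_clinear A" and nr: "near_regular A" and "riesz_point (adj A)"
  shows "riesz_point A"
proof -
  note aA = bounded_clinear_adj[OF A]
  obtain F c where F: "finite F" "\<And>x. x \<in> perp F \<Longrightarrow> adj A x \<in> perp F" and c: "c > 0"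
    "\<And>x. x \<in> perp F \<Longrightarrow> c * norm x \<le> norm (adj A x)" and onto: "perp F \<subseteq> adj A ` perp F"
    using assms(3) unfolding riesz_point_def by blast
  \<comment> \<open>The adjoint maps \<open>perp F\<close> onto itself with inverse bounded by
    \<open>1 / c\<close>; solving \<open>adj A y = x\<close> and pairing with \<open>x\<close> moves
    this bound to \<open>A\<close>.\<close>
  have low: "c * norm x \<le> norm (A x)" if x: "x \<in> perp F" for x
  proof (cases "x = 0")
    case False
    obtain y where y: "y \<in> perp F" "adj A y = x" using onto x by blast
    have "(norm x)\<^sup>2 = cmod (cinner x (adj A y))" by (simp add: y cinner_self norm_power)
    also have "\<dots> = cmod (cinner (A x) y)" by (simp add: cinner_adj[OF A])
    also have "\<dots> \<le> norm (A x) * norm y" by (rule Cauchy_Schwarz)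
    also have "\<dots> \<le> norm (A x) * (norm x / c)"
      using c(2)[OF y(1)] c(1) y(2) by (intro mult_left_mono) (auto simp: field_simps)
    finally show ?thesis using False c(1) by (simp add: power2_eq_square field_simps)
  qed (simp add: clin_simps[OF A])
  have "CP A (UNIV \<inter> perp F)"
    using CP_bounded_below[OF A closed_csubspace_perp c(1) low] by simp
  then have cp: "CP A UNIV" by (rule CP_perp[OF A F(1) closed_csubspace_UNIV])
  let ?V = "\<lambda>k. {x. (adj A ^^ k) x = 0}"
  have V0: "?V k \<inter> perp F \<subseteq> {0}" for k
  proof (induction k)
    case (Suc k)
    show ?case
    proof
      fix x assume x: "x \<in> ?V (Suc k) \<inter> perp F"
      then have "adj A x \<in> ?V k \<inter> perp F" using F(2) by (simp add: funpow_Suc_right del: funpow.simps)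
      then have "adj A x = 0" using Suc by blast
      then have "c * norm x \<le> 0" using c(2)[of x] x by simp
      then show "x \<in> {0}" using c(1) by (simp add: mult_le_0_iff)
    qed
  qed simp
  have mono: "?V k \<subseteq> ?V (Suc k)" for k by (rule kernel_powers_mono[OF aA])
  have sub: "csubspace (?V k)" for k by (rule kernel_powers_subspace[OF aA])
  have fd: "\<exists>B. finite B \<and> B \<subseteq> ?V k \<and> ?V k \<subseteq> cspan B" for k
    by (rule finite_dim_of_perp[OF F(1) sub V0])
  \<comment> \<open>Finite dimension of each kernel does not stop the chain; the union also meets
    \<open>perp F\<close> only in 0 and gives one finite spanning set for all of them.\<close>
  let ?Z = "\<Union>k. ?V k"
  have mono': "?V j \<subseteq> ?V k" if "j \<le> k" for j k using lift_Suc_mono_le[of ?V, OF mono that] .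
  have "csubspace ?Z"
    unfolding csubspace_iff
  proof (intro conjI ballI allI)
    show "0 \<in> ?Z" using complex_vector.subspace_0[OF sub] by blast
    show "x + y \<in> ?Z" if "x \<in> ?Z" "y \<in> ?Z" for x y
    proof -
      obtain i j where "x \<in> ?V i" "y \<in> ?V j" using \<open>x \<in> ?Z\<close> \<open>y \<in> ?Z\<close> by blast
      then have "x \<in> ?V (max i j)" "y \<in> ?V (max i j)"
        using mono'[of i "max i j"] mono'[of j "max i j"] by auto
      then have "x + y \<in> ?V (max i j)" by (rule complex_vector.subspace_add[OF sub])
      then show ?thesis by blast
    qed
    show "a *\<^sub>C x \<in> ?Z" if "x \<in> ?Z" for x a
      using that complex_vector.subspace_scale[OF sub] by blast
  qed
  moreover have "?Z \<inter> perp F \<subseteq> {0}" using V0 by blast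
  ultimately obtain B where "finite B" "?Z \<subseteq> cspan B"
    using finite_dim_of_perp[OF F(1)] by blast
  then obtain k where k: "?V (Suc k) = ?V k"
    using finite_dim_chain(1)[of B ?V] sub mono by blast
  note inv = adj_perp_kernel_invariant[OF aA k, unfolded adj_adj[OF A]]
    and dense = adj_perp_kernel_dense[OF aA k, unfolded adj_adj[OF A]]
  obtain c' where c': "c' > 0" "\<forall>x\<in>perp (?V k). c' * norm x \<le> norm (A x)" "A ` perp (?V k) = perp (?V k)"
    using bounded_below_and_onto[OF A closed_csubspace_perp inv dense CP_subset[OF cp]]
      near_regular_inj[OF nr A] by blast
  obtain B' where B': "finite B'" "B' \<subseteq> ?V k" "?V k \<subseteq> cspan B'" using fd by blast
  have "perp (?V k) = perp B'" by (rule perp_finite_dim_subspace[OF B'(2,3)])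
  then show ?thesis unfolding riesz_point_def using B'(1) inv c' by (intro exI[of _ B']) auto
qed

text \<open>The failure of \<open>CP\<close> is the form in which non-invertibility is used: it
  provides approximate kernel vectors in \<open>W\<close> orthogonal to any finite set.\<close>

definition dense_range_subspace :: "('a::complex_hilbert_space \<Rightarrow> 'a) \<Rightarrow> 'a set \<Rightarrow> bool"
  where "dense_range_subspace C W \<longleftrightarrow> closed_csubspace W \<and> (\<forall>x\<in>W. C x \<in> W) \<and>
    W \<subseteq> closure (C ` W) \<and> \<not> CP C W"

text \<open>If the kernels of the powers become stable, the adjoint is taken on the complement of
  the stable kernel: \<open>CP\<close> there would make the adjoint, hence \<open>A\<close>, a Riesz
  point. If they grow forever, \<open>A\<close> is taken on the closure of the intersection of all
  ranges of its powers: \<open>CP\<close> there would make \<open>A\<close> injective on a space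
  that contains nonzero kernel vectors.\<close>

lemma dense_range_subspace_cases:
  assumes A: "bounded_clinear A" and nr: "near_regular A" and nrz: "\<not> riesz_point A"
    and fin: "\<not> infinite_cdim {x. A x = 0}"
  shows "(\<exists>W. dense_range_subspace A W) \<or> (\<exists>W. dense_range_subspace (adj A) W)"
proof -
  note aA = bounded_clinear_adj[OF A]
  obtain B where B: "finite B" "{x. A x = 0} \<subseteq> cspan B" using fin unfolding infinite_cdim_def by blast
  let ?V = "\<lambda>k. {x. (A ^^ k) x = 0}"
  show ?thesis
  proof (cases "\<exists>k. ?V (Suc k) = ?V k")
    case True
    then obtain k where k: "?V (Suc k) = ?V k" by blast
    have "\<exists>D. finite D \<and> ?V j \<subseteq> cspan D" for j
    proof (induction j)
      case (Suc j)
      then obtain D where D: "finite D" "?V j \<subseteq> cspan D" by blast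
      show ?case
      proof (rule finite_dim_preimage[OF A kernel_powers_subspace[OF A] B(1) _ D(1)])
        show "{x \<in> ?V (Suc j). A x = 0} \<subseteq> cspan B" using B(2) by blast
        show "A ` ?V (Suc j) \<subseteq> cspan D"
          using D(2) by (auto simp: funpow_Suc_right simp del: funpow.simps)
      qed
    qed auto
    then obtain D where "finite D" "?V k \<subseteq> cspan D" by blast
    then obtain B' where B': "finite B'" "B' \<subseteq> ?V k" "?V k \<subseteq> cspan B'"
      using finite_dim_subset_basis by metis
    note inv = adj_perp_kernel_invariant[OF A k] and dense = adj_perp_kernel_dense[OF A k]
    have "\<not> CP (adj A) (perp (?V k))"
    proof
      assume "CP (adj A) (perp (?V k))"
      then obtain c where c: "c > 0" "\<forall>x\<in>perp (?V k). c * norm x \<le> norm (adj A x)"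
          "adj A ` perp (?V k) = perp (?V k)"
        using bounded_below_and_onto[OF aA closed_csubspace_perp inv dense]
          near_regular_inj[OF near_regular_adj[OF A nr] aA] by blast
      have "perp (?V k) = perp B'" by (rule perp_finite_dim_subspace[OF B'(2,3)])
      then have "riesz_point (adj A)"
        unfolding riesz_point_def using B'(1) inv c by (intro exI[of _ B']) auto
      then show False using riesz_point_of_adj[OF A nr] nrz by blast
    qed
    then have "dense_range_subspace (adj A) (perp (?V k))"
      unfolding dense_range_subspace_def using inv dense closed_csubspace_perp by blast
    then show ?thesis by blast
  next
    case False
    define N where "N = {x. A x = 0}"
    define Rg where "Rg k = range (A ^^ k)" for k
    have N: "csubspace N" unfolding N_def using closed_csubspaceD(1)[OF closed_csubspace_kernel[OF A]] .
    have Rg: "csubspace (Rg k)" for k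
      unfolding Rg_def by (rule csubspace_image[OF bounded_clinear_funpow[OF A] complex_vector.subspace_UNIV])
    have Rg_Suc: "Rg (Suc k) \<subseteq> Rg k" for k
      unfolding Rg_def funpow_Suc_right by auto
    have A_Rg: "A x \<in> Rg (Suc k)" if "x \<in> Rg k" for x k using that by (auto simp: Rg_def)
    have Rg_A: "\<exists>x. x \<in> Rg k \<and> A x = y" if "y \<in> Rg (Suc k)" for y k
      using that by (auto simp: Rg_def)
    have Rg_mono: "Rg k \<subseteq> Rg j" if "j \<le> k" for j k using lift_Suc_antimono_le[of Rg, OF Rg_Suc that] .
    \<comment> \<open>Here the finite dimension of the kernel enters; in general \<open>A\<close>
      need not map the intersection of its iterated ranges onto itself.\<close>
    have "\<exists>k. \<forall>n\<ge>k. N \<inter> Rg n = N \<inter> Rg k"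
    proof (rule finite_dim_chain(2)[OF B(1), of "\<lambda>n. N \<inter> Rg n"])
      show "N \<inter> Rg n \<subseteq> cspan B" for n using B(2) by (auto simp: N_def)
      show "csubspace (N \<inter> Rg n)" for n by (rule complex_vector.subspace_inter[OF N Rg])
      show "N \<inter> Rg (Suc n) \<subseteq> N \<inter> Rg n" for n using Rg_Suc by blast
    qed
    then obtain k0 where k0: "\<And>n. n \<ge> k0 \<Longrightarrow> N \<inter> Rg n = N \<inter> Rg k0" by blast
    define D where "D = (\<Inter>k. Rg k)"
    have D: "csubspace D" unfolding D_def using Rg by (auto intro: complex_vector.subspace_Inter)
    have AD: "A x \<in> D" if "x \<in> D" for x
      using that A_Rg Rg_Suc unfolding D_def by blast
    have NR: "N \<inter> Rg k0 \<subseteq> D"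
    proof -
      have "N \<inter> Rg k0 \<subseteq> Rg n" for n
        using k0[of "max k0 n"] Rg_mono[of n "max k0 n"] by auto
      then show ?thesis by (auto simp: D_def)
    qed
    \<comment> \<open>One preimage serves all \<open>n\<close>: the preimage taken in
      \<open>Rg k0\<close> differs from the one in \<open>Rg n\<close> by a kernel vector of
      \<open>Rg k0\<close>, and such vectors lie in every range.\<close>
    have DA: "\<exists>x. x \<in> D \<and> A x = y" if y: "y \<in> D" for y
    proof -
      have "y \<in> Rg (Suc k)" for k using y unfolding D_def by blast
      then obtain x where x: "\<And>k. x k \<in> Rg k" "\<And>k. A (x k) = y" using Rg_A by metis
      have "x k0 \<in> Rg n" for n
      proof (cases "n \<le> k0")
        case True then show ?thesis using x(1) Rg_mono by blast
      next
        case False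
        then have "x n \<in> Rg k0" using x(1)[of n] Rg_mono[of k0 n] by auto
        then have "x n - x k0 \<in> N \<inter> Rg k0"
          using x complex_vector.subspace_diff[OF Rg] by (auto simp: N_def clin_simps[OF A])
        then have "x n - x k0 \<in> Rg n" using k0[of n] False by auto
        then have "x n - (x n - x k0) \<in> Rg n" using x(1) complex_vector.subspace_diff[OF Rg] by blast
        then show ?thesis by simp
      qed
      then show ?thesis using x(2) by (auto simp: D_def)
    qed
    note W = closed_csubspace_closure[OF D]
    have AW: "A x \<in> closure D" if "x \<in> closure D" for x
    proof -
      have "A ` closure D \<subseteq> closure (A ` D)"
        by (rule image_closure_subset[OF continuous_on_bounded_clinear[OF A]]) (auto simp: closure_subset)
      moreover have "closure (A ` D) \<subseteq> closure D" by (rule closure_mono) (use AD in blast)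
      ultimately show ?thesis using that by blast
    qed
    have dense: "closure D \<subseteq> closure (A ` closure D)"
    proof (rule closure_mono)
      show "D \<subseteq> A ` closure D" using DA closure_subset by blast
    qed
    have "\<not> CP A (closure D)"
    proof
      assume "CP A (closure D)"
      then obtain c where c: "c > 0" "\<forall>x\<in>closure D. c * norm x \<le> norm (A x)"
        using bounded_below_and_onto[OF A W AW dense] near_regular_inj[OF nr A] by blast
      \<comment> \<open>The strict growth of the kernels makes \<open>(A ^^ k0) x\<close> a nonzero
        kernel vector in \<open>Rg k0\<close>, hence in \<open>D\<close>.\<close>
      obtain x where x: "x \<in> ?V (Suc k0)" "x \<notin> ?V k0"
        using False kernel_powers_mono[OF A, of k0] by blast
      have "(A ^^ k0) x \<in> N \<inter> Rg k0" using x(1) by (auto simp: N_def Rg_def)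
      then have "(A ^^ k0) x \<in> closure D" "A ((A ^^ k0) x) = 0" using NR closure_subset by (auto simp: N_def)
      then have "c * norm ((A ^^ k0) x) \<le> 0" using c(2) by fastforce
      then show False using c(1) x(2) by (simp add: mult_le_0_iff)
    qed
    then have "dense_range_subspace A (closure D)"
      unfolding dense_range_subspace_def using AW dense W by blast
    then show ?thesis by blast
  qed
qed

section \<open>Weakly null resolvent orbits\<close>

lemma Baire_closed:
  fixes Q :: "nat \<Rightarrow> 'a::complete_space set"
  assumes E: "closed E" "E \<noteq> {}" and Q: "\<And>k. open (Q k)"
    and dense: "\<And>k e \<delta>. e \<in> E \<Longrightarrow> \<delta> > 0 \<Longrightarrow> \<exists>e'\<in>E \<inter> Q k. dist e' e < \<delta>"
  shows "\<exists>e\<in>E. \<forall>k. e \<in> Q k"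
proof -
  let ?X = "top_of_set E"
  have "completely_metrizable_space ?X"
    using completely_metrizable_space_closedin[OF completely_metrizable_space_euclidean] E(1) closed_closedin by blast
  moreover have "openin ?X T \<and> ?X closure_of T = topspace ?X" if T: "T \<in> range (\<lambda>k. E \<inter> Q k)" for T
  proof -
    obtain k where k: "T = E \<inter> Q k" using T by blast
    have "E \<subseteq> closure T"
      unfolding closure_approachable k using dense by (auto simp: closure_approachable)
    then have "?X closure_of T = E" by (auto simp: closure_of_subtopology k Int_absorb1)
    then show ?thesis using Q by (auto simp: k openin_open)
  qed
  ultimately have "?X closure_of (\<Inter>(range (\<lambda>k. E \<inter> Q k))) = topspace ?X"
    by (intro Baire_category) auto
  then have "(\<Inter>(range (\<lambda>k. E \<inter> Q k))) \<noteq> {}" using E(2) by auto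
  then show ?thesis by blast
qed

text \<open>Given \<open>e\<close>, solve \<open>C w \<approx> e\<close> and perturb \<open>e\<close> to \<open>(C - \<nu>) (w + t z)\<close>, where \<open>z\<close> is a unit
  vector almost in the kernel of \<open>C\<close>. Since \<open>w\<close> does not depend on \<open>\<nu>\<close>, the term \<open>t z\<close> dominates.\<close>

lemma generic_resolvent_orbit:
  fixes C :: "'a::complex_hilbert_space \<Rightarrow> 'a"
  assumes C: "bounded_clinear C" and W: "dense_range_subspace C W" and nr: "near_regular C"
    and u: "u = 0 \<or> (\<exists>x\<in>W. cinner (C x) u \<noteq> 0)"
  shows "\<exists>e\<in>W. cinner e u = 0 \<and> (\<forall>k::nat. \<exists>\<nu> x. cmod \<nu> < 1 / Suc k \<and> regular C \<nu> \<and>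
    C x - \<nu> *\<^sub>C x = e \<and> norm x > Suc k \<and> (\<forall>i\<le>k. Suc k * cmod (cinner x (f i)) < norm x))"
proof -
  have Wc: "closed_csubspace W" and CW: "\<And>x. x \<in> W \<Longrightarrow> C x \<in> W" and Wd: "W \<subseteq> closure (C ` W)"
    and ncp: "\<not> CP C W" using W unfolding dense_range_subspace_def by auto
  \<comment> \<open>The orthogonality to \<open>u\<close> is built into the complete space on which
    category is used, so that the generic vector inherits it.\<close>
  define E where "E = W \<inter> perp {u}"
  have E: "closed_csubspace E" unfolding E_def by (rule closed_csubspace_Int[OF Wc closed_csubspace_perp])
  define R where "R \<nu> = (SOME R. bounded_clinear R \<and> (\<forall>x. C (R x) - \<nu> *\<^sub>C R x = x) \<and>
    (\<forall>x. R (C x - \<nu> *\<^sub>C x) = x))" for \<nu>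
  have R: "bounded_clinear (R \<nu>)" "\<And>x. C (R \<nu> x) - \<nu> *\<^sub>C R \<nu> x = x" "\<And>x. R \<nu> (C x - \<nu> *\<^sub>C x) = x"
    if "regular C \<nu>" for \<nu>
    using that someI_ex[of "\<lambda>R. bounded_clinear R \<and> (\<forall>x. C (R x) - \<nu> *\<^sub>C R x = x) \<and>
      (\<forall>x. R (C x - \<nu> *\<^sub>C x) = x)"] unfolding regular_def R_def[symmetric] by auto
  \<comment> \<open>\<open>Q k\<close> collects the vectors that behave well at stage
    \<open>k\<close> for some admissible \<open>\<nu>\<close>. Only finitely many \<open>f i\<close>
    and strict inequalities occur, so it is open.\<close>
  define Q where "Q k = (\<Union>\<nu>\<in>{\<nu>. cmod \<nu> < 1 / Suc k \<and> regular C \<nu>}.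
    {e. Suc k < norm (R \<nu> e)} \<inter> (\<Inter>i\<in>{..k}. {e. Suc k * cmod (cinner (R \<nu> e) (f i)) < norm (R \<nu> e)}))" for k :: nat
  have "\<exists>e\<in>E. \<forall>k. e \<in> Q k"
  proof (rule Baire_closed)
    show "closed E" "E \<noteq> {}" using closed_csubspaceD(2,3)[OF E] by auto
    show "open (Q k)" for k
      unfolding Q_def
      by (intro open_UN ballI open_Int open_INT finite_atMost open_Collect_less continuous_intros
          continuous_on_bounded_clinear) (auto intro: R)
  next
    fix k :: nat and e0 and \<delta> :: real
    assume e0: "e0 \<in> E" and d: "\<delta> > 0"
    \<comment> \<open>\<open>M\<close> and \<open>\<eta>\<close> must be fixed before
      \<open>\<nu>\<close>: the size of \<open>z\<close> depends on \<open>M\<close>, and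
      \<open>near_regular\<close> only promises some \<open>\<nu>\<close> below a bound given in
      advance.\<close>
    have "\<exists>M\<ge>0. \<exists>\<eta>>0. \<forall>\<nu>. cmod \<nu> < \<eta> \<longrightarrow> (\<exists>w\<in>W. norm w \<le> M \<and>
        cinner (C w - \<nu> *\<^sub>C w) u = 0 \<and> norm (C w - \<nu> *\<^sub>C w - e0) < \<delta> / 2)"
    proof (cases "u = 0")
      case True
      obtain w where w: "w \<in> W" "norm (C w - e0) < \<delta> / 4"
      proof -
        have "e0 \<in> closure (C ` W)" using e0 Wd by (auto simp: E_def)
        then show thesis using that d unfolding closure_approachable dist_norm
          by (metis (no_types, lifting) imageE divide_pos_pos zero_less_numeral)
      qed
      have "\<exists>w'\<in>W. norm w' \<le> norm w \<and> cinner (C w' - \<nu> *\<^sub>C w') u = 0 \<and>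
            norm (C w' - \<nu> *\<^sub>C w' - e0) < \<delta> / 2"
        if nu: "cmod \<nu> < \<delta> / (4 * (norm w + 1))" for \<nu>
      proof -
        have "cmod \<nu> * norm w \<le> cmod \<nu> * (norm w + 1)" by (intro mult_left_mono) auto
        also have "\<dots> < \<delta> / 4" using nu by (simp add: field_simps add_pos_nonneg)
        finally have "norm (\<nu> *\<^sub>C w) < \<delta> / 4" by (simp add: norm_scaleC)
        moreover have "norm (C w - \<nu> *\<^sub>C w - e0) \<le> norm (C w - e0) + norm (\<nu> *\<^sub>C w)"
          using norm_triangle_ineq4[of "C w - e0" "\<nu> *\<^sub>C w"] by (simp add: algebra_simps)
        ultimately have "norm (C w - \<nu> *\<^sub>C w - e0) < \<delta> / 2" using w(2) by simp
        then show ?thesis using w(1) True by auto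
      qed
      moreover have "\<delta> / (4 * (norm w + 1)) > 0" using d by (auto intro!: divide_pos_pos add_nonneg_pos)
      ultimately show ?thesis using norm_ge_zero[of w] by blast
    next
      case False
      then obtain x1 where x1: "x1 \<in> W" "cinner (C x1) u \<noteq> 0" using u by blast
      define a where "a = cmod (cinner (C x1) u)"
      have a: "a > 0" using x1(2) by (simp add: a_def)
      \<comment> \<open>\<open>P\<close> is the cost factor of restoring orthogonality to
        \<open>u\<close> by adding a multiple of \<open>x1\<close>: an image error \<open>q\<close>
        is enlarged by at most \<open>q * P\<close>.\<close>
      define P where "P = 2 / a * norm u * (norm (C x1) + norm x1)"
      have P: "P \<ge> 0" using a by (simp add: P_def)
      obtain w0 where w0: "w0 \<in> W" "norm (C w0 - e0) < \<delta> / (8 * (1 + P))"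
      proof -
        have "e0 \<in> closure (C ` W)" using e0 Wd by (auto simp: E_def)
        moreover have "\<delta> / (8 * (1 + P)) > 0" using d P by simp
        ultimately show thesis using that unfolding closure_approachable dist_norm
          by (metis (no_types, lifting) imageE)
      qed
      \<comment> \<open>The three bounds keep \<open>M\<close> independent of \<open>\<nu>\<close>,
        keep the denominator \<open>?t\<close> at least \<open>a / 2\<close> in modulus, and make
        \<open>\<nu> *\<^sub>C w0\<close> negligible even after the correction.\<close>
      define \<eta> where "\<eta> = min 1 (min (a / (2 * (cmod (cinner x1 u) + 1))) (\<delta> / (8 * (1 + P) * (norm w0 + 1))))"
      define M where "M = norm w0 + 2 / a * (norm (C w0 - e0) * norm u + norm w0 * norm u) * norm x1"
      have "\<eta> > 0" using a d P by (auto simp: \<eta>_def add_nonneg_pos intro!: divide_pos_pos mult_pos_pos)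
      moreover have "M \<ge> 0" using a by (simp add: M_def)
      moreover have "\<exists>w\<in>W. norm w \<le> M \<and> cinner (C w - \<nu> *\<^sub>C w) u = 0 \<and> norm (C w - \<nu> *\<^sub>C w - e0) < \<delta> / 2"
        if nu: "cmod \<nu> < \<eta>" for \<nu>
      proof -
        let ?s = "cinner (C w0 - e0) u - \<nu> * cinner w0 u" and ?t = "cinner (C x1) u - \<nu> * cinner x1 u"
        have "cmod (\<nu> * cinner x1 u) \<le> cmod \<nu> * (cmod (cinner x1 u) + 1)"
          unfolding norm_mult by (intro mult_left_mono) auto
        also have "\<dots> \<le> a / (2 * (cmod (cinner x1 u) + 1)) * (cmod (cinner x1 u) + 1)"
          using nu by (intro mult_right_mono) (auto simp: \<eta>_def)
        also have "\<dots> = a / 2"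
        proof -
          have *: "a / (2 * y) * y = a / 2" if "y \<noteq> 0" for y using that by simp
          show ?thesis by (rule *) (use norm_ge_zero[of "cinner x1 u"] in linarith)
        qed
        finally have t: "cmod ?t \<ge> a / 2"
          using norm_triangle_ineq2[of "cinner (C x1) u" "\<nu> * cinner x1 u"] by (simp add: a_def)
        then have t0: "?t \<noteq> 0" using a by auto
        \<comment> \<open>The multiple of \<open>x1\<close> for which the image of
          \<open>w0 + \<gamma> *\<^sub>C x1\<close> under \<open>C - \<nu>\<close> is orthogonal to
          \<open>u\<close>; recall that \<open>e0\<close> is.\<close>
        define \<gamma> where "\<gamma> = - ?s / ?t"
        have s: "cmod ?s \<le> norm (C w0 - e0) * norm u + cmod \<nu> * (norm w0 * norm u)"
          by (intro order_trans[OF norm_triangle_ineq4] add_mono Cauchy_Schwarz)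
            (auto simp: norm_mult intro!: mult_left_mono Cauchy_Schwarz)
        have "cmod \<gamma> = cmod ?s / cmod ?t" by (simp add: \<gamma>_def norm_divide norm_minus_commute)
        also have "\<dots> \<le> cmod ?s / (a / 2)" using t a t0 by (intro divide_left_mono mult_pos_pos) auto
        also have "\<dots> = 2 / a * cmod ?s" by simp
        finally have g: "cmod \<gamma> \<le> 2 / a * cmod ?s" .
        define w where "w = w0 + \<gamma> *\<^sub>C x1"
        have "w \<in> W" using w0 x1 by (simp add: w_def closed_csubspaceD[OF Wc])
        moreover have "norm w \<le> M"
        proof -
          have "cmod \<nu> * (norm w0 * norm u) \<le> 1 * (norm w0 * norm u)"
            using nu by (intro mult_right_mono) (auto simp: \<eta>_def)
          then have "cmod \<gamma> \<le> 2 / a * (norm (C w0 - e0) * norm u + norm w0 * norm u)"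
            using s a by (intro order_trans[OF g] mult_left_mono) auto
          then have "norm (\<gamma> *\<^sub>C x1) \<le> 2 / a * (norm (C w0 - e0) * norm u + norm w0 * norm u) * norm x1"
            unfolding norm_scaleC by (rule mult_right_mono) simp
          then show ?thesis unfolding w_def M_def using norm_triangle_ineq[of w0 "\<gamma> *\<^sub>C x1"] by linarith
        qed
        moreover have "cinner (C w - \<nu> *\<^sub>C w) u = 0"
        proof -
          have "cinner e0 u = 0" using e0 by (auto simp: E_def perp_def)
          then have "cinner (C w - \<nu> *\<^sub>C w) u = ?s + \<gamma> * ?t"
            by (simp add: w_def clin_simps[OF C] cinner_simps algebra_simps)
          then show ?thesis using t0 by (simp add: \<gamma>_def)
        qed
        moreover have "norm (C w - \<nu> *\<^sub>C w - e0) < \<delta> / 2"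
        proof -
          let ?q = "norm (C w0 - e0) + cmod \<nu> * norm w0"
          have "norm (C x1 - \<nu> *\<^sub>C x1) \<le> norm (C x1) + 1 * norm x1"
            using nu by (intro order_trans[OF norm_triangle_ineq4] add_mono)
              (auto simp: norm_scaleC \<eta>_def intro!: mult_left_le_one_le)
          then have "cmod \<gamma> * norm (C x1 - \<nu> *\<^sub>C x1) \<le> (2 / a * (?q * norm u)) * (norm (C x1) + norm x1)"
            using s a by (intro mult_mono order_trans[OF g]) (auto simp: algebra_simps)
          also have "\<dots> = ?q * P" by (simp add: P_def)
          finally have 1: "norm (\<gamma> *\<^sub>C (C x1 - \<nu> *\<^sub>C x1)) \<le> ?q * P" by (simp add: norm_scaleC)
          have 2: "norm (C w0 - e0 - \<nu> *\<^sub>C w0) \<le> ?q"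
            using norm_triangle_ineq4[of "C w0 - e0" "\<nu> *\<^sub>C w0"] by (simp add: norm_scaleC)
          have eq: "C w - \<nu> *\<^sub>C w - e0 = (C w0 - e0 - \<nu> *\<^sub>C w0) + \<gamma> *\<^sub>C (C x1 - \<nu> *\<^sub>C x1)"
            by (simp add: w_def clin_simps[OF C] scaleC_add_right scaleC_scaleC
                complex_vector.scale_right_diff_distrib mult.commute)
          have "norm (C w - \<nu> *\<^sub>C w - e0) \<le> ?q + ?q * P"
            unfolding eq
            using norm_triangle_ineq[of "C w0 - e0 - \<nu> *\<^sub>C w0" "\<gamma> *\<^sub>C (C x1 - \<nu> *\<^sub>C x1)"] 1 2 by linarith
          also have "\<dots> = ?q * (1 + P)" by (simp add: algebra_simps)
          also have "?q * (1 + P) < (\<delta> / (4 * (1 + P))) * (1 + P)"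
          proof (rule mult_strict_right_mono)
            have "cmod \<nu> * norm w0 \<le> cmod \<nu> * (norm w0 + 1)" by (intro mult_left_mono) auto
            also have "\<dots> \<le> \<delta> / (8 * (1 + P) * (norm w0 + 1)) * (norm w0 + 1)"
              using nu by (intro mult_right_mono) (auto simp: \<eta>_def)
            also have "\<dots> = \<delta> / (8 * (1 + P))"
            proof -
              have *: "\<delta> / (8 * (1 + P) * y) * y = \<delta> / (8 * (1 + P))" if "y \<noteq> 0" for y
                using that by simp
              show ?thesis by (rule *) (use norm_ge_zero[of w0] in linarith)
            qed
            finally show "?q < \<delta> / (4 * (1 + P))" using w0(2) P by (simp add: field_simps)
          qed (use P in simp)
          also have "\<dots> = \<delta> / 4"
          proof -
            have *: "\<delta> / (4 * y) * y = \<delta> / 4" if "y \<noteq> 0" for y using that by simp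
            show ?thesis by (rule *) (use P in linarith)
          qed
          finally show ?thesis using d by simp
        qed
        ultimately show ?thesis by blast
      qed
      ultimately show ?thesis by blast
    qed
    then obtain M \<eta> where M: "M \<ge> 0" and eta: "\<eta> > 0" and
      w: "\<And>\<nu>. cmod \<nu> < \<eta> \<Longrightarrow> \<exists>w\<in>W. norm w \<le> M \<and>
        cinner (C w - \<nu> *\<^sub>C w) u = 0 \<and> norm (C w - \<nu> *\<^sub>C w - e0) < \<delta> / 2"
      by blast
    \<comment> \<open>Since \<open>z\<close> is a unit vector orthogonal to the \<open>f i\<close>,
      \<open>norm x\<close> is at least \<open>t - M\<close> while the pairings of \<open>x\<close>
      with \<open>f i\<close> are those of \<open>w\<close>. This \<open>t\<close> puts
      \<open>t - M\<close> above both thresholds.\<close>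
    define t where "t = M + Suc k + Suc k * M * (\<Sum>i\<le>k. norm (f i)) + 1"
    have S0: "0 \<le> Suc k * M * (\<Sum>i\<le>k. norm (f i))"
      using M by (intro mult_nonneg_nonneg sum_nonneg) auto
    have t: "t > 0" using M S0 unfolding t_def by linarith
    \<comment> \<open>Orthogonality of \<open>z\<close> to both \<open>u\<close> and
      \<open>adj C u\<close> makes \<open>C z - \<nu> *\<^sub>C z\<close> orthogonal to
      \<open>u\<close> for every \<open>\<nu>\<close>, so the large term does not spoil the
      constraint.\<close>
    have "finite (f ` {..k} \<union> {u, adj C u})" by simp
    moreover have "\<delta> / (8 * t) > 0" using d t by simp
    ultimately obtain z where z: "z \<in> W \<inter> perp (f ` {..k} \<union> {u, adj C u})" "norm z = 1"
      "norm (C z) < \<delta> / (8 * t)"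
      using not_CP_approx_kernel[OF C Wc ncp] by blast
    have "min \<eta> (min (1 / Suc k) (\<delta> / (8 * t))) > 0" using eta d t by simp
    then obtain \<nu> where nu: "cmod \<nu> < min \<eta> (min (1 / Suc k) (\<delta> / (8 * t)))" "regular C \<nu>"
      using nr unfolding near_regular_def by blast
    then obtain w where w: "w \<in> W" "norm w \<le> M" "cinner (C w - \<nu> *\<^sub>C w) u = 0"
      "norm (C w - \<nu> *\<^sub>C w - e0) < \<delta> / 2" using w[of \<nu>] by auto
    define x where "x = w + complex_of_real t *\<^sub>C z"
    define e where "e = C x - \<nu> *\<^sub>C x"
    have xW: "x \<in> W" using w z by (simp add: x_def closed_csubspaceD[OF Wc])
    have z0: "cinner z (f i) = 0" if "i \<le> k" for i using z(1) that by (auto simp: perp_def)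
    have zu: "cinner z u = 0" "cinner z (adj C u) = 0" using z(1) by (auto simp: perp_def)
    have e_eq: "e = (C w - \<nu> *\<^sub>C w) + complex_of_real t *\<^sub>C (C z - \<nu> *\<^sub>C z)"
      by (simp add: e_def x_def clin_simps[OF C] scaleC_add_right scaleC_scaleC
          complex_vector.scale_right_diff_distrib mult.commute)
    have "cinner e u = 0"
      using w(3) zu by (simp add: e_eq cinner_add_left cinner_scaleC_left cinner_diff_left cinner_adj[OF C])
    then have eE: "e \<in> E" using xW CW by (auto simp: E_def perp_def e_def closed_csubspaceD[OF Wc])
    have "norm (C z - \<nu> *\<^sub>C z) \<le> \<delta> / (8 * t) + \<delta> / (8 * t)"
      using z nu(1) by (intro order_trans[OF norm_triangle_ineq4] add_mono) (auto simp: norm_scaleC)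
    then have "t * norm (C z - \<nu> *\<^sub>C z) \<le> t * (\<delta> / (8 * t) + \<delta> / (8 * t))"
      using t by (intro mult_left_mono) auto
    also have "\<dots> = \<delta> / 4" using t by (simp add: field_simps)
    finally have "norm (complex_of_real t *\<^sub>C (C z - \<nu> *\<^sub>C z)) \<le> \<delta> / 4" using t by (simp add: norm_scaleC)
    moreover have e_e0: "e - e0 = (C w - \<nu> *\<^sub>C w - e0) + complex_of_real t *\<^sub>C (C z - \<nu> *\<^sub>C z)"
      by (simp add: e_eq)
    ultimately have "norm (e - e0) < \<delta>"
      using norm_triangle_ineq[of "C w - \<nu> *\<^sub>C w - e0" "complex_of_real t *\<^sub>C (C z - \<nu> *\<^sub>C z)"] w(4) d
      unfolding e_e0 by linarith
    have nx: "norm x \<ge> t - M"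
    proof -
      have "norm (complex_of_real t *\<^sub>C z) \<le> norm x + norm w"
        using norm_triangle_ineq4[of x w] by (simp add: x_def)
      then show ?thesis using t z(2) w(2) by (simp add: norm_scaleC)
    qed
    have "e \<in> Q k"
      unfolding Q_def
    proof (rule UN_I[of \<nu>])
      show "\<nu> \<in> {\<nu>. cmod \<nu> < 1 / Suc k \<and> regular C \<nu>}" using nu by simp
      have Rx: "R \<nu> e = x" unfolding e_def by (rule R(3)[OF nu(2)])
      have S: "norm (f i) \<le> (\<Sum>i\<le>k. norm (f i))" if "i \<le> k" for i
        using that by (intro member_le_sum) auto
      have "Suc k * cmod (cinner x (f i)) < norm x" if i: "i \<le> k" for i
      proof -
        have "cmod (cinner x (f i)) = cmod (cinner w (f i))" using z0[OF i] by (simp add: x_def cinner_simps)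
        also have "\<dots> \<le> M * (\<Sum>i\<le>k. norm (f i))"
          using w(2) S[OF i] M by (intro order_trans[OF Cauchy_Schwarz] mult_mono) auto
        finally have "Suc k * cmod (cinner x (f i)) \<le> Suc k * (M * (\<Sum>i\<le>k. norm (f i)))"
          by (intro mult_left_mono) auto
        also have "\<dots> < t - M" by (simp add: t_def mult.assoc)
        finally show ?thesis using nx by simp
      qed
      moreover have "Suc k < norm x"
      proof -
        show ?thesis using nx S0 unfolding t_def by linarith
      qed
      ultimately show "e \<in> {e. Suc k < norm (R \<nu> e)} \<inter>
          (\<Inter>i\<in>{..k}. {e. Suc k * cmod (cinner (R \<nu> e) (f i)) < norm (R \<nu> e)})"
        by (simp add: Rx)
    qed
    then show "\<exists>e'\<in>E \<inter> Q k. dist e' e0 < \<delta>"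
      using eE \<open>norm (e - e0) < \<delta>\<close> by (auto simp: dist_norm)
  qed
  then obtain e where e: "e \<in> E" "\<And>k. e \<in> Q k" by blast
  show ?thesis
  proof (intro bexI[of _ e] conjI allI)
    show "e \<in> W" "cinner e u = 0" using e(1) by (auto simp: E_def perp_def)
    fix k :: nat
    obtain \<nu> where nu: "cmod \<nu> < 1 / Suc k" "regular C \<nu>" "Suc k < norm (R \<nu> e)"
      "\<And>i. i \<le> k \<Longrightarrow> Suc k * cmod (cinner (R \<nu> e) (f i)) < norm (R \<nu> e)"
      using e(2)[of k] unfolding Q_def by auto
    then show "\<exists>\<nu> x. cmod \<nu> < 1 / Suc k \<and> regular C \<nu> \<and> C x - \<nu> *\<^sub>C x = e \<and> norm x > Suc k \<and>
        (\<forall>i\<le>k. Suc k * cmod (cinner x (f i)) < norm x)"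
      using R(2)[OF nu(2)] by blast
  qed
qed

definition wnull :: "(nat \<Rightarrow> 'a::complex_hilbert_space) \<Rightarrow> bool"
  where "wnull g \<longleftrightarrow> (\<forall>w. (\<lambda>n. cinner (g n) w) \<longlonglongrightarrow> 0)"

text \<open>A bounded inverse would bound \<open>C\<close> below and thus give \<open>CP\<close>.
  The point of the fact is that the parameters of a resolvent orbit are never 0.\<close>

lemma dense_range_subspace_not_regular:
  assumes C: "bounded_clinear C" and W: "dense_range_subspace C W"
  shows "\<not> regular C 0"
proof
  assume "regular C 0"
  then obtain R where R: "bounded_clinear R" "\<And>x. R (C x) = x"
    unfolding regular_def by auto
  obtain K where K: "K \<ge> 0" "\<And>x. norm (R x) \<le> norm x * K" using bounded_clinear_bound[OF R(1)] by blast
  have low: "1 / (K + 1) * norm x \<le> norm (C x)" for x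
  proof -
    have "norm x \<le> norm (C x) * K" using K(2)[of "C x"] R(2) by simp
    also have "\<dots> \<le> norm (C x) * (K + 1)" by (intro mult_left_mono) auto
    finally show ?thesis using K(1) by (simp add: field_simps)
  qed
  have "closed_csubspace W" "\<not> CP C W" using W by (auto simp: dense_range_subspace_def)
  moreover have "1 / (K + 1) > 0" using K(1) by simp
  ultimately show False using CP_bounded_below[OF C _ _ low] by blast
qed

lemma wnullI:
  fixes f :: "nat \<Rightarrow> 'a::complex_hilbert_space"
  assumes f: "closure (range f) = UNIV" and unit: "\<And>n. norm (g n) = 1"
    and small: "\<And>n i. i \<le> n \<Longrightarrow> cmod (cinner (g n) (f i)) \<le> 1 / Suc n"
  shows "wnull g"
  unfolding wnull_def
proof
  fix w
  show "(\<lambda>n. cinner (g n) w) \<longlonglongrightarrow> 0"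
  proof (rule LIMSEQ_I)
    fix e :: real assume e: "e > 0"
    have "w \<in> closure (range f)" using f by simp
    then obtain i where i: "dist (f i) w < e / 2"
      unfolding closure_approachable using e by (metis half_gt_zero imageE)
    obtain M where M: "1 / real (Suc M) < e / 2" using e nat_approx_posE half_gt_zero by metis
    have "cmod (cinner (g n) w) < e" if n: "n \<ge> max i M" for n
    proof -
      have "cinner (g n) w = cinner (g n) (f i) - cinner (g n) (f i - w)" by (simp add: cinner_diff_right)
      then have "cmod (cinner (g n) w) \<le> cmod (cinner (g n) (f i)) + cmod (cinner (g n) (f i - w))"
        using norm_triangle_ineq4 by metis
      moreover have "cmod (cinner (g n) (f i - w)) < e / 2"
        using Cauchy_Schwarz[of "g n" "f i - w"] unit[of n] i by (simp add: dist_norm)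
      moreover have "cmod (cinner (g n) (f i)) \<le> 1 / Suc n" using small n by simp
      moreover have "1 / real (Suc n) \<le> 1 / real (Suc M)" using n by (intro divide_left_mono) auto
      ultimately show ?thesis using M by linarith
    qed
    then show "\<exists>no. \<forall>n\<ge>no. norm (cinner (g n) w - 0) < e" by (intro exI[of _ "max i M"]) simp
  qed
qed

text \<open>The condition at stage \<open>k\<close> implies the one at every earlier stage, and no
  parameter is 0. So a later stage can always be chosen with strictly smaller modulus, which makes
  the parameters pairwise distinct.\<close>

lemma orbit_sequence:
  fixes f :: "nat \<Rightarrow> 'a::complex_hilbert_space"
  assumes f: "closure (range f) = UNIV" and n0: "\<not> regular C 0"
    and orb: "\<And>k::nat. \<exists>\<nu> x. cmod \<nu> < 1 / Suc k \<and> regular C \<nu> \<and>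
      C x - \<nu> *\<^sub>C x = e \<and> norm x > Suc k \<and> (\<forall>i\<le>k. Suc k * cmod (cinner x (f i)) < norm x)"
  obtains \<nu> x where "\<And>n. regular C (\<nu> n)" "\<And>n. C (x n) = \<nu> n *\<^sub>C x n + e" "\<And>n. norm (x n) > Suc n"
    "\<And>n. cmod (\<nu> n) < 1 / Suc n" "\<And>m n. m < n \<Longrightarrow> cmod (\<nu> n) < cmod (\<nu> m)" "\<And>n. \<nu> n \<noteq> 0"
    "wnull (\<lambda>n. unitv (x n))"
proof -
  define P where "P n s \<longleftrightarrow> cmod (fst s) < 1 / Suc n \<and> regular C (fst s) \<and>
      C (snd s) - fst s *\<^sub>C snd s = e \<and> norm (snd s) > Suc n \<and>
      (\<forall>i\<le>n. Suc n * cmod (cinner (snd s) (f i)) < norm (snd s))" for n :: nat and s :: "complex \<times> 'a"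
  have ex: "\<exists>s. P k s" for k using orb[of k] by (auto simp: P_def)
  have mono: "P n s" if "P k s" "n \<le> k" for n k s
  proof -
    have "1 / real (Suc k) \<le> 1 / real (Suc n)" using that(2) by (intro divide_left_mono) auto
    moreover have "real (Suc n) * cmod (cinner (snd s) (f i)) \<le> real (Suc k) * cmod (cinner (snd s) (f i))" for i
      using that(2) by (intro mult_right_mono) auto
    moreover have "cmod (fst s) < 1 / Suc k" "regular C (fst s)" "C (snd s) - fst s *\<^sub>C snd s = e"
      "norm (snd s) > Suc k" "\<And>i. i \<le> k \<Longrightarrow> Suc k * cmod (cinner (snd s) (f i)) < norm (snd s)"
      using that(1) by (auto simp: P_def)
    moreover have "real (Suc n) \<le> real (Suc k)" using that(2) by simp
    ultimately show ?thesis unfolding P_def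
      using that(2) by (intro conjI allI impI) (linarith, assumption, assumption, linarith, meson le_less_trans le_trans)
  qed
  have "\<exists>F. \<forall>n. P n (F n) \<and> cmod (fst (F (Suc n))) < cmod (fst (F n))"
  proof (rule dependent_nat_choice)
    show "\<exists>s. P 0 s" by (rule ex)
    fix s n assume s: "P n s"
    then have "fst s \<noteq> 0" using n0 by (auto simp: P_def)
    then obtain M where M: "1 / real (Suc M) < cmod (fst s)" using nat_approx_posE zero_less_norm_iff by metis
    obtain t where t: "P (max M (Suc n)) t" using ex by blast
    have "P (Suc n) t" "P M t" using mono[OF t] by auto
    moreover from this have "cmod (fst t) < cmod (fst s)" using M by (auto simp: P_def)
    ultimately show "\<exists>t. P (Suc n) t \<and> cmod (fst t) < cmod (fst s)" by blast
  qed
  then obtain F where F: "\<And>n. P n (F n)" "\<And>n. cmod (fst (F (Suc n))) < cmod (fst (F n))" by blast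
  define \<nu> x where "\<nu> n = fst (F n)" and "x n = snd (F n)" for n
  have x: "cmod (\<nu> n) < 1 / Suc n" "regular C (\<nu> n)" "C (x n) - \<nu> n *\<^sub>C x n = e" "norm (x n) > Suc n"
      "\<And>i. i \<le> n \<Longrightarrow> Suc n * cmod (cinner (x n) (f i)) < norm (x n)" for n
    using F(1)[of n] by (auto simp: P_def \<nu>_def x_def)
  show thesis
  proof (rule that[of \<nu> x])
    show "C (x n) = \<nu> n *\<^sub>C x n + e" for n using x(3)[of n] by (simp add: algebra_simps)
    show "cmod (\<nu> n) < cmod (\<nu> m)" if "m < n" for m n
      using lift_Suc_mono_less[of "\<lambda>n. - cmod (\<nu> n)" m n] F(2) that by (simp add: \<nu>_def)
    show "\<nu> n \<noteq> 0" for n using x(2)[of n] n0 by metis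
    show "wnull (\<lambda>n. unitv (x n))"
    proof (rule wnullI[OF f])
      have pos: "norm (x n) > 0" for n using x(4)[of n] by (meson le_less_trans of_nat_0_le_iff)
      show "norm (unitv (x n)) = 1" for n using pos[of n] by (intro norm_unitv) auto
      show "cmod (cinner (unitv (x n)) (f i)) \<le> 1 / Suc n" if "i \<le> n" for n i
        using x(5)[OF that] pos[of n]
        by (simp add: unitv_def cinner_scaleC_left norm_mult norm_divide field_simps)
    qed
  qed (use x in auto)
qed

section \<open>Perturbations of orthonormal sequences\<close>

text \<open>The projections of a weakly null sequence onto a fixed finite dimensional space tend to
  0 in norm, so late members are almost orthogonal to \<open>F\<close> already.\<close>

lemma gram_schmidt_step:
  assumes F: "finite F" "orthonormal F" and g: "\<And>n. norm (g n) = 1" "wnull g"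
    and ev: "eventually P sequentially" and d: "\<delta> > 0"
  shows "\<exists>k>N. P k \<and> (\<exists>v. norm v = 1 \<and> v \<in> perp F \<and> g k \<in> cspan (insert v F) \<and>
    norm (g k - v) < \<delta> \<and> cmod (cinner q v) < \<delta>)"
proof -
  define y where "y k = (\<Sum>a\<in>F. cinner (g k) a *\<^sub>C a)" for k
  define r where "r k = g k - y k" for k
  have "y \<longlonglongrightarrow> (\<Sum>a\<in>F. 0 *\<^sub>C a)"
    unfolding y_def by (intro tendsto_sum tendsto_scaleC tendsto_const) (use g(2) in \<open>auto simp: wnull_def\<close>)
  then have y0: "y \<longlonglongrightarrow> 0" by simp
  have "r k \<in> perp F" for k
  proof (rule perp_memI)
    fix a assume a: "a \<in> F"
    have "cinner (y k) a = (\<Sum>b\<in>F. if b = a then cinner (g k) b else 0)"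
      unfolding y_def cinner_sum_left
      by (rule sum.cong) (use F(2) a in \<open>auto simp: orthonormal_def cinner_scaleC_left\<close>)
    then show "cinner (r k) a = 0" using a F(1) by (simp add: r_def cinner_diff_left)
  qed
  note rF = this
  have nr: "\<bar>norm (r k) - 1\<bar> \<le> norm (y k)" for k
    using norm_triangle_ineq3[of "g k - y k" "g k"] g(1)[of k] by (simp add: r_def)
  have close: "norm (g k - unitv (r k)) \<le> 2 * norm (y k)" if "r k \<noteq> 0" for k
  proof -
    have "r k - unitv (r k) = complex_of_real (1 - 1 / norm (r k)) *\<^sub>C r k"
      by (simp add: unitv_def complex_vector.scale_left_diff_distrib)
    then have "norm (r k - unitv (r k)) = \<bar>1 - 1 / norm (r k)\<bar> * norm (r k)"
      by (simp only: norm_scaleC norm_of_real)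
    also have "\<dots> = \<bar>norm (r k) - 1\<bar>"
    proof -
      have "\<bar>1 - 1 / norm (r k)\<bar> * norm (r k) = \<bar>(1 - 1 / norm (r k)) * norm (r k)\<bar>"
        by (simp add: abs_mult)
      then show ?thesis using that by (simp add: left_diff_distrib abs_minus_commute)
    qed
    finally have "norm (r k - unitv (r k)) \<le> norm (y k)" using nr by simp
    moreover have eq: "g k - unitv (r k) = y k + (r k - unitv (r k))" by (simp add: r_def)
    ultimately show ?thesis unfolding eq using norm_triangle_ineq[of "y k" "r k - unitv (r k)"] by linarith
  qed
  \<comment> \<open>The bound 1/2 keeps \<open>r k\<close> nonzero. As \<open>g k\<close> is within
    \<open>2 * norm (y k)\<close> of the normalized remainder, the other two bounds give the
    closeness to \<open>g k\<close> and an error of at most \<open>\<delta> / 2\<close> in the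
    pairing with \<open>q\<close>.\<close>
  define m where "m = min (1/2) (min (\<delta> / 4) (\<delta> / (4 * (norm q + 1))))"
  have m: "m > 0" using d by (auto simp: m_def intro!: divide_pos_pos add_nonneg_pos)
  have "eventually (\<lambda>k. norm (y k) < m) sequentially"
    using order_tendstoD(2)[OF tendsto_norm_zero[OF y0] m] .
  moreover have "eventually (\<lambda>k. cmod (cinner (g k) q) < \<delta> / 2) sequentially"
  proof -
    have "(\<lambda>k. cinner (g k) q) \<longlonglongrightarrow> 0" using g(2) by (simp add: wnull_def)
    from order_tendstoD(2)[OF tendsto_norm_zero[OF this], of "\<delta> / 2"] d show ?thesis by simp
  qed
  ultimately have "eventually (\<lambda>k. norm (y k) < m \<and> cmod (cinner (g k) q) < \<delta> / 2 \<and> P k \<and> k > N) sequentially"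
    using ev eventually_gt_at_top[of N] by eventually_elim auto
  then obtain k where k: "norm (y k) < m" "cmod (cinner (g k) q) < \<delta> / 2" "P k" "k > N"
    using eventually_happens'[OF sequentially_bot] by blast
  have r0: "r k \<noteq> 0" using nr[of k] k(1) by (auto simp: m_def)
  let ?v = "unitv (r k)"
  have "norm ?v = 1" using r0 by (rule norm_unitv)
  moreover have "?v \<in> perp F"
    unfolding unitv_def by (rule closed_csubspaceD(6)[OF closed_csubspace_perp rF])
  moreover have "g k \<in> cspan (insert ?v F)"
  proof -
    have "y k \<in> cspan (insert ?v F)"
      unfolding y_def by (intro complex_vector.span_sum complex_vector.span_scale complex_vector.span_base) auto
    moreover have "r k = complex_of_real (norm (r k)) *\<^sub>C ?v"
      using r0 by (simp add: unitv_def scaleC_scaleC)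
    then have "r k \<in> cspan (insert ?v F)"
      by (metis complex_vector.span_base complex_vector.span_scale insertI1)
    ultimately show ?thesis using complex_vector.span_add[of "y k" _ "r k"] by (simp add: r_def)
  qed
  moreover have gv: "norm (g k - ?v) < \<delta>" using close[OF r0] k(1) d by (simp add: m_def)
  moreover have "cmod (cinner q ?v) < \<delta>"
  proof -
    have "cinner q ?v = cinner q (g k) - cinner q (g k - ?v)" by (simp add: cinner_diff_right)
    then have "cmod (cinner q ?v) \<le> cmod (cinner q (g k)) + cmod (cinner q (g k - ?v))"
      using norm_triangle_ineq4 by metis
    moreover have "cmod (cinner q (g k)) < \<delta> / 2" using k(2) by (metis cinner_commute complex_mod_cnj)
    moreover have "cmod (cinner q (g k - ?v)) \<le> \<delta> / 2"
    proof -
      have "cmod (cinner q (g k - ?v)) \<le> norm q * norm (g k - ?v)" by (rule Cauchy_Schwarz)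
      also have "\<dots> \<le> (norm q + 1) * (2 * (\<delta> / (4 * (norm q + 1))))"
        using close[OF r0] k(1) by (intro mult_mono) (auto simp: m_def)
      also have "\<dots> = \<delta> / 2"
      proof -
        have *: "z * (2 * (\<delta> / (4 * z))) = \<delta> / 2" if "z \<noteq> 0" for z using that by simp
        show ?thesis by (rule *) (use norm_ge_zero[of q] in linarith)
      qed
      finally show ?thesis .
    qed
    ultimately show ?thesis by linarith
  qed
  ultimately show ?thesis using k by blast
qed

lemma onseqI_less:
  assumes "\<And>n. norm (w n) = 1" "\<And>i n. i < n \<Longrightarrow> cinner (w n) (w i) = 0"
  shows "onseq w"
  unfolding onseq_def
proof (intro allI)
  fix m n :: nat
  consider "m < n" | "n < m" | "m = n" by linarith
  then show "cinner (w m) (w n) = (if m = n then 1 else 0)"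
  proof cases
    case 1 then show ?thesis using assms(2)[OF 1] by (simp add: cinner_eq_0_commute[of "w m"])
  qed (use assms in \<open>auto simp: cinner_self\<close>)
qed

text \<open>The first vector \<open>p\<close> is prescribed, so \<open>g (s n)\<close> sits at index
  \<open>Suc n\<close>. Keeping the later vectors almost orthogonal to \<open>q\<close> will show
  that a certain vector is outside their closed span.\<close>

lemma select_near_orthonormal:
  assumes g: "\<And>n. norm (g n) = 1" "wnull g" and p: "norm p = 1"
    and ev: "\<And>n. eventually (P n) sequentially" and d: "\<And>n. \<delta> n > 0"
  obtains s w where "strict_mono s" "onseq w" "w 0 = p" "\<And>n. P n (s n)" "\<And>n. norm (g (s n) - w (Suc n)) < \<delta> n"
    "\<And>n. g (s n) \<in> cspan (range w)" "\<And>n. cmod (cinner q (w (Suc n))) < \<delta> n"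
proof -
  \<comment> \<open>In a state \<open>(F, k, v)\<close> the newest vector \<open>v\<close> is not
    yet in \<open>F\<close>, so its orthogonality to all earlier ones is part of the invariant;
    \<open>k\<close> is the last index used.\<close>
  define I where "I (n::nat) S \<longleftrightarrow> (case S of (F, k::nat, v) \<Rightarrow> finite F \<and> orthonormal F \<and> norm v = 1 \<and> v \<in> perp F \<and>
    (n = 0 \<longrightarrow> F = {} \<and> v = p))" for n S
  define Q where "Q n S S' \<longleftrightarrow> (case S of (F, k, v) \<Rightarrow> case S' of (F', k', v') \<Rightarrow> F' = insert v F \<and> k < k' \<and>
    P n k' \<and> g k' \<in> cspan (insert v' F') \<and> norm (g k' - v') < \<delta> n \<and> cmod (cinner q v') < \<delta> n)" for n S S'
  have "\<exists>f. \<forall>n. I n (f n) \<and> Q n (f n) (f (Suc n))"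
  proof (rule dependent_nat_choice)
    show "\<exists>S. I 0 S" using p by (intro exI[of _ "({}, 0, p)"]) (simp add: I_def orthonormal_def perp_def)
    fix S n assume S: "I n S"
    obtain F k v where Fkv: "S = (F, k, v)" by (cases S)
    have F: "finite F" "orthonormal F" "norm v = 1" "v \<in> perp F" using S by (auto simp: I_def Fkv)
    have "v \<notin> F" using perpD(1)[OF F(4), of v] F(3) by auto
    then have ON: "orthonormal (insert v F)"
      using F(2,3) perpD[OF F(4)] by (auto simp: orthonormal_def cinner_self)
    have "finite (insert v F)" using F(1) by simp
    from gram_schmidt_step[OF this ON g ev[of n] d[of n], of k q]
    obtain k' v' where "k' > k" "P n k'" "norm v' = 1" "v' \<in> perp (insert v F)"
      "g k' \<in> cspan (insert v' (insert v F))" "norm (g k' - v') < \<delta> n" "cmod (cinner q v') < \<delta> n"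
      by blast
    then show "\<exists>S'. I (Suc n) S' \<and> Q n S S'"
      using ON F(1) by (intro exI[of _ "(insert v F, k', v')"]) (simp add: I_def Q_def Fkv)
  qed
  then obtain f where f: "\<And>n. I n (f n)" "\<And>n. Q n (f n) (f (Suc n))" by blast
  define F k w where "F n = fst (f n)" and "k n = fst (snd (f n))" and "w n = snd (snd (f n))" for n
  have fn: "f n = (F n, k n, w n)" for n by (simp add: F_def k_def w_def)
  have I: "norm (w n) = 1" "w n \<in> perp (F n)" for n using f(1)[of n] by (auto simp: I_def fn)
  have F0: "F 0 = {}" "w 0 = p" using f(1)[of 0] by (auto simp: I_def fn)
  have Q: "F (Suc n) = insert (w n) (F n)" "k n < k (Suc n)" "P n (k (Suc n))"
    "g (k (Suc n)) \<in> cspan (insert (w (Suc n)) (F (Suc n)))" "norm (g (k (Suc n)) - w (Suc n)) < \<delta> n"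
    "cmod (cinner q (w (Suc n))) < \<delta> n" for n
    using f(2)[of n] by (auto simp: Q_def fn)
  have Fw: "F n = w ` {..<n}" for n by (induction n) (auto simp: F0 Q lessThan_Suc)
  show thesis
  proof (rule that[of "\<lambda>n. k (Suc n)" w])
    show "strict_mono (\<lambda>n. k (Suc n))" using Q(2) by (simp add: strict_mono_Suc_iff)
    show "onseq w" using I(1)
    proof (rule onseqI_less)
      show "cinner (w n) (w i) = 0" if "i < n" for i n using perpD(1)[OF I(2)[of n]] that by (auto simp: Fw)
    qed
    show "g (k (Suc n)) \<in> cspan (range w)" for n
    proof -
      have "insert (w (Suc n)) (F (Suc n)) \<subseteq> range w" by (auto simp: Fw)
      then show ?thesis using Q(4)[of n] complex_vector.span_mono by blast
    qed
  qed (use Q F0 in auto)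
qed

text \<open>\<open>x\<close> is a Riesz basis of the closed span of \<open>w\<close>. That
  \<open>L\<close> preserves this span and is the identity on its complement lets two systems with
  orthogonal spans be straightened independently.\<close>

definition riesz_system where
  "riesz_system x w L L' \<longleftrightarrow> onseq w \<and> bounded_clinear L \<and> bounded_clinear L' \<and> (\<forall>h. L (L' h) = h) \<and>
    (\<forall>h. L' (L h) = h) \<and> (\<forall>n. L (w n) = x n) \<and> (\<forall>h\<in>perp (range w). L h = h) \<and>
    (\<forall>h\<in>cls (range w). L h \<in> cls (range w) \<and> L' h \<in> cls (range w))"

text \<open>\<open>L\<close> is \<open>1 + D\<close>, where \<open>D\<close> sends
  \<open>w n\<close> to \<open>x n - w n\<close>. The errors sum to 1/2, so \<open>D\<close> has
  norm at most 1/2 and \<open>L\<close> is invertible; the range of \<open>D\<close> lies in the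
  closed span of \<open>w\<close>, hence \<open>L\<close> and its inverse respect that span.\<close>

lemma near_orthonormal_riesz_system:
  assumes w: "onseq w" and x: "\<And>n. x n \<in> cls (range w)" "\<And>n. norm (x n - w n) \<le> (1/2) ^ (n + 2)"
  shows "\<exists>L L'. riesz_system x w L L'"
proof -
  define D where "D h = (\<Sum>n. cinner h (w n) *\<^sub>C (x n - w n))" for h
  have bd: "norm (cinner h (w n) *\<^sub>C (x n - w n)) \<le> norm h * (1/2) ^ (n + 2)" for h n
    unfolding norm_scaleC using Cauchy_Schwarz[of h "w n"] onseq_norm[OF w, of n]
    by (intro mult_mono x) auto
  have sg: "summable (\<lambda>n. norm h * (1/2) ^ (n + 2))" for h :: 'a
    unfolding power_add by (intro summable_mult summable_mult2 summable_geometric) auto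
  have sm: "summable (\<lambda>n. cinner h (w n) *\<^sub>C (x n - w n))" for h
    by (rule summable_comparison_test[OF _ sg[of h]]) (use bd in auto)
  have nD: "norm (D h) \<le> norm h * (1/2)" for h
  proof -
    have "norm (D h) \<le> (\<Sum>n. norm h * (1/2) ^ (n + 2))"
      unfolding D_def
      by (rule order_trans[OF summable_norm suminf_le[OF bd _ sg]])
        (use bd in \<open>auto intro!: summable_comparison_test[OF _ sg[of h]]\<close>)
    also have "\<dots> = norm h * ((\<Sum>n. (1/2) ^ n) * (1/2)^2)"
      unfolding power_add by (subst suminf_mult) (auto simp: suminf_mult2 summable_geometric intro!: summable_mult2)
    also have "\<dots> = norm h * (1/2)" by (simp add: suminf_geometric power2_eq_square)
    finally show ?thesis .
  qed
  have D: "bounded_clinear D"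
  proof (rule bounded_clinearI[OF _ _ nD])
    show "D (a + b) = D a + D b" for a b
      unfolding D_def suminf_add[OF sm sm] by (simp add: cinner_add_left scaleC_add_left)
    show "D (c *\<^sub>C a) = c *\<^sub>C D a" for c a
      unfolding D_def using bounded_linear.suminf[OF bounded_clinear_bounded_linear[OF bounded_clinear_scale] sm, of c a]
      by (simp add: cinner_scaleC_left scaleC_scaleC)
  qed
  have half: "(0::real) \<le> 1/2" "1/2 < cmod (-1)" by auto
  have "regular D (-1)"
  proof (rule regularI[OF D])
    show "(cmod (-1) - 1/2) * norm a \<le> norm (D a - (-1) *\<^sub>C a)" for a
      by (rule bounded_below_of_large[OF nD])
    show "\<exists>a. D a - (-1) *\<^sub>C a = b" for b
    proof -
      have "b \<in> (\<lambda>x. D x - (-1) *\<^sub>C x) ` UNIV"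
        using onto_of_large[OF D closed_csubspace_UNIV _ half(1) nD half(2)] by blast
      then show ?thesis by blast
    qed
  qed simp
  then obtain L' where L': "bounded_clinear L'" "\<And>a. D (L' a) - (-1) *\<^sub>C L' a = a"
    "\<And>a. L' (D a - (-1) *\<^sub>C a) = a"
    unfolding regular_def by blast
  define L where "L h = D h - (-1) *\<^sub>C h" for h
  have L: "bounded_clinear L" unfolding L_def by (intro bounded_clinear_intros D)
  have L_eq: "L h = D h + h" for h by (simp add: L_def scaleC_minus1)
  note M = closed_csubspace_cls[of "range w"]
  have DM: "D h \<in> cls (range w)" for h
  proof -
    have "cinner h (w n) *\<^sub>C (x n - w n) \<in> cls (range w)" for n
      using x(1) cls_superset[of "range w"] by (auto intro!: closed_csubspaceD[OF M])
    then have "(\<Sum>n<N. cinner h (w n) *\<^sub>C (x n - w n)) \<in> cls (range w)" for N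
      by (rule complex_vector.subspace_sum[OF closed_csubspaceD(1)[OF M]])
    then show ?thesis
      unfolding D_def using closed_sequentially[OF closed_csubspaceD(2)[OF M] _ summable_LIMSEQ[OF sm]] by blast
  qed
  have "L (w n) = x n" for n
  proof -
    have "D (w n) = (\<Sum>k. if k = n then x k - w k else 0)"
      unfolding D_def by (rule suminf_cong) (auto simp: onseqD[OF w])
    then have "D (w n) = x n - w n" using sums_unique[OF sums_single[of n "\<lambda>k. x k - w k"]] by simp
    then show ?thesis by (simp add: L_eq)
  qed
  moreover have "L h = h" if "h \<in> perp (range w)" for h
    using that by (simp add: L_eq D_def perp_def)
  moreover have "L' h \<in> cls (range w)" if h: "h \<in> cls (range w)" for h
  proof -
    obtain a where "a \<in> cls (range w)" "h = D a - (-1) *\<^sub>C a"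
      using onto_of_large[OF D M DM half(1) nD half(2)] h by blast
    then show ?thesis using L'(3) by simp
  qed
  moreover have "L h \<in> cls (range w)" if "h \<in> cls (range w)" for h
    using that DM by (simp add: L_eq closed_csubspaceD[OF M])
  ultimately have "riesz_system x w L L'"
    unfolding riesz_system_def using w L L' by (simp add: L_def)
  then show ?thesis by blast
qed

lemma riesz_system_exists:
  assumes g: "\<And>n. norm (g n) = 1" "wnull g" and p: "norm p = 1"
    and ev: "\<And>n. eventually (P n) sequentially" and \<eta>: "\<eta> > 0"
  obtains s w L L' where "strict_mono s" "\<And>n. P n (s n)" "w 0 = p"
    "riesz_system (case_nat p (\<lambda>n. g (s n))) w L L'" "\<And>n. cmod (cinner q (w (Suc n))) \<le> \<eta> * (1/2) ^ (n + 2)"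
proof -
  \<comment> \<open>\<open>n + 3\<close> is \<open>Suc n + 2\<close>, because \<open>g (s n)\<close>
    is compared with \<open>w (Suc n)\<close>; the factor \<open>min 1 \<eta>\<close> serves
    closeness and the pairing with \<open>q\<close> at once.\<close>
  define \<delta> where "\<delta> n = min 1 \<eta> * (1/2) ^ (n + 3)" for n :: nat
  have d: "\<delta> n > 0" for n using \<eta> by (simp add: \<delta>_def)
  obtain s w where s: "strict_mono s" "onseq w" "w 0 = p" "\<And>n. P n (s n)" "\<And>n. norm (g (s n) - w (Suc n)) < \<delta> n"
    "\<And>n. g (s n) \<in> cspan (range w)" "\<And>n. cmod (cinner q (w (Suc n))) < \<delta> n"
    by (rule select_near_orthonormal[where P = P and \<delta> = \<delta> and q = q, OF g p ev d]) (rule that, assumption+)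
  have dle: "\<delta> n \<le> \<eta> * (1/2) ^ (n + 2)" "\<delta> n \<le> (1/2) ^ (Suc n + 2)" for n
  proof -
    have "\<delta> n \<le> \<eta> * (1/2) ^ (n + 3)" unfolding \<delta>_def by (intro mult_right_mono) auto
    also have "\<dots> \<le> \<eta> * (1/2) ^ (n + 2)" using \<eta> by (intro mult_left_mono power_decreasing) auto
    finally show "\<delta> n \<le> \<eta> * (1/2) ^ (n + 2)" .
    show "\<delta> n \<le> (1/2) ^ (Suc n + 2)"
      unfolding \<delta>_def by (rule order_trans[OF mult_right_mono[of _ 1]]) (auto simp: numeral_3_eq_3)
  qed
  have "\<exists>L L'. riesz_system (case_nat p (\<lambda>n. g (s n))) w L L'"
  proof (rule near_orthonormal_riesz_system[OF s(2)])
    fix n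
    show "case_nat p (\<lambda>n. g (s n)) n \<in> cls (range w)"
    proof (cases n)
      case 0 then show ?thesis using s(3) cls_superset[of "range w"] by auto
    next
      case (Suc k) then show ?thesis using s(6)[of k] closure_subset by (auto simp: cls_def)
    qed
    show "norm (case_nat p (\<lambda>n. g (s n)) n - w n) \<le> (1/2) ^ (n + 2)"
    proof (cases n)
      case (Suc k) then show ?thesis using s(5)[of k] dle(2)[of k] by simp
    qed (simp add: s(3))
  qed
  then obtain L L' where "riesz_system (case_nat p (\<lambda>n. g (s n))) w L L'" by blast
  moreover have "cmod (cinner q (w (Suc n))) \<le> \<eta> * (1/2) ^ (n + 2)" for n
    using s(7)[of n] dle(1)[of n] by simp
  ultimately show thesis using that s by metis
qed

lemma onseq_coefficients:
  assumes w: "onseq w" and c: "summable (\<lambda>n. (cmod (c n))\<^sup>2)"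
  shows "\<exists>x. \<forall>k. cinner x (w k) = c k"
proof (intro exI allI)
  fix k
  have "cinner (\<Sum>n. c n *\<^sub>C w n) (w k) = (\<Sum>n. cinner (c n *\<^sub>C w n) (w k))"
    by (rule bounded_linear.suminf[OF bounded_linear_cinner_left summable_onseq[OF w c]])
  also have "\<dots> = (\<Sum>n. if n = k then c n else 0)"
    by (rule suminf_cong) (simp add: cinner_simps onseqD[OF w])
  finally show "cinner (\<Sum>n. c n *\<^sub>C w n) (w k) = c k" using sums_unique[OF sums_single[of k c]] by simp
qed

lemma closed_csubspace_preimage:
  assumes B: "bounded_clinear B" and M: "closed_csubspace M" shows "closed_csubspace {x. B x \<in> M}"
proof -
  have "closed (B -` M)"
    by (rule closed_vimage[OF closed_csubspaceD(2)[OF M] continuous_on_bounded_clinear[OF B]])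
  then show ?thesis
    using closed_csubspaceD[OF M]
    by (auto simp: closed_csubspace_def csubspace_iff clin_simps[OF B] vimage_def)
qed

section \<open>Rank one couplings with weakly null eigenvector systems on both sides\<close>

text \<open>\<open>A - \<psi> \<otimes> u\<close> maps \<open>x\<^sub>n\<close> to \<open>\<lambda>\<^sub>n x\<^sub>n + a\<^sub>n e\<close>, and its adjoint maps \<open>y\<^sub>k\<close> to the span of
  \<open>y\<^sub>k\<close> and \<open>m\<close>. The adjoint is avoided so that the definition is stable under similarities.\<close>

definition coupled ::
  "('a::complex_hilbert_space \<Rightarrow> 'a) \<Rightarrow> 'a \<Rightarrow> 'a \<Rightarrow> 'a \<Rightarrow> 'a \<Rightarrow> (nat \<Rightarrow> 'a) \<Rightarrow> (nat \<Rightarrow> complex) \<Rightarrow>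
    (nat \<Rightarrow> complex) \<Rightarrow> (nat \<Rightarrow> 'a) \<Rightarrow> (nat \<Rightarrow> complex) \<Rightarrow> (nat \<Rightarrow> complex) \<Rightarrow> bool" where
  "coupled A \<psi> u e m x l a y \<mu> b \<longleftrightarrow>
    (\<forall>n. A (x n) = l n *\<^sub>C x n + a n *\<^sub>C e + cinner (x n) u *\<^sub>C \<psi>) \<and>
    (\<forall>k h. cinner (A h) (y k) = \<mu> k * cinner h (y k) + cnj (b k) * cinner h m + cinner h u * cinner \<psi> (y k)) \<and>
    (\<forall>n k. cinner (x n) (y k) = 0) \<and> (\<forall>k. cinner e (y k) = 0) \<and> (\<forall>n. cinner (x n) m = 0) \<and>
    cinner \<psi> u = 0 \<and> cinner e u = 0 \<and> cinner \<psi> m = 0"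

text \<open>The four alternatives are what the transvections need later: nonzero \<open>e\<close>
  and \<open>m\<close> must have components off the spans of \<open>x\<close> and \<open>y\<close>,
  and nonzero \<open>u\<close> and \<open>\<psi>\<close> must have nonzero projections onto them.
  For Riesz systems these spans are those of \<open>wx\<close> and \<open>wy\<close>.\<close>

definition two_sided_system where
  "two_sided_system A d \<psi> u e m x l a y \<mu> b wx wy \<longleftrightarrow>
    coupled A \<psi> u e m x l a y \<mu> b \<and>
    (\<forall>n. cmod (l n) \<le> d n) \<and> (\<forall>k. cmod (\<mu> k) \<le> d k) \<and>
    (e = 0 \<or> e \<notin> cls (range wx)) \<and> (m = 0 \<or> m \<notin> cls (range wy)) \<and>
    (u = 0 \<or> cinner (x 0) u \<noteq> 0) \<and> (\<psi> = 0 \<or> cinner \<psi> (y 0) \<noteq> 0)"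

definition has_two_sided_system where
  "has_two_sided_system A d \<longleftrightarrow> (\<exists>\<psi> u e m x l a y \<mu> b wx wy Lx Lx' Ly Ly'.
    two_sided_system A d \<psi> u e m x l a y \<mu> b wx wy \<and> riesz_system x wx Lx Lx' \<and> riesz_system y wy Ly Ly')"

text \<open>Taking the adjoint exchanges \<open>x\<close> with \<open>y\<close>, \<open>e\<close>
  with \<open>m\<close> and \<open>\<psi>\<close> with \<open>u\<close>, and conjugates the
  eigenvalues.\<close>

lemma has_two_sided_system_adj:
  assumes A: "bounded_clinear A" and "has_two_sided_system A d"
  shows "has_two_sided_system (adj A) d"
proof -
  obtain \<psi> u e m x l a y \<mu> b wx wy Lx Lx' Ly Ly' where
    S: "two_sided_system A d \<psi> u e m x l a y \<mu> b wx wy" and R: "riesz_system x wx Lx Lx'" "riesz_system y wy Ly Ly'"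
    using assms(2) unfolding has_two_sided_system_def by blast
  note S = S[unfolded two_sided_system_def coupled_def]
  have sy: "cinner (y n) (x k) = 0" "cinner m (x k) = 0" "cinner (y n) e = 0" "cinner u \<psi> = 0"
    "cinner m \<psi> = 0" "cinner \<psi> u = 0" "cinner u e = 0" for n k
    using S by (simp_all add: cinner_eq_0_commute[of "y n"] cinner_eq_0_commute[of m] cinner_eq_0_commute[of u])
  have sy0: "cinner (y 0) \<psi> = 0 \<longleftrightarrow> cinner \<psi> (y 0) = 0" "cinner u (x 0) = 0 \<longleftrightarrow> cinner (x 0) u = 0"
    by (rule cinner_eq_0_commute)+
  have "two_sided_system (adj A) d u \<psi> m e y (\<lambda>n. cnj (\<mu> n)) b x (\<lambda>n. cnj (l n)) a wy wx"
    unfolding two_sided_system_def coupled_def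
  proof (intro conjI allI)
    show "adj A (y n) = cnj (\<mu> n) *\<^sub>C y n + b n *\<^sub>C m + cinner (y n) \<psi> *\<^sub>C u" for n
    proof (rule cinner_ext_right)
      fix h
      have "cinner \<psi> (y n) = cnj (cinner (y n) \<psi>)" by (rule cinner_commute)
      then show "cinner h (adj A (y n)) = cinner h (cnj (\<mu> n) *\<^sub>C y n + b n *\<^sub>C m + cinner (y n) \<psi> *\<^sub>C u)"
        using S by (simp add: cinner_adj[OF A, symmetric] cinner_simps mult.commute)
    qed
    show "cinner (adj A h) (x k) = cnj (l k) * cinner h (x k) + cnj (a k) * cinner h e + cinner h \<psi> * cinner u (x k)" for k h
    proof -
      have "cinner u (x k) = cnj (cinner (x k) u)" by (rule cinner_commute)
      then show ?thesis
        using S by (simp add: cinner_adj'[OF A, symmetric] cinner_simps mult.commute)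
    qed
  qed (use S sy sy0 in auto)
  then show ?thesis unfolding has_two_sided_system_def using R by blast
qed

text \<open>Letting the subspace vary with \<open>n\<close> produces two mutually orthogonal
  sequences in one run; the kernels of \<open>A\<close> and of its adjoint need not be orthogonal to
  each other.\<close>

lemma interlaced_onseq:
  fixes Z :: "nat \<Rightarrow> 'a::complex_hilbert_space set"
  assumes "\<And>n. csubspace (Z n)" "\<And>n. infinite_cdim (Z n)"
  shows "\<exists>v. onseq v \<and> (\<forall>n. v n \<in> Z n)"
proof -
  define I where "I (n::nat) S \<longleftrightarrow> (case S of (F, v) \<Rightarrow> finite F \<and> norm v = 1 \<and> v \<in> perp F \<and> v \<in> Z n \<and>
    (n = 0 \<longrightarrow> F = {}))" for n S
  have "\<exists>f. \<forall>n. I n (f n) \<and> fst (f (Suc n)) = insert (snd (f n)) (fst (f n))"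
  proof (rule dependent_nat_choice)
    obtain z where "z \<in> Z 0 \<inter> perp {}" "norm z = 1" using infinite_cdim_perp[OF assms finite.emptyI] by blast
    then show "\<exists>S. I 0 S" by (intro exI[of _ "({}, z)"]) (simp add: I_def)
    fix S n assume "I n S"
    then have "finite (insert (snd S) (fst S))" by (auto simp: I_def split: prod.splits)
    then obtain z where "z \<in> Z (Suc n) \<inter> perp (insert (snd S) (fst S))" "norm z = 1"
      using infinite_cdim_perp[OF assms] by blast
    then show "\<exists>S'. I (Suc n) S' \<and> fst S' = insert (snd S) (fst S)"
      using \<open>finite (insert (snd S) (fst S))\<close>
      by (intro exI[of _ "(insert (snd S) (fst S), z)"]) (simp add: I_def)
  qed
  then obtain f where f: "\<And>n. I n (f n)" "\<And>n. fst (f (Suc n)) = insert (snd (f n)) (fst (f n))" by blast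
  define v where "v n = snd (f n)" for n
  have I: "norm (v n) = 1" "v n \<in> perp (fst (f n))" "v n \<in> Z n" for n
    using f(1)[of n] by (auto simp: I_def v_def split: prod.splits)
  have "fst (f n) = v ` {..<n}" for n
  proof (induction n)
    case 0 then show ?case using f(1)[of 0] by (auto simp: I_def split: prod.splits)
  qed (auto simp: f(2) v_def lessThan_Suc)
  then have "cinner (v n) (v i) = 0" if "i < n" for i n using perpD(1)[OF I(2)[of n]] that by auto
  then have "onseq v" using onseqI_less I(1) by blast
  then show ?thesis using I(3) by blast
qed

lemma riesz_system_onseq: "onseq w \<Longrightarrow> riesz_system w w (\<lambda>x. x) (\<lambda>x. x)"
  by (simp add: riesz_system_def bounded_clinear_ident)

lemma onseq_subseq: "onseq w \<Longrightarrow> inj s \<Longrightarrow> onseq (\<lambda>n. w (s n))"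
  by (auto simp: onseq_def inj_eq)

lemma has_two_sided_system_infinite_kernels:
  assumes A: "bounded_clinear A" and d: "\<And>n. d n > 0"
    and inf: "infinite_cdim {x. A x = 0}" "infinite_cdim {x. adj A x = 0}"
  shows "has_two_sided_system A d"
proof -
  have "\<exists>v. onseq v \<and> (\<forall>n::nat. v n \<in> (if even n then {x. A x = 0} else {x. adj A x = 0}))"
    using inf closed_csubspaceD(1)[OF closed_csubspace_kernel[OF A]]
      closed_csubspaceD(1)[OF closed_csubspace_kernel[OF bounded_clinear_adj[OF A]]]
    by (intro interlaced_onseq) auto
  then obtain v where v: "onseq v" "\<And>n. v n \<in> (if even n then {x. A x = 0} else {x. adj A x = 0})" by blast
  define x y where "x n = v (2 * n)" and "y n = v (2 * n + 1)" for n
  have xy1: "A (x n) = 0" "adj A (y n) = 0" for n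
    using v(2)[of "2 * n"] v(2)[of "2 * n + 1"] by (auto simp: x_def y_def)
  have xy2: "cinner (x n) (y k) = 0" for n k
  proof -
    have "2 * n \<noteq> 2 * k + 1" by presburger
    then show ?thesis using onseqD[OF v(1), of "2 * n" "2 * k + 1"] by (simp add: x_def y_def)
  qed
  note xy = xy1 xy2
  have on: "onseq x" "onseq y"
    using onseq_subseq[OF v(1), of "\<lambda>n. 2 * n"] onseq_subseq[OF v(1), of "\<lambda>n. 2 * n + 1"]
    by (auto simp: x_def[abs_def] y_def[abs_def] inj_def)
  have "two_sided_system A d 0 0 0 0 x (\<lambda>_. 0) (\<lambda>_. 0) y (\<lambda>_. 0) (\<lambda>_. 0) x y"
    unfolding two_sided_system_def coupled_def using xy d by (auto simp: cinner_adj[OF A] less_imp_le)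
  then show ?thesis unfolding has_two_sided_system_def using riesz_system_onseq[OF on(1)] riesz_system_onseq[OF on(2)] by blast
qed

text \<open>The Sherman-Morrison formula, whose denominator \<open>1 - cinner (R \<psi>) u\<close>
  is 1 here.\<close>

lemma regular_rank_one_perturbation:
  assumes A: "bounded_clinear A" and R: "bounded_clinear R" "\<And>x. A (R x) - \<nu> *\<^sub>C R x = x" "\<And>x. R (A x - \<nu> *\<^sub>C x) = x"
    and 0: "cinner (R \<psi>) u = 0"
  shows "regular (\<lambda>h. A h - cinner h u *\<^sub>C \<psi>) \<nu>"
  unfolding regular_def
proof (intro exI[of _ "\<lambda>w. R w + cinner (R w) u *\<^sub>C R \<psi>"] conjI allI)
  show "bounded_clinear (\<lambda>w. R w + cinner (R w) u *\<^sub>C R \<psi>)"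
    using bounded_clinear_plus[OF R(1) bounded_clinear_compose[OF bounded_clinear_rank1[of u "R \<psi>"] R(1)]] .
  have R2: "A (R x) = x + \<nu> *\<^sub>C R x" for x using R(2)[of x] by (simp add: algebra_simps)
  show "A (R w + cinner (R w) u *\<^sub>C R \<psi>) - cinner (R w + cinner (R w) u *\<^sub>C R \<psi>) u *\<^sub>C \<psi> -
      \<nu> *\<^sub>C (R w + cinner (R w) u *\<^sub>C R \<psi>) = w" for w
    by (simp add: clin_simps[OF A] R2 cinner_simps 0 scaleC_add_right scaleC_scaleC mult.commute)
  fix x
  have "R (A x - cinner x u *\<^sub>C \<psi> - \<nu> *\<^sub>C x) = R (A x - \<nu> *\<^sub>C x) - cinner x u *\<^sub>C R \<psi>"
    by (simp add: clin_simps[OF R(1)] algebra_simps)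
  then have eq: "R (A x - cinner x u *\<^sub>C \<psi> - \<nu> *\<^sub>C x) = x - cinner x u *\<^sub>C R \<psi>" by (simp add: R(3))
  show "R (A x - cinner x u *\<^sub>C \<psi> - \<nu> *\<^sub>C x) + cinner (R (A x - cinner x u *\<^sub>C \<psi> - \<nu> *\<^sub>C x)) u *\<^sub>C R \<psi> = x"
    unfolding eq by (simp add: cinner_simps 0)
qed

text \<open>\<open>\<psi>\<close> is chosen such that infinitely many of the resolvent vectors \<open>y\<^sub>n\<close> of \<open>adj A\<close> become
  eigenvectors of the adjoint of \<open>B = A - \<psi> \<otimes> u\<close>. Then \<open>B\<close> has eigenvectors as well, their
  closed span is a subspace on which \<open>B\<close> has dense range, and splitting the index set makes it
  orthogonal to infinitely many \<open>y\<^sub>n\<close>.\<close>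

lemma has_two_sided_system_of_dense_range:
  fixes A :: "'a::complex_hilbert_space \<Rightarrow> 'a" and f :: "nat \<Rightarrow> 'a"
  assumes A: "bounded_clinear A" and nr: "near_regular A" and W: "dense_range_subspace (adj A) W"
    and f: "closure (range f) = UNIV" and d: "\<And>n. d n > 0"
  shows "has_two_sided_system A d"
proof -

  \<comment> \<open>A resolvent orbit of the adjoint\<close>
  define C where "C = adj A"
  have C: "bounded_clinear C" and aC: "adj C = A" by (simp_all add: C_def bounded_clinear_adj A adj_adj)
  have nC: "\<not> regular C 0" using dense_range_subspace_not_regular[OF C] W by (simp add: C_def)
  \<comment> \<open>The constraint vector is 0 in this first use, so nothing is demanded; the
    generic vector obtained is the future \<open>u\<close>.\<close>
  obtain u where orb: "\<And>k::nat. \<exists>\<nu> x. cmod \<nu> < 1 / Suc k \<and> regular C \<nu> \<and> C x - \<nu> *\<^sub>C x = u \<and>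
      norm x > Suc k \<and> (\<forall>i\<le>k. Suc k * cmod (cinner x (f i)) < norm x)"
    using generic_resolvent_orbit[OF C _ near_regular_adj[OF A nr, folded C_def], of W 0 f] W
    by (auto simp: C_def)
  obtain \<nu> y where y: "\<And>n. regular C (\<nu> n)" "\<And>n. C (y n) = \<nu> n *\<^sub>C y n + u" "\<And>n. norm (y n) > Suc n"
    "\<And>n. cmod (\<nu> n) < 1 / Suc n" "\<And>m n. m < n \<Longrightarrow> cmod (\<nu> n) < cmod (\<nu> m)" "\<And>n. \<nu> n \<noteq> 0"
    "wnull (\<lambda>n. unitv (y n))"
    by (rule orbit_sequence[OF f nC orb]) (rule that, assumption+)
  have y0: "y n \<noteq> 0" for n using y(3)[of n] by auto
  have "u \<noteq> 0"
  proof
    assume "u = 0"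
    then have "C (y 0) = \<nu> 0 *\<^sub>C y 0" using y(2)[of 0] by simp
    then show False using regular_inj[OF y(1) _ C] y0 by blast
  qed
  \<comment> \<open>Thinning out until the norms exceed \<open>2 ^ n\<close> makes the reciprocals
    of the norms square summable, as the coefficients of \<open>\<psi>\<close> require.\<close>
  have ev: "eventually (\<lambda>k. 2 ^ n \<le> Suc k) sequentially" for n :: nat
    using eventually_ge_at_top[of "2 ^ n :: nat"] by eventually_elim simp
  obtain s w L L' where s: "strict_mono s" "\<And>n. 2 ^ n \<le> Suc (s n)" "w 0 = unitv u"
    and rs: "riesz_system (case_nat (unitv u) (\<lambda>n. unitv (y (s n)))) w L L'"
    by (rule riesz_system_exists[where P = "\<lambda>n k. 2 ^ n \<le> Suc k" and \<eta> = 1 and q = 0,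
          OF norm_unitv[OF y0] y(7) norm_unitv[OF \<open>u \<noteq> 0\<close>] ev zero_less_one]) (rule that, assumption+)

  \<comment> \<open>Construction of the rank one perturbation\<close>
  define Y N where "Y n = y (s n)" and "N n = \<nu> (s n)" for n
  \<comment> \<open>Index 0 belongs to \<open>u\<close> and gets 0, so that \<open>\<psi>\<close> is
    orthogonal to \<open>u\<close>. The other indices are split modulo 3. In classes 0 and 1 the
    pairing of \<open>\<psi>\<close> with \<open>Y j\<close> is 1, making the conjugate of
    \<open>N j\<close> an eigenvalue of the perturbed operator: class 0 supplies its eigenvectors,
    class 1 those of its adjoint. In class 2 the pairing is 0 and the point stays regular, so that 0
    remains a limit of regular points.\<close>
  define c where "c n = (case n of 0 \<Rightarrow> 0 | Suc j \<Rightarrow> if j mod 3 = 2 then 0 else complex_of_real (1 / norm (Y j)))" for n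
  have on: "onseq w" using rs by (simp add: riesz_system_def)
  have "cmod (c n) \<le> 2 * (1/2) ^ n" for n
  proof (cases n)
    case (Suc j)
    have "(2::real) ^ j \<le> Suc (s j)" using s(2)[of j] by (metis of_nat_le_iff of_nat_numeral of_nat_power)
    then have "2 ^ j \<le> norm (Y j)" using y(3)[of "s j"] by (simp add: Y_def)
    then have "1 / norm (Y j) \<le> 1 / 2 ^ j" by (intro frac_le) auto
    then show ?thesis by (simp add: Suc c_def norm_divide power_one_over)
  qed (simp add: c_def)
  then have "(cmod (c n))\<^sup>2 \<le> 4 * (1/4) ^ n" for n
  proof -
    have "(2 * (1/2) ^ n)\<^sup>2 = 4 * (1/2 * (1/2) :: real) ^ n" unfolding power2_eq_square power_mult_distrib by simp
    moreover have "(cmod (c n))\<^sup>2 \<le> (2 * (1/2) ^ n)\<^sup>2" using \<open>\<And>n. cmod (c n) \<le> _\<close> by (intro power_mono) auto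
    ultimately show ?thesis by simp
  qed
  note c_sq = this
  have "summable (\<lambda>n. (cmod (c n))\<^sup>2)"
  proof (rule summable_comparison_test)
    show "\<exists>M. \<forall>n\<ge>M. norm ((cmod (c n))\<^sup>2) \<le> 4 * (1/4) ^ n" using c_sq by simp
    show "summable (\<lambda>n. 4 * (1/4) ^ n :: real)" by (intro summable_mult summable_geometric) simp
  qed
  then obtain \<psi>0 where psi0: "\<And>k. cinner \<psi>0 (w k) = c k" using onseq_coefficients[OF on] by blast
  have L': "bounded_clinear L'" and LL: "\<And>h. L' (L h) = h"
    and Lw: "L (w 0) = unitv u" "\<And>n. L (w (Suc n)) = unitv (Y n)"
    using rs by (auto simp: riesz_system_def Y_def split: nat.splits)
  \<comment> \<open>The adjoint of the inverse turns coefficients against the orthonormal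
    \<open>w\<close> into coefficients against the vectors \<open>L (w k)\<close>.\<close>
  define \<psi> where "\<psi> = adj L' \<psi>0"
  have psi: "cinner \<psi> (L (w k)) = c k" for k
    using cinner_adj'[OF L', of \<psi>0 "L (w k)"] by (simp add: \<psi>_def LL psi0)
  have Y0: "Y j \<noteq> 0" for j using y0 by (simp add: Y_def)
  have psi_u: "cinner \<psi> u = 0"
    using psi[of 0] \<open>u \<noteq> 0\<close> by (simp add: Lw c_def unitv_def cinner_scaleC_right)
  have psi_Y: "cinner \<psi> (Y j) = (if j mod 3 = 2 then 0 else 1)" for j
    using psi[of "Suc j"] Y0[of j] by (simp add: Lw c_def unitv_def cinner_scaleC_right split: if_splits)
  have CY: "C (Y j) = N j *\<^sub>C Y j + u" for j using y(2) by (simp add: Y_def N_def)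
  have N0: "N j \<noteq> 0" for j using y(6) by (simp add: N_def)
  have N_small: "cmod (N j) < 1 / Suc j" for j
  proof -
    have "1 / real (Suc (s j)) \<le> 1 / real (Suc j)"
      using strict_mono_imp_increasing[OF s(1), of j] by (intro divide_left_mono) auto
    then show ?thesis using y(4)[of "s j"] by (simp add: N_def)
  qed
  have N_inj: "N i \<noteq> N j" if "i \<noteq> j" for i j
    using that y(5)[of "s i" "s j"] y(5)[of "s j" "s i"] strict_mono_less[OF s(1)]
    by (metis N_def linorder_neqE_nat order_less_irrefl)
  have Yn: "wnull (\<lambda>n. unitv (Y (t n)))" if t: "strict_mono t" for t
  proof -
    have "(\<lambda>n. cinner (unitv (y (s (t n)))) v) \<longlonglongrightarrow> 0" for v
      using LIMSEQ_subseq_LIMSEQ[of "\<lambda>n. cinner (unitv (y n)) v" 0 "s \<circ> t"] y(7) strict_mono_o[OF s(1) t]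
      by (auto simp: wnull_def o_def)
    then show ?thesis by (simp add: wnull_def Y_def)
  qed

  \<comment> \<open>Eigenvectors of the perturbed operator and of its adjoint\<close>
  define B where "B h = A h - cinner h u *\<^sub>C \<psi>" for h
  have B: "bounded_clinear B" unfolding B_def by (intro bounded_clinear_intros A)
  have BY: "cinner (B h) (Y j) = cnj (N j) * cinner h (Y j)" if "j mod 3 \<noteq> 2" for h j
    using that by (simp add: B_def cinner_simps cinner_adj[OF A] C_def[symmetric] CY psi_Y)
  define R where "R j = (SOME R. bounded_clinear R \<and> (\<forall>x. A (R x) - cnj (N j) *\<^sub>C R x = x) \<and>
    (\<forall>x. R (A x - cnj (N j) *\<^sub>C x) = x))" for j
  have R: "bounded_clinear (R j)" "\<And>x. A (R j x) - cnj (N j) *\<^sub>C R j x = x" "\<And>x. R j (A x - cnj (N j) *\<^sub>C x) = x" for j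
  proof -
    have "regular A (cnj (N j))" using regular_adj[OF C y(1)] by (simp add: aC N_def)
    from someI_ex[OF this[unfolded regular_def]]
    show "bounded_clinear (R j)" "\<And>x. A (R j x) - cnj (N j) *\<^sub>C R j x = x" "\<And>x. R j (A x - cnj (N j) *\<^sub>C x) = x"
      by (auto simp: R_def)
  qed
  \<comment> \<open>\<open>X j\<close> solves \<open>(A - cnj (N j)) X = \<psi>\<close>, and its
    pairing with \<open>u\<close> is that of \<open>\<psi>\<close> with \<open>Y j\<close>. If this
    is 1, the right side equals \<open>cinner X u *\<^sub>C \<psi>\<close>, which is exactly what
    \<open>B\<close> subtracts.\<close>
  define X where "X j = R j \<psi>" for j
  have X_u: "cinner (X j) u = cinner \<psi> (Y j)" for j
  proof -
    have "u = C (Y j) - N j *\<^sub>C Y j" by (simp add: CY)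
    then have "cinner (X j) u = cinner (A (X j) - cnj (N j) *\<^sub>C X j) (Y j)"
      by (simp add: cinner_simps C_def cinner_adj[OF A])
    then show ?thesis by (simp add: X_def R(2))
  qed
  have BX: "B (X j) = cnj (N j) *\<^sub>C X j" if "j mod 3 \<noteq> 2" for j
  proof -
    have "cinner (X j) u = 1" using X_u[of j] psi_Y[of j] that by simp
    moreover have "A (X j) - cnj (N j) *\<^sub>C X j = \<psi>" unfolding X_def by (rule R(2))
    then have "A (X j) = \<psi> + cnj (N j) *\<^sub>C X j" by (simp add: algebra_simps)
    ultimately show ?thesis by (simp add: B_def)
  qed
  have B_reg: "regular B (cnj (N j))" if "j mod 3 = 2" for j
    unfolding B_def using that X_u[of j] psi_Y[of j]
    by (intro regular_rank_one_perturbation[OF A R]) (simp add: X_def)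
  have "3 * i mod 3 \<noteq> (2::nat)" "(3 * i + 1) mod 3 \<noteq> (2::nat)" "(3 * i + 2) mod 3 = (2::nat)" for i
    by presburger+
  note mods = this
  have psi_Y0: "cinner \<psi> (Y (3 * i)) = 1" and psi_Y1: "cinner \<psi> (Y (3 * i + 1)) = 1" for i
    using psi_Y[of "3 * i"] psi_Y[of "3 * i + 1"] mods(1,2)[of i] by (simp_all only: if_False)
  have BX0: "B (X (3 * i)) = cnj (N (3 * i)) *\<^sub>C X (3 * i)" for i using BX mods(1) .
  have BY1: "cinner (B h) (Y (3 * i + 1)) = cnj (N (3 * i + 1)) * cinner h (Y (3 * i + 1))" for h i
    using BY mods(2) .
  have X_u0: "cinner (X (3 * i)) u = 1" for i using X_u[of "3 * i"] psi_Y0[of i] by (simp only:)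
  have nrB: "near_regular B"
    unfolding near_regular_def
  proof (intro allI impI)
    fix \<epsilon> :: real assume "\<epsilon> > 0"
    then obtain M where M: "1 / real (Suc M) < \<epsilon>" using nat_approx_posE by metis
    have "1 / real (Suc (3 * M + 2)) \<le> 1 / real (Suc M)" by (intro divide_left_mono) auto
    then have "cmod (cnj (N (3 * M + 2))) < \<epsilon>" using N_small[of "3 * M + 2"] M by (simp only: complex_mod_cnj)
    then show "\<exists>\<nu>. cmod \<nu> < \<epsilon> \<and> regular B \<nu>" using B_reg[OF mods(3)] by blast
  qed
  have X_nz: "X (3 * i) \<noteq> 0" for i using X_u0[of i] by auto
  \<comment> \<open>Eigenvectors of \<open>B\<close> and left eigenvectors of \<open>B\<close> for
    different eigenvalues are orthogonal; the classes 0 and 1 share no eigenvalue.\<close>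
  have XY: "cinner (X (3 * i)) (Y (3 * k + 1)) = 0" for i k
  proof -
    have "cnj (N (3 * i)) * cinner (X (3 * i)) (Y (3 * k + 1)) = cnj (N (3 * k + 1)) * cinner (X (3 * i)) (Y (3 * k + 1))"
      using BY1[of "X (3 * i)" k] BX0[of i] by (simp add: cinner_scaleC_left)
    moreover have "3 * i \<noteq> 3 * k + 1" by presburger
    then have "cnj (N (3 * i)) \<noteq> cnj (N (3 * k + 1))" using N_inj by simp
    ultimately show ?thesis by simp
  qed

  \<comment> \<open>The closed span of the eigenvectors, with dense range\<close>
  define W1 where "W1 = cls (range (\<lambda>i. X (3 * i)))"
  have W1: "closed_csubspace W1" unfolding W1_def by (rule closed_csubspace_cls)
  have XW: "X (3 * i) \<in> W1" for i unfolding W1_def by (rule subsetD[OF cls_superset]) (rule rangeI)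
  have BW1: "B h \<in> W1" if "h \<in> W1" for h
  proof -
    have "cls (range (\<lambda>i. X (3 * i))) \<subseteq> {h. B h \<in> W1}"
      by (rule cls_minimal[OF _ closed_csubspace_preimage[OF B W1]])
        (use XW BX0 in \<open>auto intro!: closed_csubspaceD[OF W1]\<close>)
    then show ?thesis using that unfolding W1_def by blast
  qed
  have dense: "W1 \<subseteq> closure (B ` W1)"
  proof -
    have M: "closed_csubspace (closure (B ` W1))"
      by (rule closed_csubspace_closure[OF csubspace_image[OF B closed_csubspaceD(1)[OF W1]]])
    have "X (3 * i) \<in> closure (B ` W1)" for i
    proof -
      have "X (3 * i) = B ((1 / cnj (N (3 * i))) *\<^sub>C X (3 * i))"
        using BX0[of i] N0[of "3 * i"] by (simp add: clin_simps[OF B] scaleC_scaleC)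
      then have "X (3 * i) \<in> B ` W1" by (rule image_eqI) (rule closed_csubspaceD(6)[OF W1 XW])
      then show ?thesis by (rule subsetD[OF closure_subset])
    qed
    then have "range (\<lambda>i. X (3 * i)) \<subseteq> closure (B ` W1)" by (rule image_subsetI)
    from cls_minimal[OF this M] show ?thesis by (simp only: W1_def)
  qed
  \<comment> \<open>\<open>CP\<close> would bound \<open>B\<close> below on \<open>W1\<close>, but
    \<open>W1\<close> contains eigenvectors with arbitrarily small eigenvalues.\<close>
  have "\<not> CP B W1"
  proof
    assume "CP B W1"
    then obtain c where c: "c > 0" "\<forall>x\<in>W1. c * norm x \<le> norm (B x)"
      using bounded_below_and_onto[OF B W1 BW1 dense] near_regular_inj[OF nrB B] by blast
    obtain M where M: "1 / real (Suc M) < c" using c(1) nat_approx_posE by metis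
    have "c * norm (X (3 * M)) \<le> norm (B (X (3 * M)))" using c(2) XW by blast
    also have "\<dots> = cmod (N (3 * M)) * norm (X (3 * M))" using BX0[of M] by (simp add: norm_scaleC)
    finally have "c \<le> cmod (N (3 * M))" using X_nz[of M] by simp
    also have "\<dots> < 1 / Suc (3 * M)" by (rule N_small)
    also have "\<dots> \<le> 1 / Suc M" by (intro divide_left_mono) auto
    finally show False using M by simp
  qed
  then have dr: "dense_range_subspace B W1" unfolding dense_range_subspace_def using W1 BW1 dense by blast
  have "cinner (B (X (3 * 0))) u \<noteq> 0"
    using BX0[of 0] X_u0[of 0] N0[of 0] by (simp add: cinner_scaleC_left)
  then have ucond: "u = 0 \<or> (\<exists>x\<in>W1. cinner (B x) u \<noteq> 0)" using XW by blast

  \<comment> \<open>The second resolvent orbit\<close>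
  obtain e where eW: "e \<in> W1" and eu: "cinner e u = 0" and
    orb2: "\<And>k::nat. \<exists>\<nu> x. cmod \<nu> < 1 / Suc k \<and> regular B \<nu> \<and> B x - \<nu> *\<^sub>C x = e \<and>
      norm x > Suc k \<and> (\<forall>i\<le>k. Suc k * cmod (cinner x (f i)) < norm x)"
    using generic_resolvent_orbit[OF B dr nrB ucond, of f] by blast
  obtain \<eta> \<xi> where xi: "\<And>n. regular B (\<eta> n)" "\<And>n. B (\<xi> n) = \<eta> n *\<^sub>C \<xi> n + e" "\<And>n. norm (\<xi> n) > Suc n"
    "\<And>n. cmod (\<eta> n) < 1 / Suc n" "wnull (\<lambda>n. unitv (\<xi> n))"
    by (rule orbit_sequence[OF f dense_range_subspace_not_regular[OF B dr] orb2]) (rule that, assumption+)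
  have xi0: "\<xi> n \<noteq> 0" for n using xi(3)[of n] by auto
  have eY: "cinner e (Y (3 * k + 1)) = 0" for k
  proof -
    have "cls (range (\<lambda>i. X (3 * i))) \<subseteq> perp {Y (3 * k + 1)}"
      by (rule cls_minimal[OF _ closed_csubspace_perp]) (use XY in \<open>auto simp: perp_def\<close>)
    then show ?thesis using eW by (auto simp: W1_def perp_def)
  qed
  have xiY: "cinner (\<xi> n) (Y (3 * k + 1)) = 0" for n k
  proof -
    define j where "j = 3 * k + 1"
    let ?Y = "Y j" and ?N = "cnj (N j)"
    have BYk: "cinner (B h) ?Y = ?N * cinner h ?Y" for h unfolding j_def by (rule BY1)
    have eYj: "cinner e ?Y = 0" unfolding j_def by (rule eY)
    \<comment> \<open>The range of \<open>B - ?N\<close> is orthogonal to \<open>?Y\<close>, so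
      \<open>?N\<close> is not regular, whereas \<open>\<eta> n\<close> is.\<close>
    have "\<eta> n \<noteq> ?N"
    proof
      assume eq: "\<eta> n = ?N"
      obtain h where "B h - \<eta> n *\<^sub>C h = ?Y" using xi(1)[of n] unfolding regular_def by blast
      then have "cinner ?Y ?Y = cinner (B h - ?N *\<^sub>C h) ?Y" using eq by simp
      also have "\<dots> = 0" by (simp add: cinner_simps BYk)
      finally show False using Y0 by simp
    qed
    moreover have "?N * cinner (\<xi> n) ?Y = \<eta> n * cinner (\<xi> n) ?Y"
      using BYk[of "\<xi> n"] xi(2)[of n] eYj by (auto simp: cinner_simps)
    ultimately show ?thesis unfolding j_def[symmetric] by simp
  qed

  \<comment> \<open>Subsequences close to orthonormal ones\<close>
  have small: "\<exists>M. 1 / real (Suc M) < \<epsilon>" if "\<epsilon> > 0" for \<epsilon> using that nat_approx_posE by metis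
  obtain i0 where i0: "1 / real (Suc i0) < d 0" using small[OF d] by blast
  have i0': "cmod (N (3 * i0)) \<le> d 0" "cmod (N (3 * i0 + 1)) \<le> d 0"
  proof -
    have "1 / real (Suc (3 * i0)) \<le> 1 / real (Suc i0)" "1 / real (Suc (3 * i0 + 1)) \<le> 1 / real (Suc i0)"
      by (intro divide_left_mono; simp)+
    then show "cmod (N (3 * i0)) \<le> d 0" "cmod (N (3 * i0 + 1)) \<le> d 0"
      using N_small[of "3 * i0"] N_small[of "3 * i0 + 1"] i0 by linarith+
  qed
  have ev_small: "eventually (\<lambda>k. 1 / real (Suc k) < \<epsilon>) sequentially" if "\<epsilon> > 0" for \<epsilon>
    using order_tendstoD(2)[OF LIMSEQ_inverse_real_of_nat that] by (simp add: inverse_eq_divide)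
  \<comment> \<open>An exact eigenvector is placed at index 0 because its pairing with
    \<open>u\<close> is known to be nonzero; for the orbit \<open>\<xi>\<close> this is not known.
    \<open>i0\<close> is so large that its eigenvalue obeys \<open>d 0\<close>.\<close>
  let ?p = "unitv (X (3 * i0))"
  have pu: "cinner ?p u \<noteq> 0"
    using X_nz[of i0] X_u0[of i0] by (simp add: unitv_def cinner_scaleC_left)
  \<comment> \<open>The part of \<open>e\<close> orthogonal to \<open>?p\<close>. It is nonzero,
    since \<open>e\<close> is orthogonal to \<open>u\<close> and \<open>?p\<close> is not.\<close>
  define q where "q = e - cinner e ?p *\<^sub>C ?p"
  have "e \<noteq> 0"
  proof
    assume "e = 0"
    then have "B (\<xi> 0) = \<eta> 0 *\<^sub>C \<xi> 0" using xi(2)[of 0] by simp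
    then show False using regular_inj[OF xi(1) _ B] xi0 by blast
  qed
  have "q \<noteq> 0"
  proof
    assume "q = 0"
    then have e_eq: "e = cinner e ?p *\<^sub>C ?p" by (simp add: q_def)
    then have "cinner e ?p * cinner ?p u = 0" using eu by (metis cinner_scaleC_left)
    then have "cinner e ?p = 0" using pu by simp
    then show False using e_eq \<open>e \<noteq> 0\<close> by simp
  qed
  have ev1: "eventually (\<lambda>k. cmod (\<eta> k) \<le> d (Suc n)) sequentially" for n
    using ev_small[OF d[of "Suc n"]]
    by eventually_elim (use xi(4) in \<open>meson less_imp_le less_trans\<close>)
  have qpos: "norm q > 0" using \<open>q \<noteq> 0\<close> by simp
  obtain s1 wx Lx Lx' where s1: "strict_mono s1" "\<And>n. cmod (\<eta> (s1 n)) \<le> d (Suc n)" "wx 0 = ?p"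
    and rx: "riesz_system (case_nat ?p (\<lambda>n. unitv (\<xi> (s1 n)))) wx Lx Lx'"
    and qx: "\<And>n. cmod (cinner q (wx (Suc n))) \<le> norm q * (1/2) ^ (n + 2)"
    by (rule riesz_system_exists[where P = "\<lambda>n k. cmod (\<eta> k) \<le> d (Suc n)" and \<eta> = "norm q" and q = q,
          OF norm_unitv[OF xi0] xi(5) norm_unitv[OF X_nz[of i0]] ev1 qpos]) (rule that, assumption+)
  have ev2: "eventually (\<lambda>k. cmod (N (3 * k + 1)) \<le> d (Suc n)) sequentially" for n
    using ev_small[OF d[of "Suc n"]]
  proof eventually_elim
    case (elim k)
    have "1 / real (Suc (3 * k + 1)) \<le> 1 / real (Suc k)" by (intro divide_left_mono) auto
    then show ?case using N_small[of "3 * k + 1"] elim by linarith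
  qed
  have sm3: "strict_mono (\<lambda>n::nat. 3 * n + 1)" by (simp add: strict_mono_def)
  obtain s2 wy Ly Ly' where s2: "strict_mono s2" "\<And>n. cmod (N (3 * s2 n + 1)) \<le> d (Suc n)"
    and ry: "riesz_system (case_nat (unitv (Y (3 * i0 + 1))) (\<lambda>n. unitv (Y (3 * s2 n + 1)))) wy Ly Ly'"
    by (rule riesz_system_exists[where P = "\<lambda>n k. cmod (N (3 * k + 1)) \<le> d (Suc n)" and \<eta> = 1 and q = 0
          and g = "\<lambda>n. unitv (Y (3 * n + 1))",
          OF norm_unitv[OF Y0] Yn[OF sm3] norm_unitv[OF Y0[of "3 * i0 + 1"]] ev2 zero_less_one])
      (rule that, assumption+)
  \<comment> \<open>If \<open>e\<close> were in the span, so would be \<open>q\<close>; but its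
    expansion has no term at index 0 and the remaining coefficients add up to at most half of
    \<open>norm q\<close>.\<close>
  have e_notin: "e \<notin> cls (range wx)"
  proof
    assume e: "e \<in> cls (range wx)"
    note M = closed_csubspace_cls[of "range wx"]
    have onx: "onseq wx" using rx by (simp add: riesz_system_def)
    have p: "?p \<in> cls (range wx)" using cls_superset[of "range wx"] s1(3) by (metis rangeI subsetD)
    have q: "q \<in> cls (range wx)" unfolding q_def using e p by (intro closed_csubspaceD[OF M])
    have "cinner q ?p = 0"
      using norm_unitv[OF X_nz[of i0]] by (simp add: q_def cinner_simps cinner_self)
    then have q0: "cinner q (wx 0) = 0" by (simp add: s1(3))
    note ex = onseq_expansion[OF onx q]
    have bd: "norm (cinner q (wx (Suc n)) *\<^sub>C wx (Suc n)) \<le> norm q * (1/2) ^ (n + 2)" for n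
      using qx[of n] by (simp add: norm_scaleC onseq_norm[OF onx])
    have sg: "summable (\<lambda>n. norm q * (1/2) ^ (n + 2))"
      unfolding power_add by (intro summable_mult summable_mult2 summable_geometric) auto
    have "q = (\<Sum>n. cinner q (wx (Suc n)) *\<^sub>C wx (Suc n))"
      using ex(1) suminf_split_head[OF ex(2)] q0 by simp
    then have "norm q = norm (\<Sum>n. cinner q (wx (Suc n)) *\<^sub>C wx (Suc n))" by simp
    also have "\<dots> \<le> (\<Sum>n. norm q * (1/2) ^ (n + 2))"
      by (rule order_trans[OF summable_norm suminf_le[OF bd _ sg]])
        (use bd in \<open>auto intro!: summable_comparison_test[OF _ sg]\<close>)
    also have "\<dots> = norm q * ((\<Sum>n. (1/2) ^ n) * (1/2)^2)"
      unfolding power_add by (subst suminf_mult) (auto simp: suminf_mult2 summable_geometric intro!: summable_mult2)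
    also have "\<dots> = norm q * (1/2)" by (simp add: suminf_geometric power2_eq_square)
    finally show False using \<open>q \<noteq> 0\<close> by simp
  qed
  let ?x = "case_nat ?p (\<lambda>n. unitv (\<xi> (s1 n)))" and ?lam = "case_nat (cnj (N (3 * i0))) (\<lambda>n. \<eta> (s1 n))"
    and ?a = "case_nat 0 (\<lambda>n. complex_of_real (1 / norm (\<xi> (s1 n))))"
    and ?y = "case_nat (unitv (Y (3 * i0 + 1))) (\<lambda>n. unitv (Y (3 * s2 n + 1)))"
    and ?mu = "case_nat (cnj (N (3 * i0 + 1))) (\<lambda>n. cnj (N (3 * s2 n + 1)))"
  have A_eq: "A h = B h + cinner h u *\<^sub>C \<psi>" for h by (simp add: B_def)
  have AY: "cinner (A h) (unitv (Y (3 * k + 1))) = cnj (N (3 * k + 1)) * cinner h (unitv (Y (3 * k + 1))) +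
      cinner h u * cinner \<psi> (unitv (Y (3 * k + 1)))" for h k
    using BY1[of h k] by (simp add: A_eq unitv_def cinner_simps algebra_simps)
  \<comment> \<open>The vector \<open>m\<close> is 0 here: on this side the \<open>y\<close> are
    exact eigenvectors of the adjoint of \<open>B\<close>.\<close>
  have "two_sided_system A d \<psi> u e 0 ?x ?lam ?a ?y ?mu (\<lambda>_. 0) wx wy"
    unfolding two_sided_system_def coupled_def
  proof (intro conjI allI)
    fix n k h
    show "A (?x n) = ?lam n *\<^sub>C ?x n + ?a n *\<^sub>C e + cinner (?x n) u *\<^sub>C \<psi>"
      using BX0[of i0] xi(2)
      by (cases n) (simp_all add: A_eq unitv_def clin_simps[OF B] scaleC_add_right scaleC_scaleC mult.commute)
    show "cinner (A h) (?y k) = ?mu k * cinner h (?y k) + cnj 0 * cinner h 0 + cinner h u * cinner \<psi> (?y k)"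
      using AY[of h i0] AY[of h] by (cases k) simp_all
    have "cinner (unitv g) (unitv (Y (3 * j + 1))) = 0" if "cinner g (Y (3 * j + 1)) = 0" for g j
      using that by (simp add: unitv_def cinner_simps)
    then show "cinner (?x n) (?y k) = 0"
      using XY xiY by (cases n; cases k) simp_all
    show "cinner e (?y k) = 0"
      using eY[of i0] eY by (cases k) (simp_all add: unitv_def cinner_scaleC_right)
    show "cmod (?lam n) \<le> d n" using i0' s1(2) by (cases n) simp_all
    show "cmod (?mu k) \<le> d k" using i0' s2(2) by (cases k) simp_all
    show "\<psi> = 0 \<or> cinner \<psi> (?y 0) \<noteq> 0"
      using psi_Y1[of i0] Y0[of "3 * i0 + 1"] by (simp add: unitv_def cinner_scaleC_right)
  qed (use e_notin pu psi_u eu in auto)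
  then show ?thesis unfolding has_two_sided_system_def using rx ry by blast
qed

text \<open>All cases but that of two infinite dimensional kernels reduce, by passing to the adjoint
  if necessary, to a dense range subspace of the adjoint.\<close>

lemma has_two_sided_system_of_near_regular:
  fixes A :: "'a::complex_hilbert_space \<Rightarrow> 'a" and f :: "nat \<Rightarrow> 'a"
  assumes A: "bounded_clinear A" and nr: "near_regular A" and nz: "\<not> riesz_point A"
    and f: "closure (range f) = UNIV" and d: "\<And>n. d n > 0"
  shows "has_two_sided_system A d"
proof -
  note aA = bounded_clinear_adj[OF A]
  have main: "has_two_sided_system C d"
    if C: "bounded_clinear C" "near_regular C" "\<not> riesz_point C" and fin: "\<not> infinite_cdim {x. C x = 0}" for C :: "'a \<Rightarrow> 'a"
    using dense_range_subspace_cases[OF C fin]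
  proof (elim disjE exE)
    fix W assume "dense_range_subspace (adj C) W"
    then show ?thesis using has_two_sided_system_of_dense_range[where d = d, OF C(1,2) _ f d] by blast
  next
    fix W assume "dense_range_subspace C W"
    then have "has_two_sided_system (adj C) d"
      using has_two_sided_system_of_dense_range[where d = d, OF bounded_clinear_adj[OF C(1)] near_regular_adj[OF C(1,2)] _ f d]
        adj_adj[OF C(1)] by metis
    then show ?thesis using has_two_sided_system_adj[OF bounded_clinear_adj[OF C(1)]] adj_adj[OF C(1)] by metis
  qed
  consider "\<not> infinite_cdim {x. A x = 0}" | "\<not> infinite_cdim {x. adj A x = 0}"
    | "infinite_cdim {x. A x = 0}" "infinite_cdim {x. adj A x = 0}" by blast
  then show ?thesis
  proof cases
    case 1 then show ?thesis by (rule main[OF A nr nz])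
  next
    case 2
    have "\<not> riesz_point (adj A)" using riesz_point_of_adj[OF A nr] nz by blast
    from main[OF aA near_regular_adj[OF A nr] this 2] show ?thesis
      using has_two_sided_system_adj[OF aA] adj_adj[OF A] by metis
  next
    case 3 then show ?thesis by (rule has_two_sided_system_infinite_kernels[where d = d, OF A d])
  qed
qed

section \<open>Straightening a two-sided system by similarities\<close>

definition inverse_pair where
  "inverse_pair S S' \<longleftrightarrow> bounded_clinear S \<and> bounded_clinear S' \<and> (\<forall>x. S (S' x) = x) \<and> (\<forall>x. S' (S x) = x)"

lemma inverse_pair_trans:
  "inverse_pair S S' \<Longrightarrow> inverse_pair R R' \<Longrightarrow> inverse_pair (\<lambda>x. S (R x)) (\<lambda>x. R' (S' x))"
  unfolding inverse_pair_def by (simp add: bounded_clinear_compose)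

lemma inverse_pair_adj:
  fixes S :: "'a::complex_hilbert_space \<Rightarrow> 'a"
  assumes "inverse_pair S S'"
  shows "inverse_pair (adj S') (adj S)"
proof -
  have S: "bounded_clinear S" "bounded_clinear S'" "\<And>x. S (S' x) = x" "\<And>x. S' (S x) = x"
    using assms by (auto simp: inverse_pair_def)
  have "adj S' (adj S x) = x" for x
    by (rule cinner_ext_right) (simp add: cinner_adj[OF S(2), symmetric] cinner_adj[OF S(1), symmetric] S)
  moreover have "adj S (adj S' x) = x" for x
    by (rule cinner_ext_right) (simp add: cinner_adj[OF S(2), symmetric] cinner_adj[OF S(1), symmetric] S)
  ultimately show ?thesis unfolding inverse_pair_def using S by (simp add: bounded_clinear_adj)
qed

lemma cinner_inverse_pair: "inverse_pair S S' \<Longrightarrow> cinner (S' p) (adj S q) = cinner p q"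
  unfolding inverse_pair_def using cinner_adj[of S "S' p" q] by simp

text \<open>Vectors (\<open>x\<close>, \<open>e\<close>, \<open>\<psi>\<close>) move by
  \<open>S'\<close> and functionals (\<open>y\<close>, \<open>m\<close>, \<open>u\<close>) by the
  adjoint of \<open>S\<close>, so all pairings between the two kinds are kept.\<close>

lemma coupled_similar:
  assumes S: "inverse_pair S S'" and C: "coupled A \<psi> u e m x l a y \<mu> b"
  shows "coupled (\<lambda>h. S' (A (S h))) (S' \<psi>) (adj S u) (S' e) (adj S m) (\<lambda>n. S' (x n)) l a (\<lambda>k. adj S (y k)) \<mu> b"
proof -
  have S': "bounded_clinear S" "bounded_clinear S'" "\<And>x. S (S' x) = x" "\<And>x. S' (S x) = x"
    using S by (auto simp: inverse_pair_def)
  note inv = cinner_inverse_pair[OF S]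
  have adjS: "cinner h (adj S q) = cinner (S h) q" for h q using cinner_adj[OF S'(1)] by simp
  show ?thesis
    using C unfolding coupled_def by (simp add: inv S' clin_simps[OF S'(2)] adjS)
qed

definition transvection :: "'a::complex_hilbert_space \<Rightarrow> 'a \<Rightarrow> 'a \<Rightarrow> 'a"
  where "transvection v z h = h + cinner h z *\<^sub>C v"

lemma bounded_clinear_transvection: "bounded_clinear (transvection v z)"
  unfolding transvection_def by (intro bounded_clinear_intros)

lemma inverse_pair_transvection:
  "cinner v z = 0 \<Longrightarrow> inverse_pair (transvection (- v) z) (transvection v z)"
  unfolding inverse_pair_def
  by (auto simp: bounded_clinear_transvection transvection_def cinner_simps)

lemma adj_transvection: "adj (transvection v z) = transvection z v"
proof (rule adj_eqI_fun[OF bounded_clinear_transvection])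
  fix x y
  have "cinner v y = cnj (cinner y v)" by (rule cinner_commute)
  then show "cinner (transvection v z x) y = cinner x (transvection z v y)"
    by (simp add: transvection_def cinner_simps mult.commute)
qed

text \<open>As \<open>z\<close> is orthogonal to all \<open>x n\<close> and \<open>v\<close> to all
  \<open>y k\<close>, both sequences stay put and only the four coupling vectors move.\<close>

lemma coupled_transvection:
  assumes "coupled A \<psi> u e m x l a y \<mu> b" "cinner v z = 0" "\<And>n. cinner (x n) z = 0" "\<And>k. cinner (y k) v = 0"
  shows "coupled (\<lambda>h. transvection v z (A (transvection (- v) z h))) (\<psi> + cinner \<psi> z *\<^sub>C v) (u - cinner u v *\<^sub>C z)
    (e + cinner e z *\<^sub>C v) (m - cinner m v *\<^sub>C z) x l a y \<mu> b"
proof -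
  have *: "adj (transvection (- v) z) h = h - cinner h v *\<^sub>C z" for h
    by (simp add: adj_transvection transvection_def cinner_minus_right)
  have "transvection v z h = h + cinner h z *\<^sub>C v" for h by (simp add: transvection_def)
  note ** = this
  show ?thesis
    using coupled_similar[OF inverse_pair_transvection[OF assms(2)] assms(1)] assms(3,4)
    unfolding * by (simp add: **[of "x _"] **[of \<psi>] **[of e])
qed

lemma cls_orth:
  assumes "\<And>x y. x \<in> X \<Longrightarrow> y \<in> Y \<Longrightarrow> cinner x y = 0" "x \<in> cls X" "y \<in> cls Y"
  shows "cinner x y = 0"
proof -
  have "X \<subseteq> perp Y" using assms(1) by (auto simp: perp_def)
  then have "cls X \<subseteq> perp (cls Y)" unfolding perp_cls by (rule cls_minimal[OF _ closed_csubspace_perp])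
  then show ?thesis using perpD(1) assms(2,3) by blast
qed

text \<open>Together with the orthogonality relations in \<open>coupled\<close>, this puts
  \<open>e\<close> and \<open>m\<close> into the middle subspace, \<open>u\<close> into the first
  and \<open>\<psi>\<close> into the third.\<close>

definition straight where
  "straight A \<psi> u e m p l a q \<mu> b \<longleftrightarrow> coupled A \<psi> u e m p l a q \<mu> b \<and>
    e \<in> perp (range p) \<and> m \<in> perp (range q) \<and> u \<in> cls (range p) \<and> \<psi> \<in> cls (range q)"

text \<open>The vectors are corrected in the order \<open>e\<close>, \<open>u\<close>,
  \<open>\<psi>\<close>, \<open>m\<close>. The first transvection also moves \<open>u\<close> and
  \<open>\<psi>\<close>, the second \<open>\<psi>\<close>, the third \<open>m\<close>, but none
  moves a vector already corrected, and the conditions needed for the remaining ones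
  survive.\<close>

lemma straighten:
  assumes A: "bounded_clinear A" and C: "coupled A \<psi> u e m p l a q \<mu> b"
    and e: "e = 0 \<or> e \<notin> cls (range p)" and m: "m = 0 \<or> m \<notin> cls (range q)"
    and u: "u = 0 \<or> cinner (p 0) u \<noteq> 0" and \<psi>: "\<psi> = 0 \<or> cinner \<psi> (q 0) \<noteq> 0"
  shows "\<exists>S S' \<psi>' u' e' m'. inverse_pair S S' \<and> straight (\<lambda>h. S' (A (S h))) \<psi>' u' e' m' p l a q \<mu> b"
proof -
  define M1 M3 where "M1 = cls (range p)" and "M3 = cls (range q)"
  have M: "closed_csubspace M1" "closed_csubspace M3" by (simp_all add: M1_def M3_def closed_csubspace_cls)
  have pM: "p n \<in> M1" and qM: "q n \<in> M3" for n
    unfolding M1_def M3_def by (rule subsetD[OF cls_superset rangeI])+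
  have M13: "cinner x y = 0" "cinner y x = 0" if "x \<in> M1" "y \<in> M3" for x y
  proof -
    have "cinner g h = 0" if "g \<in> range p" "h \<in> range q" for g h
      using that C by (auto simp: coupled_def)
    then show *: "cinner x y = 0" by (rule cls_orth[OF _ that[unfolded M1_def M3_def]])
    then show "cinner y x = 0" by (rule cinner_eq_0_commute[THEN iffD1])
  qed
  have orth1: "cinner x z = 0" if h: "\<And>n. cinner (p n) z = 0" and x: "x \<in> M1" for x z
  proof (rule cls_orth)
    show "x \<in> cls (range p)" using x by (simp add: M1_def)
    show "z \<in> cls {z}" by (rule subsetD[OF cls_superset singletonI])
    show "cinner g w = 0" if "g \<in> range p" "w \<in> {z}" for g w using that h by auto
  qed
  have orth3: "cinner z y = 0" if h: "\<And>n. cinner z (q n) = 0" and y: "y \<in> M3" for y z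
  proof (rule cls_orth)
    show "y \<in> cls (range q)" using y by (simp add: M3_def)
    show "z \<in> cls {z}" by (rule subsetD[OF cls_superset singletonI])
    show "cinner w g = 0" if "g \<in> range q" "w \<in> {z}" for g w using that h by auto
  qed
  have sq: "cinner x x \<noteq> 0" if "x \<noteq> 0" for x :: 'a using that by simp
  define sim where "sim A' \<longleftrightarrow> (\<exists>S S'. inverse_pair S S' \<and> A' = (\<lambda>h. S' (A (S h))))" for A' :: "'a \<Rightarrow> 'a"
  have sim_tv: "sim (\<lambda>h. transvection v z (A' (transvection (- v) z h)))" if "sim A'" "cinner v z = 0" for A' v z
  proof -
    obtain S S' where S: "inverse_pair S S'" "A' = (\<lambda>h. S' (A (S h)))" using \<open>sim A'\<close> by (auto simp: sim_def)
    show ?thesis unfolding sim_def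
      using inverse_pair_trans[OF S(1) inverse_pair_transvection[OF that(2)]] S(2) by blast
  qed
  have "inverse_pair (\<lambda>x. x) (\<lambda>x::'a. x)" by (simp add: inverse_pair_def bounded_clinear_ident)
  then have sim0: "sim A" unfolding sim_def by blast
  have "\<exists>A' \<psi>' u' e'. sim A' \<and> coupled A' \<psi>' u' e' m p l a q \<mu> b \<and> (\<forall>x\<in>M1. cinner e' x = 0) \<and>
     (u' = 0 \<or> cinner (p 0) u' \<noteq> 0) \<and> (\<psi>' = 0 \<or> cinner \<psi>' (q 0) \<noteq> 0)"
  proof (cases "e = 0")
    case True then show ?thesis using sim0 C u \<psi> by fastforce
  next
    case False
    \<comment> \<open>\<open>z\<close> is scaled so that \<open>e\<close> pairs with it to 1; then
      the transvection removes exactly \<open>e1\<close>. Its effects on \<open>u\<close> and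
      \<open>\<psi>\<close> are invisible to \<open>p 0\<close> and \<open>q 0\<close>.\<close>
    define e1 e2 where "e1 = orth_proj M1 e" and "e2 = e - e1"
    have e1: "e1 \<in> M1" by (simp add: e1_def orth_proj_in M)
    have e2o: "cinner e2 x = 0" "cinner x e2 = 0" if "x \<in> M1" for x
      using that orth_proj_orth[OF M(1)] orth_proj_orth_left[OF M(1)] by (auto simp: e2_def e1_def)
    have "e2 \<noteq> 0" using e False e1 by (auto simp: e2_def M1_def)
    define z where "z = (1 / cnj (cinner e2 e2)) *\<^sub>C e2"
    have vz: "cinner (- e1) z = 0" using e2o(2)[OF e1] by (simp add: z_def cinner_simps)
    have mz: "cinner m (- e1) = 0"
    proof -
      have "cinner e1 m = 0" by (rule orth1[OF _ e1]) (use C in \<open>simp add: coupled_def\<close>)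
      then show ?thesis using cinner_eq_0_commute by (auto simp: cinner_simps)
    qed
    have "cinner e z = cinner e2 z" using e2o(2)[OF e1] by (simp add: e2_def cinner_simps z_def)
    then have "cinner e z = 1" using \<open>e2 \<noteq> 0\<close> by (simp add: z_def cinner_scaleC_right)
    then have ee: "e + cinner e z *\<^sub>C (- e1) = e2" by (simp add: e2_def)
    have "coupled (\<lambda>h. transvection (- e1) z (A (transvection (- (- e1)) z h))) (\<psi> + cinner \<psi> z *\<^sub>C (- e1))
        (u - cinner u (- e1) *\<^sub>C z) (e + cinner e z *\<^sub>C (- e1)) (m - cinner m (- e1) *\<^sub>C z) p l a q \<mu> b"
    proof (rule coupled_transvection[OF C vz])
      show "cinner (p n) z = 0" for n using e2o(2)[OF pM] by (simp add: z_def cinner_scaleC_right)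
      show "cinner (q k) (- e1) = 0" for k using M13(2)[OF e1 qM] by (simp add: cinner_simps)
    qed
    then have "coupled (\<lambda>h. transvection (- e1) z (A (transvection (- (- e1)) z h))) (\<psi> + cinner \<psi> z *\<^sub>C (- e1))
        (u - cinner u (- e1) *\<^sub>C z) e2 m p l a q \<mu> b"
      unfolding ee mz by simp
    moreover have "u = 0 \<or> cinner (p 0) (u - cinner u (- e1) *\<^sub>C z) \<noteq> 0"
      using u e2o(2)[OF pM] by (simp add: cinner_simps z_def)
    then have "u - cinner u (- e1) *\<^sub>C z = 0 \<or> cinner (p 0) (u - cinner u (- e1) *\<^sub>C z) \<noteq> 0" by auto
    moreover have "\<psi> = 0 \<or> cinner (\<psi> + cinner \<psi> z *\<^sub>C (- e1)) (q 0) \<noteq> 0"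
      using \<psi> M13(1)[OF e1 qM] by (simp add: cinner_simps)
    then have "\<psi> + cinner \<psi> z *\<^sub>C (- e1) = 0 \<or> cinner (\<psi> + cinner \<psi> z *\<^sub>C (- e1)) (q 0) \<noteq> 0" by auto
    ultimately show ?thesis using sim_tv[OF sim0 vz] e2o(1) by blast
  qed
  then obtain A1 \<psi>1 u1 e1 where S1: "sim A1" "coupled A1 \<psi>1 u1 e1 m p l a q \<mu> b" "\<And>x. x \<in> M1 \<Longrightarrow> cinner e1 x = 0"
    "u1 = 0 \<or> cinner (p 0) u1 \<noteq> 0" "\<psi>1 = 0 \<or> cinner \<psi>1 (q 0) \<noteq> 0"
    by blast
  have "\<exists>A' \<psi>' u'. sim A' \<and> coupled A' \<psi>' u' e1 m p l a q \<mu> b \<and> u' \<in> M1 \<and> (\<psi>' = 0 \<or> cinner \<psi>' (q 0) \<noteq> 0)"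
  proof (cases "u1 = 0")
    case True then show ?thesis using S1 closed_csubspaceD(3)[OF M(1)] by blast
  next
    case False
    \<comment> \<open>\<open>u1\<close> becomes its projection \<open>c\<close>. The change of
      \<open>\<psi>1\<close> lies in \<open>M1\<close>, hence is orthogonal to \<open>q 0\<close>;
      both \<open>u1\<close> and \<open>c\<close> are orthogonal to \<open>e1\<close>, which
      therefore stays.\<close>
    define c where "c = orth_proj M1 u1"
    define z where "z = u1 - c"
    have c: "c \<in> M1" by (simp add: c_def orth_proj_in M)
    have zo: "cinner z x = 0" "cinner x z = 0" if "x \<in> M1" for x
      using that orth_proj_orth[OF M(1)] orth_proj_orth_left[OF M(1)] by (auto simp: z_def c_def)
    have "cinner (p 0) c \<noteq> 0" using zo(2)[OF pM, of 0] S1(4) False by (simp add: z_def cinner_simps)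
    then have "c \<noteq> 0" by auto
    define v where "v = (1 / cnj (cinner c c)) *\<^sub>C c"
    have vM: "v \<in> M1" using c by (simp add: v_def closed_csubspaceD[OF M(1)])
    have "cinner u1 v = cinner c v" using zo(1)[OF vM] by (simp add: z_def cinner_simps)
    then have "cinner u1 v = 1" using \<open>c \<noteq> 0\<close> by (simp add: v_def cinner_scaleC_right)
    then have uu: "u1 - cinner u1 v *\<^sub>C z = c" by (simp add: z_def)
    have "cinner e1 z = 0" using S1(2) S1(3)[OF c] by (simp add: coupled_def z_def cinner_simps)
    then have ee: "e1 + cinner e1 z *\<^sub>C v = e1" by simp
    have "cinner v m = 0" by (rule orth1[OF _ vM]) (use C in \<open>simp add: coupled_def\<close>)
    then have "cinner m v = 0" using cinner_eq_0_commute by blast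
    then have mm: "m - cinner m v *\<^sub>C z = m" by simp
    have "coupled (\<lambda>h. transvection v z (A1 (transvection (- v) z h))) (\<psi>1 + cinner \<psi>1 z *\<^sub>C v)
        (u1 - cinner u1 v *\<^sub>C z) (e1 + cinner e1 z *\<^sub>C v) (m - cinner m v *\<^sub>C z) p l a q \<mu> b"
      by (rule coupled_transvection[OF S1(2) zo(2)[OF vM] zo(2)[OF pM] M13(2)[OF vM qM]])
    then have "coupled (\<lambda>h. transvection v z (A1 (transvection (- v) z h))) (\<psi>1 + cinner \<psi>1 z *\<^sub>C v) c e1 m p l a q \<mu> b"
      unfolding uu ee mm .
    moreover have "\<psi>1 = 0 \<or> cinner (\<psi>1 + cinner \<psi>1 z *\<^sub>C v) (q 0) \<noteq> 0"
      using S1(5) M13(1)[OF vM qM] by (simp add: cinner_simps)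
    then have "\<psi>1 + cinner \<psi>1 z *\<^sub>C v = 0 \<or> cinner (\<psi>1 + cinner \<psi>1 z *\<^sub>C v) (q 0) \<noteq> 0" by auto
    ultimately show ?thesis using sim_tv[OF S1(1) zo(2)[OF vM]] c by blast
  qed
  then obtain A2 \<psi>2 u2 where S2: "sim A2" "coupled A2 \<psi>2 u2 e1 m p l a q \<mu> b" "u2 \<in> M1"
    "\<psi>2 = 0 \<or> cinner \<psi>2 (q 0) \<noteq> 0"
    by blast
  have e3: "cinner e1 y = 0" if "y \<in> M3" for y by (rule orth3[OF _ that]) (use S1(2) in \<open>simp add: coupled_def\<close>)
  have "\<exists>A' \<psi>' m'. sim A' \<and> coupled A' \<psi>' u2 e1 m' p l a q \<mu> b \<and> \<psi>' \<in> M3 \<and> (m' = 0 \<or> m' \<notin> M3)"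
  proof (cases "\<psi>2 = 0")
    case True then show ?thesis using S2 m closed_csubspaceD(3)[OF M(2)] by (metis M3_def)
  next
    case False
    \<comment> \<open>\<open>\<psi>2\<close> becomes its projection \<open>c\<close>. The vector
      \<open>m\<close> changes by an element of \<open>M3\<close> and so remains outside
      \<open>M3\<close>.\<close>
    define c where "c = orth_proj M3 \<psi>2"
    define v where "v = - (\<psi>2 - c)"
    have c: "c \<in> M3" by (simp add: c_def orth_proj_in M)
    have vo: "cinner v x = 0" "cinner x v = 0" if "x \<in> M3" for x
      using that orth_proj_orth[OF M(2)] orth_proj_orth_left[OF M(2)]
      by (simp_all add: v_def c_def cinner_minus_left cinner_minus_right del: minus_diff_eq)
    have "cinner c (q 0) = cinner \<psi>2 (q 0)" using vo(1)[OF qM, of 0] by (simp add: v_def cinner_simps)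
    then have "c \<noteq> 0" using S2(4) False by auto
    define z where "z = (1 / cnj (cinner c c)) *\<^sub>C c"
    have zM: "z \<in> M3" using c by (simp add: z_def closed_csubspaceD[OF M(2)])
    have "cinner \<psi>2 z = cinner c z" using vo(1)[OF zM] by (simp add: v_def cinner_simps)
    then have "cinner \<psi>2 z = 1" using \<open>c \<noteq> 0\<close> by (simp add: z_def cinner_scaleC_right)
    then have pp: "\<psi>2 + cinner \<psi>2 z *\<^sub>C v = c" by (simp add: v_def)
    have "cinner u2 \<psi>2 = 0" using S2(2) cinner_eq_0_commute by (auto simp: coupled_def)
    then have "cinner u2 v = 0" using M13(1)[OF S2(3) c] by (simp add: v_def cinner_simps)
    then have uu: "u2 - cinner u2 v *\<^sub>C z = u2" by simp
    have ee: "e1 + cinner e1 z *\<^sub>C v = e1" using e3[OF zM] by simp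
    have "coupled (\<lambda>h. transvection v z (A2 (transvection (- v) z h))) (\<psi>2 + cinner \<psi>2 z *\<^sub>C v)
        (u2 - cinner u2 v *\<^sub>C z) (e1 + cinner e1 z *\<^sub>C v) (m - cinner m v *\<^sub>C z) p l a q \<mu> b"
      by (rule coupled_transvection[OF S2(2) vo(1)[OF zM] M13(1)[OF pM zM] vo(2)[OF qM]])
    then have "coupled (\<lambda>h. transvection v z (A2 (transvection (- v) z h))) c u2 e1 (m - cinner m v *\<^sub>C z) p l a q \<mu> b"
      unfolding pp uu ee .
    moreover have "m - cinner m v *\<^sub>C z = 0 \<or> m - cinner m v *\<^sub>C z \<notin> M3"
    proof (cases "m = 0")
      case False
      have "m \<in> M3" if "m - cinner m v *\<^sub>C z \<in> M3"
        using closed_csubspaceD(4)[OF M(2) that closed_csubspaceD(6)[OF M(2) zM, of "cinner m v"]] by simp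
      then show ?thesis using m False by (auto simp: M3_def)
    qed simp
    ultimately show ?thesis using sim_tv[OF S2(1) vo(1)[OF zM]] c by blast
  qed
  then obtain A3 \<psi>3 m3 where S3: "sim A3" "coupled A3 \<psi>3 u2 e1 m3 p l a q \<mu> b" "\<psi>3 \<in> M3" "m3 = 0 \<or> m3 \<notin> M3"
    by blast
  have "\<exists>A' m'. sim A' \<and> coupled A' \<psi>3 u2 e1 m' p l a q \<mu> b \<and> (\<forall>y\<in>M3. cinner m' y = 0)"
  proof (cases "m3 = 0")
    case True then show ?thesis using S3 by (intro exI[of _ A3] exI[of _ 0]) simp
  next
    case False
    \<comment> \<open>\<open>m3\<close> loses its component \<open>z\<close> in \<open>M3\<close>.
      The vector \<open>\<psi>3\<close> is orthogonal to \<open>m3\<close> and to \<open>c\<close>,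
      hence to \<open>z\<close>, and is not moved.\<close>
    define z where "z = orth_proj M3 m3"
    define c where "c = m3 - z"
    have zM: "z \<in> M3" by (simp add: z_def orth_proj_in M)
    have co: "cinner c x = 0" "cinner x c = 0" if "x \<in> M3" for x
      using that orth_proj_orth[OF M(2)] orth_proj_orth_left[OF M(2)] by (auto simp: c_def z_def)
    have "c \<noteq> 0" using S3(4) False zM by (auto simp: c_def)
    define v where "v = (1 / cnj (cinner c c)) *\<^sub>C c"
    have vo: "cinner v x = 0" "cinner x v = 0" if "x \<in> M3" for x
      using co[OF that] by (simp_all add: v_def cinner_simps)
    have "cinner m3 v = cinner c v" using vo(2)[OF zM] by (simp add: c_def cinner_simps)
    then have "cinner m3 v = 1" using \<open>c \<noteq> 0\<close> by (simp add: v_def cinner_scaleC_right)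
    then have mm: "m3 - cinner m3 v *\<^sub>C z = c" by (simp add: c_def)
    have "cinner \<psi>3 z = 0" using S3(2) co(2)[OF S3(3)] by (simp add: coupled_def c_def cinner_simps)
    then have pp: "\<psi>3 + cinner \<psi>3 z *\<^sub>C v = \<psi>3" by simp
    have ee: "e1 + cinner e1 z *\<^sub>C v = e1" using e3[OF zM] by simp
    have "cinner u2 m3 = 0" by (rule orth1[OF _ S2(3)]) (use S3(2) in \<open>simp add: coupled_def\<close>)
    then have "cinner u2 v = 0" using M13(1)[OF S2(3) zM] by (simp add: v_def c_def cinner_simps)
    then have uu: "u2 - cinner u2 v *\<^sub>C z = u2" by simp
    have "coupled (\<lambda>h. transvection v z (A3 (transvection (- v) z h))) (\<psi>3 + cinner \<psi>3 z *\<^sub>C v)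
        (u2 - cinner u2 v *\<^sub>C z) (e1 + cinner e1 z *\<^sub>C v) (m3 - cinner m3 v *\<^sub>C z) p l a q \<mu> b"
      by (rule coupled_transvection[OF S3(2) vo(1)[OF zM] M13(1)[OF pM zM] vo(2)[OF qM]])
    then have "coupled (\<lambda>h. transvection v z (A3 (transvection (- v) z h))) \<psi>3 u2 e1 c p l a q \<mu> b"
      unfolding pp uu ee mm .
    then show ?thesis using sim_tv[OF S3(1) vo(1)[OF zM]] co(1) by blast
  qed
  then obtain A4 m4 where S4: "sim A4" "coupled A4 \<psi>3 u2 e1 m4 p l a q \<mu> b" "\<And>y. y \<in> M3 \<Longrightarrow> cinner m4 y = 0"
    by blast
  have "straight A4 \<psi>3 u2 e1 m4 p l a q \<mu> b"
    unfolding straight_def using S4 S2(3) S3(3) S1(3) pM qM by (auto simp: perp_def M1_def M3_def)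
  then show ?thesis using S4(1) unfolding sim_def by blast
qed

lemma riesz_system_cls:
  assumes "riesz_system x w L L'" shows "cls (range w) \<subseteq> cls (range x)"
proof
  fix z assume z: "z \<in> cls (range w)"
  have L: "bounded_clinear L" "\<And>h. L (L' h) = h" "\<And>n. L (w n) = x n" "L' z \<in> cls (range w)"
    using assms z by (auto simp: riesz_system_def)
  have "cls (range w) \<subseteq> {h. L h \<in> cls (range x)}"
    by (rule cls_minimal[OF _ closed_csubspace_preimage[OF L(1) closed_csubspace_cls]])
      (use L(3) cls_superset[of "range x"] in auto)
  then show "z \<in> cls (range x)" using L(2,4) by fastforce
qed

text \<open>\<open>L\<close> and \<open>L'\<close> are block diagonal for the closed span of
  \<open>w\<close> and its complement, with the identity on the latter; adjoints have the same
  shape.\<close>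

lemma riesz_system_adj_fixes:
  assumes R: "riesz_system x w L L'" and h: "h \<in> perp (range w)"
  shows "adj L h = h" "adj L' h = h"
proof -
  have L: "bounded_clinear L" "bounded_clinear L'" "\<And>h. L' (L h) = h"
    "\<And>h. h \<in> perp (range w) \<Longrightarrow> L h = h" "\<And>h. h \<in> cls (range w) \<Longrightarrow> L h \<in> cls (range w)"
    "\<And>h. h \<in> cls (range w) \<Longrightarrow> L' h \<in> cls (range w)"
    using R by (auto simp: riesz_system_def)
  have h': "cinner y h = 0" if "y \<in> cls (range w)" for y
    using h that perpD(2)[of h "cls (range w)"] by (simp add: perp_cls)
  have "adj K h = h" if K: "bounded_clinear K" "\<And>h. h \<in> perp (range w) \<Longrightarrow> K h = h"
    "\<And>h. h \<in> cls (range w) \<Longrightarrow> K h \<in> cls (range w)" for K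
  proof (rule adj_eqI[OF K(1)])
    fix z
    define z1 where "z1 = orth_proj (cls (range w)) z"
    have z1: "z1 \<in> cls (range w)" by (simp add: z1_def orth_proj_in closed_csubspace_cls)
    have z2: "z - z1 \<in> perp (range w)"
      using orth_proj_perp[OF closed_csubspace_cls, of z "range w"] by (simp add: z1_def perp_cls)
    have "K z = K z1 + (z - z1)" using K(2)[OF z2] by (simp add: clin_simps[OF K(1)] algebra_simps)
    then show "cinner (K z) h = cinner z h" using h' z1 K(3)[OF z1] by (simp add: cinner_simps)
  qed
  from this[OF L(1,4,5)] this[OF L(2) _ L(6)] L(3,4) show "adj L h = h" "adj L' h = h" by metis+
qed

text \<open>The two Riesz systems live in orthogonal spans, and each straightening map and its
  adjoint fix the other span. So a single similarity makes both sequences orthonormal, one by its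
  inverse and the other by its adjoint.\<close>

lemma has_straight_form:
  fixes A :: "'a::complex_hilbert_space \<Rightarrow> 'a"
  assumes A: "bounded_clinear A" and H: "has_two_sided_system A d"
  shows "\<exists>(S :: 'a \<Rightarrow> 'a) S' \<psi> u e m p l a q \<mu> b r. inverse_pair S S' \<and> straight (\<lambda>h. S' (A (S h))) \<psi> u e m p l a q \<mu> b \<and>
    onseq p \<and> onseq q \<and> onseq r \<and> (\<forall>n k. cinner (r n) (p k) = 0) \<and> (\<forall>n k. cinner (r n) (q k) = 0) \<and>
    (\<forall>n. cmod (l n) \<le> d (2 * n)) \<and> (\<forall>n. cmod (\<mu> n) \<le> d n)"
proof -
  obtain \<psi> u e m x l a y \<mu> b wx wy Lx Lx' Ly Ly' where
    T: "two_sided_system A d \<psi> u e m x l a y \<mu> b wx wy" and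
    R: "riesz_system x wx Lx Lx'" "riesz_system y wy Ly Ly'"
    using H unfolding has_two_sided_system_def by blast
  have C: "coupled A \<psi> u e m x l a y \<mu> b" using T by (simp add: two_sided_system_def coupled_def)
  have Lx: "inverse_pair Lx Lx'" "\<And>n. Lx (wx n) = x n" "onseq wx"
    "\<And>h. h \<in> cls (range wx) \<Longrightarrow> Lx h \<in> cls (range wx)"
    using R(1) by (auto simp: riesz_system_def inverse_pair_def)
  have Ly: "inverse_pair Ly Ly'" "\<And>n. Ly (wy n) = y n" "onseq wy"
    "\<And>h. h \<in> cls (range wy) \<Longrightarrow> Ly h \<in> cls (range wy)"
    using R(2) by (auto simp: riesz_system_def inverse_pair_def)
  note Lx' = Lx(1)[unfolded inverse_pair_def] and Ly' = Ly(1)[unfolded inverse_pair_def]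
  have wxy: "cinner g h = 0" "cinner h g = 0" if "g \<in> cls (range wx)" "h \<in> cls (range wy)" for g h
  proof -
    show *: "cinner g h = 0"
      by (rule cls_orth[of "range x" "range y"])
        (use C riesz_system_cls[OF R(1)] riesz_system_cls[OF R(2)] that in \<open>auto simp: coupled_def\<close>)
    from * show "cinner h g = 0" by (rule cinner_eq_0_commute[THEN iffD1])
  qed
  have wM: "wx n \<in> cls (range wx)" "wy n \<in> cls (range wy)" for n
    by (rule subsetD[OF cls_superset rangeI])+
  have xM: "x n \<in> cls (range wx)" "y n \<in> cls (range wy)" for n
    using Lx(4)[OF wM(1)] Ly(4)[OF wM(2)] by (simp_all add: Lx(2) Ly(2))
  have px: "g \<in> perp (range wy)" if "g \<in> cls (range wx)" for g using wxy(1)[OF that wM(2)] by (auto simp: perp_def)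
  have py: "g \<in> perp (range wx)" if "g \<in> cls (range wy)" for g using wxy(2)[OF wM(1) that] by (auto simp: perp_def)
  define S S' where "S h = Lx (adj Ly' h)" and "S' h = adj Ly (Lx' h)" for h
  have S: "inverse_pair S S'"
    using inverse_pair_trans[OF Lx(1) inverse_pair_adj[OF Ly(1)]]
    unfolding S_def[abs_def] S'_def[abs_def] .
  have Sb: "bounded_clinear S" "bounded_clinear S'" "\<And>x. S (S' x) = x" "\<And>x. S' (S x) = x"
    using S by (auto simp: inverse_pair_def)
  have adjS: "adj S h = Ly' (adj Lx h)" for h
  proof (rule adj_eqI)
    show "bounded_clinear S" using S by (simp add: inverse_pair_def)
    show "cinner (S g) h = cinner g (Ly' (adj Lx h))" for g
      using Lx' Ly' by (simp add: S_def cinner_adj bounded_clinear_adj adj_adj)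
  qed
  have Sx: "S' (x n) = wx n" for n
  proof -
    have "Lx' (x n) = wx n" using Lx' Lx(2) by metis
    then show ?thesis using riesz_system_adj_fixes(1)[OF R(2) px[OF wM(1)]] by (simp add: S'_def)
  qed
  have Sy: "adj S (y n) = wy n" for n
    using riesz_system_adj_fixes(1)[OF R(1) py[OF xM(2)]] Ly' Ly(2) by (metis adjS)
  have Sin: "S h = Lx h" if "h \<in> cls (range wx)" for h
    using riesz_system_adj_fixes(2)[OF R(2) px[OF that]] by (simp add: S_def)
  have C1: "coupled (\<lambda>h. S' (A (S h))) (S' \<psi>) (adj S u) (S' e) (adj S m) wx l a wy \<mu> b"
    using coupled_similar[OF S C] by (simp add: Sx Sy)
  \<comment> \<open>Only every second vector is kept, including index 0, whose pairing with
    \<open>u\<close> matters; the omitted ones, \<open>r\<close>, will make the middle subspace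
    infinite dimensional. This is why \<open>l\<close> is bounded by
    \<open>d (2 * n)\<close>.\<close>
  define p where "p n = wx (2 * n)" for n
  define r where "r n = wx (2 * n + 1)" for n
  have C2: "coupled (\<lambda>h. S' (A (S h))) (S' \<psi>) (adj S u) (S' e) (adj S m) p (\<lambda>n. l (2 * n)) (\<lambda>n. a (2 * n)) wy \<mu> b"
    using C1 by (simp add: coupled_def p_def)
  have pw: "cls (range p) \<subseteq> cls (range wx)"
    by (rule cls_minimal[OF _ closed_csubspace_cls]) (use wM in \<open>auto simp: p_def\<close>)
  have "S' e = 0 \<or> S' e \<notin> cls (range p)"
  proof (cases "e = 0")
    case True then show ?thesis using bounded_clinear_zero_right[OF Sb(2)] by simp
  next
    case False
    have "e \<in> cls (range wx)" if "S' e \<in> cls (range wx)"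
      using Sin[OF that] Lx(4)[OF that] by (simp add: Sb)
    then show ?thesis using T False pw by (auto simp: two_sided_system_def coupled_def)
  qed
  moreover have "adj S m = 0 \<or> adj S m \<notin> cls (range wy)"
  proof (cases "m = 0")
    case True
    then show ?thesis using bounded_clinear_zero_right[OF bounded_clinear_adj[OF Sb(1)]] by simp
  next
    case False
    have "m \<in> cls (range wy)" if "adj S m \<in> cls (range wy)"
    proof -
      have "Ly (adj S m) = adj Lx m" using Ly' by (simp add: adjS)
      then have *: "adj Lx m \<in> cls (range wy)" using Ly(4)[OF that] by simp
      have "adj Lx' (adj Lx m) = m" using inverse_pair_adj[OF Lx(1)] by (simp add: inverse_pair_def)
      then show ?thesis using riesz_system_adj_fixes(2)[OF R(1) py[OF *]] * by simp
    qed
    then show ?thesis using T False by (auto simp: two_sided_system_def coupled_def)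
  qed
  moreover have "adj S u = 0 \<or> cinner (p 0) (adj S u) \<noteq> 0"
  proof (cases "u = 0")
    case True
    then show ?thesis using bounded_clinear_zero_right[OF bounded_clinear_adj[OF Sb(1)]] by simp
  next
    case False
    have "cinner (p 0) (adj S u) = cinner (x 0) u"
      using cinner_inverse_pair[OF S, of "x 0" u] by (simp add: p_def Sx)
    then show ?thesis using T False by (simp add: two_sided_system_def coupled_def)
  qed
  moreover have "S' \<psi> = 0 \<or> cinner (S' \<psi>) (wy 0) \<noteq> 0"
  proof (cases "\<psi> = 0")
    case True then show ?thesis using bounded_clinear_zero_right[OF Sb(2)] by simp
  next
    case False
    have "cinner (S' \<psi>) (wy 0) = cinner \<psi> (y 0)"
      using cinner_inverse_pair[OF S, of \<psi> "y 0"] by (simp add: Sy)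
    then show ?thesis using T False by (simp add: two_sided_system_def coupled_def)
  qed
  moreover have "bounded_clinear (\<lambda>h. S' (A (S h)))"
    by (rule bounded_clinear_compose[OF Sb(2) bounded_clinear_compose[OF A Sb(1)]])
  ultimately obtain P P' \<psi>' u' e' m' where P: "inverse_pair P P'"
    "straight (\<lambda>h. P' (S' (A (S (P h))))) \<psi>' u' e' m' p (\<lambda>n. l (2 * n)) (\<lambda>n. a (2 * n)) wy \<mu> b"
    using straighten[OF _ C2] by blast
  have "onseq p" "onseq r"
    using onseq_subseq[OF Lx(3), of "\<lambda>n. 2 * n"] onseq_subseq[OF Lx(3), of "\<lambda>n. 2 * n + 1"]
    by (auto simp: p_def[abs_def] r_def[abs_def] inj_def)
  moreover have "cinner (r n) (p k) = 0" for n k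
  proof -
    have "2 * n + 1 \<noteq> 2 * k" by presburger
    then show ?thesis using onseqD[OF Lx(3), of "2 * n + 1" "2 * k"] by (simp add: p_def r_def)
  qed
  moreover have "cinner (r n) (wy k) = 0" for n k unfolding r_def by (rule wxy(1)[OF wM])
  moreover have "cmod (l (2 * n)) \<le> d (2 * n)" "cmod (\<mu> n) \<le> d n" for n
    using T by (auto simp: two_sided_system_def coupled_def)
  ultimately show ?thesis
    using inverse_pair_trans[OF S P(1)] P(2) Ly(3)
    apply -
    apply (rule exI[of _ "\<lambda>x. S (P x)"], rule exI[of _ "\<lambda>x. P' (S' x)"])
    apply (rule exI[of _ \<psi>'], rule exI[of _ u'], rule exI[of _ e'], rule exI[of _ m'], rule exI[of _ p])
    apply (rule exI[of _ "\<lambda>n. l (2 * n)"], rule exI[of _ "\<lambda>n. a (2 * n)"], rule exI[of _ wy], rule exI[of _ \<mu>], rule exI[of _ b], rule exI[of _ r])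
    by simp
qed

section \<open>Orthonormal bases and diagonal operators in an ideal\<close>

text \<open>Gram-Schmidt on a dense sequence. When the next member is already in the span, an
  arbitrary new unit vector is inserted, which infinite dimension provides, so the sequence never
  ends.\<close>

lemma exists_orthonormal_basis:
  fixes f :: "nat \<Rightarrow> 'a::complex_hilbert_space"
  assumes f: "closure (range f) = UNIV" and inf: "infinite_cdim (UNIV :: 'a set)"
  shows "\<exists>h :: nat \<Rightarrow> 'a. onseq h \<and> cls (range h) = UNIV"
proof -
  have step: "\<exists>r. norm r = 1 \<and> r \<in> perp F \<and> g \<in> cls (insert r F)" if F: "finite F" for F and g :: 'a
  proof -
    define y where "y = orth_proj (cls F) g"
    have F': "cls F \<subseteq> cls (insert r F)" for r
      by (rule cls_minimal[OF order_trans[OF subset_insertI cls_superset] closed_csubspace_cls])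
    have y: "y \<in> cls F" by (simp add: y_def orth_proj_in closed_csubspace_cls)
    have gy: "g - y \<in> perp F"
      using orth_proj_perp[OF closed_csubspace_cls, of g F] by (simp add: y_def perp_cls)
    show ?thesis
    proof (cases "g = y")
      case True
      obtain r where "r \<in> UNIV \<inter> perp F" "norm r = 1"
        using infinite_cdim_perp[OF complex_vector.subspace_UNIV inf F] by auto
      then show ?thesis using y True F' by auto
    next
      case False
      let ?r = "unitv (g - y)"
      have "complex_of_real (norm (g - y)) *\<^sub>C ?r = g - y"
        using False by (simp add: unitv_def scaleC_scaleC)
      moreover have "complex_of_real (norm (g - y)) *\<^sub>C ?r \<in> cls (insert ?r F)"
        by (intro closed_csubspaceD(6)[OF closed_csubspace_cls] subsetD[OF cls_superset]) simp
      ultimately have "g - y + y \<in> cls (insert ?r F)"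
        using subsetD[OF F' y] by (intro closed_csubspaceD(4)[OF closed_csubspace_cls]) auto
      moreover have "?r \<in> perp F"
        unfolding unitv_def by (rule closed_csubspaceD(6)[OF closed_csubspace_perp gy])
      ultimately show ?thesis using norm_unitv[of "g - y"] False by auto
    qed
  qed
  have "\<exists>h. \<forall>n. norm (h n) = 1 \<and> h n \<in> perp (h ` {..<n}) \<and> f n \<in> cls (insert (h n) (h ` {..<n}))"
  proof (rule dependent_wellorder_choice[where P = "\<lambda>h n r. norm r = 1 \<and> r \<in> perp (h ` {..<n}) \<and>
      f n \<in> cls (insert r (h ` {..<n}))"])
    show "(norm r = 1 \<and> r \<in> perp (h ` {..<n}) \<and> f n \<in> cls (insert r (h ` {..<n}))) =
        (norm r = 1 \<and> r \<in> perp (g ` {..<n}) \<and> f n \<in> cls (insert r (g ` {..<n})))"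
      if "\<And>y. y < n \<Longrightarrow> h y = g y" for r h g n
    proof -
      have "h ` {..<n} = g ` {..<n}" using that by (intro image_cong) auto
      then show ?thesis by simp
    qed
  qed (rule step, simp)
  then obtain h where h: "\<And>n. norm (h n) = 1" "\<And>n. h n \<in> perp (h ` {..<n})"
    "\<And>n. f n \<in> cls (insert (h n) (h ` {..<n}))" by blast
  have "onseq h"
  proof (rule onseqI_less)
    show "cinner (h n) (h i) = 0" if "i < n" for i n
      by (rule perpD(1)[OF h(2)]) (use that in auto)
  qed (rule h)
  moreover have "f n \<in> cls (range h)" for n
  proof -
    have "cls (insert (h n) (h ` {..<n})) \<subseteq> cls (range h)"
      by (rule cls_minimal[OF order_trans[OF _ cls_superset] closed_csubspace_cls]) auto
    then show ?thesis using h(3) by (rule subsetD)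
  qed
  then have "closure (range f) \<subseteq> cls (range h)"
    by (intro closure_minimal closed_csubspaceD(2)[OF closed_csubspace_cls]) auto
  ultimately show ?thesis using f by auto
qed

lemma hilbert_iso_onto_diagop:
  assumes h: "onseq h" "cls (range h) = UNIV" and p: "onseq p"
  shows "hilbert_iso_onto (diagop (\<lambda>n. 1) h p) (cls (range p))"
proof -
  define U V where "U = diagop (\<lambda>n. 1) h p" and "V = diagop (\<lambda>n. 1) p h"
  have one: "cmod ((\<lambda>n. 1) n) \<le> 1" for n :: nat by simp
  note bU = bounded_clinear_diagop[OF h(1) p one, folded U_def]
    and bV = bounded_clinear_diagop[OF p h(1) one, folded V_def]
  have cU: "cinner (U x) (p k) = cinner x (h k)" for x k
    using cinner_diagop[OF h(1) p one] by (simp add: U_def)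
  have cV: "cinner (V x) (h k) = cinner x (p k)" for x k
    using cinner_diagop[OF p h(1) one] by (simp add: V_def)
  have Up: "U x \<in> cls (range p)" for x using diagop_in_cls[OF h(1) p one] by (simp add: U_def)
  have VU: "V (U x) = x" for x
    by (rule cls_eqI[where F = "range h"]) (auto simp: h(2) cU cV)
  have UV: "U (V z) = z" if "z \<in> cls (range p)" for z
    by (rule cls_eqI[OF Up that]) (auto simp: cU cV)
  have "cinner (U x) (U y) = cinner x y" for x y
  proof -
    \<comment> \<open>\<open>V\<close> inverts \<open>U\<close>, and on the closed span of
      \<open>p\<close> the vectors \<open>U x\<close> and \<open>adj V x\<close> have the same
      pairings; hence \<open>U\<close> preserves inner products.\<close>
    have "range p \<subseteq> perp {U x - adj V x}"
    proof (clarsimp simp: perp_def cinner_eq_0_commute[of "p _"])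
      fix k
      have "V (p k) = h k" using diagop_basis[OF p h(1) one] by (simp add: V_def scaleC_one)
      then have "cinner (adj V x) (p k) = cinner x (h k)" using cinner_adj'[OF bV, of x "p k"] by simp
      then show "cinner (U x - adj V x) (p k) = 0" by (simp add: cU cinner_simps)
    qed
    then have "cls (range p) \<subseteq> perp {U x - adj V x}" by (rule cls_minimal[OF _ closed_csubspace_perp])
    then have "U y \<in> perp {U x - adj V x}" using Up by (rule subsetD)
    then have "cinner (U x - adj V x) (U y) = 0" by (rule perpD(2)) simp
    then have "cinner (U x) (U y) = cinner (adj V x) (U y)" by (simp add: cinner_simps)
    also have "\<dots> = cinner x y" using cinner_adj'[OF bV, of x "U y"] by (simp add: VU)
    finally show ?thesis .
  qed
  moreover have "range U = cls (range p)" using Up UV by (metis (no_types) image_subset_iff rangeI subsetI subset_antisym)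
  ultimately show ?thesis
    using bU unfolding hilbert_iso_onto_def bounded_clinear_def U_def by blast
qed

lemma finite_rank_if_vanishes_on_perp:
  assumes Q: "bounded_clinear Q" and F: "finite F" and 0: "\<And>x. x \<in> perp F \<Longrightarrow> Q x = 0"
  shows "Q \<in> \<F>"
proof -
  note M = closed_csubspace_cls[of F]
  have "cls F \<inter> perp F \<subseteq> {0}"
  proof
    fix x assume "x \<in> cls F \<inter> perp F"
    then have "cinner x x = 0" using perpD(1)[of x "cls F" x] by (simp add: perp_cls)
    then show "x \<in> {0}" by simp
  qed
  then obtain B where B: "finite B" "cls F \<subseteq> cspan B"
    using finite_dim_of_perp[OF F closed_csubspaceD(1)[OF M]] by blast
  have "csubspace {x. Q x \<in> cspan (Q ` B)}"
    unfolding csubspace_iff by (auto simp: clin_simps[OF Q] complex_vector.span_zero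
        complex_vector.span_add complex_vector.span_scale)
  moreover have "B \<subseteq> {x. Q x \<in> cspan (Q ` B)}" by (auto intro: complex_vector.span_base)
  ultimately have "cspan B \<subseteq> {x. Q x \<in> cspan (Q ` B)}" by (intro complex_vector.span_minimal)
  moreover have "Q x = Q (orth_proj (cls F) x)" for x
    using 0[of "x - orth_proj (cls F) x"] orth_proj_perp[OF M, of x]
    by (simp add: perp_cls clin_simps[OF Q])
  ultimately have "Q ` UNIV \<subseteq> cspan (Q ` B)"
    using B(2) orth_proj_in[OF M] by (metis (no_types, lifting) image_subsetI mem_Collect_eq subsetD)
  then have "rank_le (card (Q ` B)) UNIV Q" unfolding rank_le_def using B(1) by blast
  then show ?thesis using Q by (auto simp: finite_rank_operators_def bounded_operators_def)
qed

text \<open>An operator that is not of finite rank is nonzero on every \<open>perp F\<close>, so the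
  choice of \<open>v\<close> never stops. The diagonal operator then factors as
  \<open>Y Q X\<close>, where \<open>X\<close> carries \<open>h\<close> to \<open>v\<close> and
  \<open>Y\<close> carries the normalized \<open>Q (v n)\<close> back to \<open>h n\<close> with
  weight \<open>c n / t n\<close> of modulus at most 1.\<close>

lemma diagonal_operators_in_ideal:
  fixes h :: "nat \<Rightarrow> 'a::complex_hilbert_space"
  assumes h: "onseq h" "cls (range h) = UNIV" and J: "ideal J \<L>" and Q: "Q \<in> J" "Q \<notin> \<F>"
  shows "\<exists>d. (\<forall>n. d n > (0::real)) \<and> (\<forall>c. (\<forall>n. cmod (c n) \<le> d n) \<longrightarrow> diagop c h h \<in> J)"
proof -
  have carr: "A \<in> carrier \<L> \<longleftrightarrow> bounded_clinear A" for A :: "'a \<Rightarrow> 'a" by (simp add: bounded_operators_def)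
  have bQ: "bounded_clinear Q" using ideal.Icarr[OF J Q(1)] carr by simp
  have step: "\<exists>r. norm r = 1 \<and> r \<in> perp F \<and> Q r \<noteq> 0" if F: "finite F" for F
  proof -
    obtain x where x: "x \<in> perp F" "Q x \<noteq> 0"
      using finite_rank_if_vanishes_on_perp[OF bQ F] Q(2) by blast
    then have "x \<noteq> 0" using bounded_clinear_zero_right[OF bQ] by auto
    have "unitv x \<in> perp F"
      unfolding unitv_def by (rule closed_csubspaceD(6)[OF closed_csubspace_perp x(1)])
    moreover have "Q (unitv x) \<noteq> 0"
      using x(2) \<open>x \<noteq> 0\<close> by (simp add: unitv_def clin_simps[OF bQ])
    ultimately show ?thesis using norm_unitv[OF \<open>x \<noteq> 0\<close>] by blast
  qed
  \<comment> \<open>Orthogonality to \<open>adj Q (Q (v i))\<close> is what makes the images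
    \<open>Q (v n)\<close> orthogonal to each other.\<close>
  let ?G = "\<lambda>(v :: nat \<Rightarrow> 'a) n. v ` {..<n} \<union> (\<lambda>i. adj Q (Q (v i))) ` {..<n}"
  have "\<exists>v. \<forall>n. norm (v n) = 1 \<and> v n \<in> perp (?G v n) \<and> Q (v n) \<noteq> 0"
  proof (rule dependent_wellorder_choice[where P = "\<lambda>v n r. norm r = 1 \<and> r \<in> perp (?G v n) \<and> Q r \<noteq> 0"])
    show "(norm r = 1 \<and> r \<in> perp (?G v n) \<and> Q r \<noteq> 0) = (norm r = 1 \<and> r \<in> perp (?G w n) \<and> Q r \<noteq> 0)"
      if "\<And>y. y < n \<Longrightarrow> v y = w y" for r v w n
    proof -
      have "?G v n = ?G w n" using that by (intro arg_cong2[where f = union] image_cong) auto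
      then show ?thesis by simp
    qed
  qed (rule step, simp)
  then obtain v where v: "\<And>n. norm (v n) = 1" "\<And>n. v n \<in> perp (?G v n)" "\<And>n. Q (v n) \<noteq> 0" by blast
  have v_on: "onseq v"
    by (rule onseqI_less[OF v(1)]) (rule perpD(1)[OF v(2)], auto)
  define t where "t n = norm (Q (v n))" for n
  have t: "t n > 0" for n using v(3) by (simp add: t_def)
  define g where "g n = unitv (Q (v n))" for n
  have Qv: "Q (v n) = complex_of_real (t n) *\<^sub>C g n" for n
    using v(3) by (simp add: g_def t_def unitv_def scaleC_scaleC)
  have g: "onseq g"
  proof (rule onseqI_less)
    show "norm (g n) = 1" for n unfolding g_def by (rule norm_unitv[OF v(3)])
    fix i n :: nat assume "i < n"
    then have "cinner (v n) (adj Q (Q (v i))) = 0" by (intro perpD(1)[OF v(2)]) auto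
    then have "cinner (Q (v n)) (Q (v i)) = 0" by (simp add: cinner_adj[OF bQ])
    then show "cinner (g n) (g i) = 0" by (simp add: g_def unitv_def cinner_simps)
  qed
  obtain K where K: "\<And>x. norm (Q x) \<le> norm x * K" using bounded_clinear_bound[OF bQ] by blast
  have "diagop c h h \<in> J" if c: "\<And>n. cmod (c n) \<le> t n" for c
  proof -
    define X where "X = diagop (\<lambda>n. 1) h v"
    define Y where "Y = diagop (\<lambda>n. c n / complex_of_real (t n)) g h"
    have cK: "cmod (c n) \<le> K" for n using c[of n] K[of "v n"] v(1) by (simp add: t_def)
    have c1: "cmod (c n / complex_of_real (t n)) \<le> 1" for n
      using c[of n] t[of n] by (simp add: norm_divide)
    have one: "cmod ((\<lambda>n. 1) n) \<le> 1" for n :: nat by simp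
    note bX = bounded_clinear_diagop[OF h(1) v_on one, folded X_def]
      and bY = bounded_clinear_diagop[where c = "\<lambda>n. c n / complex_of_real (t n)", OF g h(1) c1, folded Y_def]
      and bc = bounded_clinear_diagop[where c = c, OF h(1) h(1) cK]
    have b: "bounded_clinear (\<lambda>x. Y (Q (X x)) - diagop c h h x)"
      using bounded_clinear_minus[OF bounded_clinear_compose[OF bY bounded_clinear_compose[OF bQ bX]] bc] .
    have "range h \<subseteq> {x. Y (Q (X x)) - diagop c h h x = 0}"
    proof clarsimp
      fix n
      have "X (h n) = v n" using diagop_basis[OF h(1) v_on one] by (simp add: X_def scaleC_one)
      moreover have "Y (g n) = (c n / complex_of_real (t n)) *\<^sub>C h n"
        using diagop_basis[OF g h(1), where C = 1, OF c1] by (simp add: Y_def)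
      ultimately have "Y (Q (X (h n))) = c n *\<^sub>C h n"
        using t[of n] by (simp add: Qv clin_simps[OF bY] scaleC_scaleC)
      then show "Y (Q (X (h n))) = diagop c h h (h n)" using diagop_basis[OF h(1) h(1) cK] by simp
    qed
    then have "cls (range h) \<subseteq> {x. Y (Q (X x)) - diagop c h h x = 0}"
      by (rule cls_minimal[OF _ closed_csubspace_kernel[OF b]])
    then have "Y (Q (X x)) = diagop c h h x" for x using h(2) by auto
    then have "diagop c h h = Y \<otimes>\<^bsub>\<L>\<^esub> (Q \<otimes>\<^bsub>\<L>\<^esub> X)"
      by (auto simp: bounded_operators_def)
    moreover have "Y \<otimes>\<^bsub>\<L>\<^esub> (Q \<otimes>\<^bsub>\<L>\<^esub> X) \<in> J"
      by (intro ideal.I_l_closed[OF J] ideal.I_r_closed[OF J] Q(1)) (simp_all add: carr bX bY)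
    ultimately show ?thesis by simp
  qed
  then show ?thesis using t by blast
qed

text \<open>The isometry that carries \<open>h\<close> to \<open>p\<close> intertwines the two
  diagonal operators with the same entries.\<close>

lemma restrict_diagop_in_ideal_on:
  assumes h: "onseq h" "cls (range h) = UNIV" and p: "onseq p" and C: "\<And>n. cmod (c n) \<le> C"
    and J: "diagop c h h \<in> J"
  shows "restrict (diagop c p p) (cls (range p)) \<in> ideal_on J (cls (range p))"
proof -
  define U where "U = diagop (\<lambda>n. 1) h p"
  have U: "hilbert_iso_onto U (cls (range p))" unfolding U_def by (rule hilbert_iso_onto_diagop[OF h p])
  have one: "cmod ((\<lambda>n. 1) n) \<le> 1" for n :: nat by simp
  have cU: "cinner (U x) (p k) = cinner x (h k)" for x k
    using cinner_diagop[OF h(1) p one] by (simp add: U_def)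
  have Up: "U x \<in> cls (range p)" for x using diagop_in_cls[OF h(1) p one] by (simp add: U_def)
  have "U (diagop c h h x) = diagop c p p (U x)" for x
    by (rule cls_eqI[OF Up diagop_in_cls[OF p p C]])
      (auto simp: cU cinner_diagop[OF h(1) h(1) C] cinner_diagop[OF p p C])
  moreover have "U (inv_into UNIV U y) = y" if "y \<in> cls (range p)" for y
    using U that by (intro f_inv_into_f) (auto simp: hilbert_iso_onto_def)
  ultimately have "restrict (diagop c p p) (cls (range p)) = transport_op U (cls (range p)) (diagop c h h)"
    unfolding transport_op_def by (intro restrict_ext) simp
  then show ?thesis using U J unfolding ideal_on_def by blast
qed

lemma diagonalizable_normal_on_diagop:
  assumes p: "onseq p" and C: "\<And>n. cmod (c n) \<le> C"
  shows "diagonalizable_normal_on (cls (range p)) (restrict (diagop c p p) (cls (range p)))"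
proof -
  have "p m = p n \<longleftrightarrow> m = n" for m n using onseqD[OF p, of m n] onseqD[OF p, of n n] by (metis zero_neq_one)
  then have "orthonormal (range p)" unfolding orthonormal_def by (auto simp: onseqD[OF p])
  moreover have "restrict (diagop c p p) (cls (range p)) (p n) = c n *\<^sub>C p n" for n
    using subsetD[OF cls_superset rangeI, of p n] by (simp add: diagop_basis[OF p p C])
  ultimately show ?thesis
    unfolding diagonalizable_normal_on_def orthonormal_basis_of_def cls_def[symmetric] by blast
qed

lemma onorm_on_diagop_le:
  assumes p: "onseq p" and C: "\<And>n. cmod (c n) \<le> C" and M: "csubspace M"
  shows "onorm_on M (restrict (diagop c p p) M) \<le> C"
  unfolding onorm_on_def
proof (rule cSUP_least)
  show "M \<noteq> {}" using complex_vector.subspace_0[OF M] by blast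
  fix x assume x: "x \<in> M"
  have "0 \<le> C" using C[of 0] norm_ge_zero order_trans by blast
  \<comment> \<open>At \<open>x = 0\<close> the quotient is 0 by the convention on division, so
    \<open>C\<close> must be nonnegative.\<close>
  then show "norm (restrict (diagop c p p) M x) / norm x \<le> C"
    using norm_diagop[OF p p C, where x = x] x by (cases "x = 0") (auto simp: field_simps)
qed

lemma infinite_cdim_onseq:
  assumes p: "onseq p" and M: "range p \<subseteq> M"
  shows "infinite_cdim M"
  unfolding infinite_cdim_def
proof
  assume "\<exists>B. finite B \<and> M \<subseteq> cspan B"
  then obtain B where B: "finite B" "M \<subseteq> cspan B" by blast
  have neq: "p m = p n \<longleftrightarrow> m = n" for m n using onseqD[OF p, of m n] onseqD[OF p, of n n] by (metis zero_neq_one)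
  have "\<not> complex_vector.dependent (range p)"
    unfolding complex_vector.dependent_def
  proof
    assume "\<exists>a\<in>range p. a \<in> cspan (range p - {a})"
    then obtain n where n: "p n \<in> cspan (range p - {p n})" by blast
    have "cspan (range p - {p n}) \<subseteq> perp {p n}"
      by (rule complex_vector.span_minimal[OF _ closed_csubspaceD(1)[OF closed_csubspace_perp]])
        (auto simp: perp_def onseqD[OF p])
    then have "cinner (p n) (p n) = 0" using perpD(1)[OF subsetD[OF _ n]] by blast
    then show False using onseqD[OF p, of n n] by simp
  qed
  moreover have "infinite (range p)" using neq by (intro range_inj_infinite) (auto simp: inj_def)
  ultimately show False
    using infinite_independent_not_in_finite_span[OF _ _ B(1)] order_trans[OF M B(2)] by blast
qed

section \<open>Matrix entries of a straightened operator\<close>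

lemma cls_singleton: "cls {e} = cspan {e}"
proof
  show "cspan {e} \<subseteq> cls {e}" unfolding cls_def by (rule closure_subset)
  show "cls {e} \<subseteq> cspan {e}"
  proof
    fix x assume x: "x \<in> cls {e}"
    have e: "e \<in> cls {e}" by (rule subsetD[OF cls_superset singletonI])
    have "x = (cinner x e / cinner e e) *\<^sub>C e"
      by (rule cls_eqI[OF x closed_csubspaceD(6)[OF closed_csubspace_cls e]]) (auto simp: cinner_simps)
    then show "x \<in> cspan {e}" by (metis complex_vector.span_base complex_vector.span_scale singletonI)
  qed
qed

lemma rank_le_1I: "(\<And>x. x \<in> N \<Longrightarrow> A x \<in> cls {e}) \<Longrightarrow> rank_le 1 N A"
  unfolding rank_le_def by (intro exI[of _ "{e}"]) (auto simp: cls_singleton)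

lemma orth_proj_eq_0: "closed_csubspace M \<Longrightarrow> x \<in> perp M \<Longrightarrow> orth_proj M x = 0"
  by (rule orth_proj_eqI) (auto simp: closed_csubspaceD perp_def)

text \<open>The first column is read off from the vectors \<open>A (p n)\<close>, the third row from
  the pairings of \<open>A x\<close> with \<open>q k\<close>. For \<open>x\<close> in the middle
  subspace these pairings involve \<open>x\<close> only through \<open>cinner x m\<close>.\<close>

lemma straight_matrix_entries:
  assumes A: "bounded_clinear A" and S: "straight A \<psi> u e m p l a q \<mu> b"
    and p: "onseq p" and q: "onseq q" and C: "\<And>n. cmod (l n) \<le> C" "\<And>n. cmod (\<mu> n) \<le> C"
  defines "M1 \<equiv> cls (range p)" and "M3 \<equiv> cls (range q)" and "M2 \<equiv> perp (range p \<union> range q)"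
  shows "matrix_entry M1 M1 A = restrict (diagop l p p) M1"
    and "matrix_entry M3 M3 A = restrict (diagop \<mu> q q) M3"
    and "rank_le 1 M1 (matrix_entry M2 M1 A)"
    and "rank_le 1 M1 (matrix_entry M3 M1 A)"
    and "rank_le 1 M2 (matrix_entry M3 M2 A)"
proof -
  have M: "closed_csubspace M1" "closed_csubspace M2" "closed_csubspace M3"
    by (simp_all add: M1_def M2_def M3_def closed_csubspace_cls closed_csubspace_perp)
  have pM: "p n \<in> M1" and qM: "q n \<in> M3" for n
    unfolding M1_def M3_def by (rule subsetD[OF cls_superset rangeI])+
  have Ap: "A (p n) = l n *\<^sub>C p n + a n *\<^sub>C e + cinner (p n) u *\<^sub>C \<psi>" for n
    using S by (simp add: straight_def coupled_def)
  have Aq: "cinner (A h) (q k) = \<mu> k * cinner h (q k) + cnj (b k) * cinner h m + cinner h u * cinner \<psi> (q k)" for h k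
    using S by (simp add: straight_def coupled_def)
  have em: "e \<in> perp (range p)" "m \<in> perp (range q)" "u \<in> M1" "\<psi> \<in> M3"
    using S by (auto simp: straight_def M1_def M3_def)
  have o: "cinner (p n) (q k) = 0" "cinner e (q k) = 0" "cinner (p n) m = 0" for n k
    using S by (auto simp: straight_def coupled_def)
  have perp13: "perp M1 = perp (range p)" "perp M3 = perp (range q)" by (simp_all add: M1_def M3_def perp_cls)
  have perp2: "x \<in> perp M2" if "x \<in> M1 \<or> x \<in> M3" for x
  proof -
    have "cls (range p) \<subseteq> cls (range p \<union> range q)" "cls (range q) \<subseteq> cls (range p \<union> range q)"
      by (rule cls_minimal[OF order_trans[OF _ cls_superset] closed_csubspace_cls], simp)+
    then show ?thesis using that unfolding M1_def M2_def M3_def perp_perp_cls by (auto dest: subsetD)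
  qed
  have M13: "M1 \<subseteq> perp (range q)" "M3 \<subseteq> perp (range p)"
    unfolding M1_def M3_def
    by (rule cls_minimal[OF _ closed_csubspace_perp];
        auto simp: perp_def o cinner_eq_0_commute[of "q _"])+
  have e2: "e \<in> M2" using em(1) o(2) by (auto simp: M2_def perp_def)
  have p1: "orth_proj M1 (A (p n)) = l n *\<^sub>C p n" for n
  proof -
    have "orth_proj M1 e = 0" "orth_proj M1 \<psi> = 0"
      using em M13 by (auto intro!: orth_proj_eq_0[OF M(1)] simp: perp13)
    then show ?thesis
      by (simp add: Ap clin_simps[OF bounded_clinear_orth_proj[OF M(1)]] orth_proj_id[OF M(1) pM])
  qed
  have p2: "orth_proj M2 (A (p n)) = a n *\<^sub>C e" for n
  proof -
    have "orth_proj M2 (p n) = 0" "orth_proj M2 \<psi> = 0"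
      using em pM by (auto intro!: orth_proj_eq_0[OF M(2)] perp2)
    then show ?thesis
      by (simp add: Ap clin_simps[OF bounded_clinear_orth_proj[OF M(2)]] orth_proj_id[OF M(2) e2])
  qed
  have p3: "orth_proj M3 (A (p n)) = cinner (p n) u *\<^sub>C \<psi>" for n
  proof -
    have "p n \<in> perp M3" "e \<in> perp M3"
      unfolding perp13 using M13(1) pM o(2) by (auto simp: perp_def)
    then have "orth_proj M3 (p n) = 0" "orth_proj M3 e = 0"
      by (auto intro!: orth_proj_eq_0[OF M(3)])
    then show ?thesis
      by (simp add: Ap clin_simps[OF bounded_clinear_orth_proj[OF M(3)]] orth_proj_id[OF M(3) em(4)])
  qed
  note bA = bounded_clinear_compose[OF bounded_clinear_orth_proj A]
  have "cls (range p) \<subseteq> {x. orth_proj M1 (A x) - diagop l p p x = 0}"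
  proof (rule cls_minimal)
    show "range p \<subseteq> {x. orth_proj M1 (A x) - diagop l p p x = 0}"
      by (auto simp: p1 diagop_basis[OF p p C(1)])
    show "closed_csubspace {x. orth_proj M1 (A x) - diagop l p p x = 0}"
      by (rule closed_csubspace_kernel[OF bounded_clinear_minus[OF bA[OF M(1)] bounded_clinear_diagop[where c = l, OF p p C(1)]]])
  qed
  then show "matrix_entry M1 M1 A = restrict (diagop l p p) M1"
    unfolding matrix_entry_def by (intro restrict_ext) (auto simp: M1_def)
  have "M1 \<subseteq> {x. orth_proj M2 (A x) \<in> cls {e}}"
    unfolding M1_def
  proof (rule cls_minimal)
    have "e \<in> cls {e}" by (rule subsetD[OF cls_superset singletonI])
    then show "range p \<subseteq> {x. orth_proj M2 (A x) \<in> cls {e}}"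
      using closed_csubspaceD(6)[OF closed_csubspace_cls] by (auto simp: p2)
    show "closed_csubspace {x. orth_proj M2 (A x) \<in> cls {e}}"
      by (rule closed_csubspace_preimage[OF bA[OF M(2)] closed_csubspace_cls])
  qed
  then show "rank_le 1 M1 (matrix_entry M2 M1 A)"
    by (intro rank_le_1I[of _ _ e]) (auto simp: matrix_entry_def)
  have "M1 \<subseteq> {x. orth_proj M3 (A x) \<in> cls {\<psi>}}"
    unfolding M1_def
  proof (rule cls_minimal)
    have "\<psi> \<in> cls {\<psi>}" by (rule subsetD[OF cls_superset singletonI])
    then show "range p \<subseteq> {x. orth_proj M3 (A x) \<in> cls {\<psi>}}"
      using closed_csubspaceD(6)[OF closed_csubspace_cls] by (auto simp: p3)
    show "closed_csubspace {x. orth_proj M3 (A x) \<in> cls {\<psi>}}"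
      by (rule closed_csubspace_preimage[OF bA[OF M(3)] closed_csubspace_cls])
  qed
  then show "rank_le 1 M1 (matrix_entry M3 M1 A)"
    by (intro rank_le_1I[of _ _ \<psi>]) (auto simp: matrix_entry_def)
  have P3: "cinner (orth_proj M3 h) (q k) = cinner h (q k)" for h k by (rule cinner_orth_proj[OF M(3) qM])
  have "orth_proj M3 (A x) = diagop \<mu> q q x" if x: "x \<in> M3" for x
  proof (rule cls_eqI)
    show "orth_proj M3 (A x) \<in> cls (range q)" using orth_proj_in[OF M(3)] by (simp add: M3_def)
    show "diagop \<mu> q q x \<in> cls (range q)" by (rule diagop_in_cls[OF q q C(2)])
    have "m \<in> perp M3" using em(2) by (simp add: perp13)
    then have "cinner x m = 0" by (rule perpD(2)[OF _ x])
    moreover have "x \<in> perp M1" using x M13(2) by (auto simp: perp13)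
    then have "cinner x u = 0" by (rule perpD(1)[OF _ em(3)])
    ultimately show "cinner (orth_proj M3 (A x)) f = cinner (diagop \<mu> q q x) f" if "f \<in> range q" for f
      using that by (auto simp: P3 Aq cinner_diagop[OF q q C(2)])
  qed
  then show "matrix_entry M3 M3 A = restrict (diagop \<mu> q q) M3"
    unfolding matrix_entry_def by (intro restrict_ext) auto
  have "orth_proj M3 (A x) \<in> cls {orth_proj M3 (A m)}" if x: "x \<in> M2" for x
  proof -
    \<comment> \<open>All rows are multiples of the one at \<open>m\<close>. If \<open>m\<close> is
      0, division by zero makes \<open>?c\<close> equal to 0, and the left side vanishes
      too.\<close>
    let ?c = "cinner x m / cinner m m"
    have "orth_proj M3 (A x) = ?c *\<^sub>C orth_proj M3 (A m)"
    proof (rule cls_eqI[where F = "range q"])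
      show "orth_proj M3 (A x) \<in> cls (range q)" using orth_proj_in[OF M(3)] by (simp add: M3_def)
      show "?c *\<^sub>C orth_proj M3 (A m) \<in> cls (range q)"
        using closed_csubspaceD(6)[OF M(3) orth_proj_in[OF M(3)]] by (simp add: M3_def)
      have "x \<in> perp M1" using x unfolding perp13 M2_def by (auto simp: perp_def)
      then have xu: "cinner x u = 0" by (rule perpD(1)[OF _ em(3)])
      have "m \<in> perp M1" using o(3) unfolding perp13 by (auto simp: perp_def cinner_eq_0_commute[of m])
      then have mu: "cinner m u = 0" by (rule perpD(1)[OF _ em(3)])
      have xq: "cinner x (q k) = 0" "cinner m (q k) = 0" for k
        using x em(2) by (auto simp: M2_def perp_def)
      show "cinner (orth_proj M3 (A x)) f = cinner (?c *\<^sub>C orth_proj M3 (A m)) f" if "f \<in> range q" for f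
        using that by (auto simp: cinner_scaleC_left P3 Aq xu mu xq)
    qed
    moreover have "orth_proj M3 (A m) \<in> cls {orth_proj M3 (A m)}" by (rule subsetD[OF cls_superset singletonI])
    ultimately show ?thesis using closed_csubspaceD(6)[OF closed_csubspace_cls] by simp
  qed
  then show "rank_le 1 M2 (matrix_entry M3 M2 A)"
    by (intro rank_le_1I[of _ _ "orth_proj M3 (A m)"]) (auto simp: matrix_entry_def)
qed

theorem theorem3p1:
  fixes T' :: "'h::complex_hilbert_space \<Rightarrow> 'h"
    and \<epsilon> :: real
    and J :: "('h \<Rightarrow> 'h) set"
  assumes separable: "\<exists>D :: 'h set. countable D \<and> closure D = UNIV"
    and infinite_dimensional: "infinite_cdim (UNIV :: 'h set)"
    and T': "T' \<in> carrier \<L>"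
    and \<epsilon>: "\<epsilon> > 0"
    and J_ideal: "ideal J \<L>"
    and J_proper: "J \<noteq> carrier \<L>"
    and J_larger: "\<F> \<subset> J"
  shows "\<exists>\<beta> S M1 M2 M3.
    S \<in> Units \<L> \<and>
    closed_csubspace M1 \<and> closed_csubspace M2 \<and> closed_csubspace M3 \<and>
    infinite_cdim M1 \<and> infinite_cdim M2 \<and> infinite_cdim M3 \<and>
    mutually_orthogonal M1 M2 \<and> mutually_orthogonal M1 M3 \<and> mutually_orthogonal M2 M3 \<and>
    {x + y + z | x y z. x \<in> M1 \<and> y \<in> M2 \<and> z \<in> M3} = UNIV \<and>
    (let A = inv\<^bsub>\<L>\<^esub> S \<circ> (\<lambda>x. T' x - \<beta> *\<^sub>C x) \<circ> S;
         T11 = matrix_entry M1 M1 A;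
         T33 = matrix_entry M3 M3 A;
         R21 = matrix_entry M2 M1 A;
         R31 = matrix_entry M3 M1 A;
         R32 = matrix_entry M3 M2 A
     in T11 \<in> ideal_on J M1 \<and> T33 \<in> ideal_on J M3 \<and>
        onorm_on M1 T11 < \<epsilon> \<and> onorm_on M3 T33 < \<epsilon> \<and>
        rank_le 1 M1 R21 \<and> rank_le 1 M1 R31 \<and> rank_le 1 M2 R32 \<and>
        diagonalizable_normal_on M1 T11 \<and> diagonalizable_normal_on M3 T33)"
proof -
  obtain D :: "'h set" where D: "countable D" "closure D = UNIV" using separable by blast
  then have "D \<noteq> {}" by auto
  define f where "f = from_nat_into D"
  have f: "closure (range f) = UNIV" unfolding f_def range_from_nat_into[OF \<open>D \<noteq> {}\<close> D(1)] by (rule D(2))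
  obtain h :: "nat \<Rightarrow> 'h" where h: "onseq h" "cls (range h) = UNIV"
    using exists_orthonormal_basis[OF f infinite_dimensional] by blast
  obtain Q where Q: "Q \<in> J" "Q \<notin> \<F>" using J_larger by blast
  obtain t where t: "\<And>n. t n > 0" "\<And>c. (\<And>n. cmod (c n) \<le> t n) \<Longrightarrow> diagop c h h \<in> J"
    using diagonal_operators_in_ideal[OF h J_ideal Q] by blast
  \<comment> \<open>A running minimum decreases in \<open>n\<close>, so the bound
    \<open>d (2 * n)\<close> still yields \<open>t n\<close>. The cap \<open>\<epsilon> / 2\<close>
    leaves room for the strict norm inequality.\<close>
  define d where "d n = Min ((\<lambda>i. min (t i) (\<epsilon> / 2)) ` {..n})" for n
  have d0: "d n > 0" for n unfolding d_def using t(1) \<epsilon> by (subst Min_gr_iff) auto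
  have d_le: "d n \<le> min (t i) (\<epsilon> / 2)" if "i \<le> n" for i n
    unfolding d_def using that by (intro Min_le) auto
  have bT: "bounded_clinear T'" using T' by (simp add: bounded_operators_def)
  obtain \<beta> where \<beta>: "near_regular (\<lambda>x. T' x - \<beta> *\<^sub>C x)" "\<not> riesz_point (\<lambda>x. T' x - \<beta> *\<^sub>C x)"
    using exists_essential_boundary_point[OF bT infinite_dimensional] by blast
  define A where "A x = T' x - \<beta> *\<^sub>C x" for x
  have bA: "bounded_clinear A"
    unfolding A_def[abs_def] by (rule bounded_clinear_minus[OF bT bounded_clinear_scale])
  have "has_two_sided_system A d"
    by (rule has_two_sided_system_of_near_regular[OF bA _ _ f d0])
      (use \<beta> in \<open>simp_all add: A_def[abs_def]\<close>)
  from has_straight_form[OF bA this] obtain S S' :: "'h \<Rightarrow> 'h" and \<psi> u e m p l a q \<mu> b r where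
    S: "inverse_pair S S'" and st: "straight (\<lambda>h. S' (A (S h))) \<psi> u e m p l a q \<mu> b"
    and p: "onseq p" and q: "onseq q" and r: "onseq r"
    and "\<forall>n k. cinner (r n) (p k) = 0" "\<forall>n k. cinner (r n) (q k) = 0"
      "\<forall>n. cmod (l n) \<le> d (2 * n)" "\<forall>n. cmod (\<mu> n) \<le> d n"
    by (elim exE conjE) (rule that)
  then have rp: "cinner (r n) (p k) = 0" and rq: "cinner (r n) (q k) = 0"
    and l: "cmod (l n) \<le> d (2 * n)" and \<mu>: "cmod (\<mu> n) \<le> d n" for n k
    by simp_all
  have Sb: "bounded_clinear S" "bounded_clinear S'" "S \<circ> S' = id" "S' \<circ> S = id"
    using S by (auto simp: inverse_pair_def)
  interpret ring "\<L> :: ('h \<Rightarrow> 'h) ring" by (rule ring_bounded_operators)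
  have SL: "S \<in> carrier \<L>" "S' \<in> carrier \<L>" "S \<otimes>\<^bsub>\<L>\<^esub> S' = \<one>\<^bsub>\<L>\<^esub>" "S' \<otimes>\<^bsub>\<L>\<^esub> S = \<one>\<^bsub>\<L>\<^esub>"
    using Sb by (simp_all add: bounded_operators_def)
  have SU: "S \<in> Units \<L>" unfolding Units_def using SL by blast
  have inv: "inv\<^bsub>\<L>\<^esub> S = S'" by (rule inv_char[OF SL])
  define B where "B = inv\<^bsub>\<L>\<^esub> S \<circ> (\<lambda>x. T' x - \<beta> *\<^sub>C x) \<circ> S"
  have B: "B = (\<lambda>h. S' (A (S h)))" by (auto simp: B_def inv A_def)
  have bB: "bounded_clinear B"
    unfolding B by (rule bounded_clinear_compose[OF Sb(2) bounded_clinear_compose[OF bA Sb(1)]])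
  have l_le: "cmod (l n) \<le> t n" "cmod (l n) \<le> \<epsilon> / 2" and \<mu>_le: "cmod (\<mu> n) \<le> t n" "cmod (\<mu> n) \<le> \<epsilon> / 2" for n
    using l[of n] \<mu>[of n] d_le[of n "2 * n"] d_le[of n n] by auto
  define M1 M2 M3 where "M1 = cls (range p)" and "M2 = perp (range p \<union> range q)" and "M3 = cls (range q)"
  have M: "closed_csubspace M1" "closed_csubspace M2" "closed_csubspace M3"
    by (simp_all add: M1_def M2_def M3_def closed_csubspace_cls closed_csubspace_perp)
  have pM: "range p \<subseteq> M1" and qM: "range q \<subseteq> M3"
    unfolding M1_def M3_def by (rule cls_superset)+
  \<comment> \<open>\<open>M2\<close> is defined as a complement and could be small; the vectors set
    aside by \<open>has_straight_form\<close> guarantee its infinite dimension.\<close>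
  have "range r \<subseteq> M2" using rp rq by (auto simp: M2_def perp_def)
  then have inf: "infinite_cdim M1" "infinite_cdim M2" "infinite_cdim M3"
    using infinite_cdim_onseq[OF p pM] infinite_cdim_onseq[OF r] infinite_cdim_onseq[OF q qM] by auto
  have pq: "cinner (p n) (q k) = 0" for n k using st by (simp add: straight_def coupled_def)
  have M13: "cinner x y = 0" if "x \<in> M1" "y \<in> M3" for x y
    by (rule cls_orth[OF _ that[unfolded M1_def M3_def]]) (auto simp: pq)
  have M2p: "M2 \<subseteq> perp M1" "M2 \<subseteq> perp M3" unfolding M1_def M2_def M3_def perp_cls by (auto simp: perp_def)
  have mo: "mutually_orthogonal M1 M2" "mutually_orthogonal M1 M3" "mutually_orthogonal M2 M3"
    unfolding mutually_orthogonal_def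
    using M13 perpD(2)[OF subsetD[OF M2p(1)]] perpD(1)[OF subsetD[OF M2p(2)]] by auto
  have dec: "{x + y + z | x y z. x \<in> M1 \<and> y \<in> M2 \<and> z \<in> M3} = UNIV"
  proof (intro equalityI subsetI)
    fix x :: 'h
    let ?y = "x - orth_proj M1 x - orth_proj M3 x"
    have "cinner (orth_proj M3 x) g = 0" if "g \<in> range p" for g
      using M13[of g "orth_proj M3 x"] that pM orth_proj_in[OF M(3)] cinner_eq_0_commute[of g] by auto
    moreover have "cinner (orth_proj M1 x) g = 0" if "g \<in> range q" for g
      using M13[OF orth_proj_in[OF M(1)]] that qM by auto
    ultimately have "?y \<in> M2"
      unfolding M2_def using pM qM
      by (intro perp_memI) (auto simp: cinner_diff_left cinner_orth_proj[OF M(1)] cinner_orth_proj[OF M(3)] image_subset_iff)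
    moreover have "x = orth_proj M1 x + ?y + orth_proj M3 x" by simp
    ultimately show "x \<in> {x + y + z | x y z. x \<in> M1 \<and> y \<in> M2 \<and> z \<in> M3}"
      using orth_proj_in[OF M(1)] orth_proj_in[OF M(3)] by blast
  qed simp
  note ent = straight_matrix_entries[OF bB st[folded B] p q l_le(2) \<mu>_le(2), folded M1_def M2_def M3_def]
  have "matrix_entry M1 M1 B \<in> ideal_on J M1" "matrix_entry M3 M3 B \<in> ideal_on J M3"
    unfolding ent(1,2)
    using restrict_diagop_in_ideal_on[where c = l, OF h p l_le(2) t(2)[OF l_le(1)]]
      restrict_diagop_in_ideal_on[where c = \<mu>, OF h q \<mu>_le(2) t(2)[OF \<mu>_le(1)]]
    by (simp_all add: M1_def M3_def)
  moreover have "onorm_on M1 (matrix_entry M1 M1 B) < \<epsilon>" "onorm_on M3 (matrix_entry M3 M3 B) < \<epsilon>"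
    unfolding ent(1,2)
    using onorm_on_diagop_le[where c = l, OF p l_le(2) closed_csubspaceD(1)[OF M(1)]]
      onorm_on_diagop_le[where c = \<mu>, OF q \<mu>_le(2) closed_csubspaceD(1)[OF M(3)]] \<epsilon> by auto
  moreover have "diagonalizable_normal_on M1 (matrix_entry M1 M1 B)"
    "diagonalizable_normal_on M3 (matrix_entry M3 M3 B)"
    unfolding ent(1,2)
    using diagonalizable_normal_on_diagop[where c = l, OF p l_le(2)] diagonalizable_normal_on_diagop[where c = \<mu>, OF q \<mu>_le(2)]
    by (simp_all add: M1_def M3_def)
  ultimately show ?thesis
    using SU M inf mo dec ent(3-5)
    by (intro exI[of _ \<beta>] exI[of _ S] exI[of _ M1] exI[of _ M2] exI[of _ M3])
      (simp add: B_def[symmetric])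
qed

end
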